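(* (Inner bound, decode-and-forward, one confidential and one common message.) Let $(U,V,X,X_1,Y,Y_1,Z)$ be random variables on finite alphabets with joint distribution of the form $P_{Y,Z,Y_1|X,X_1}(y,z,y_1|x,x_1)\,P_{X,X_1|U,V}(x,x_1|u,v)\,P_{U,V}(u,v)$, with $P_{Y,Z,Y_1|X,X_1}$ the channel. Write $M=\min\{I(U;Y_1|X_1),I(U,X_1;Y),I(U,X_1;Z)\}$. Then every triple $(R_0,R_1,R_e)$ of positive reals with $$R_e\le R_1,\quad R_0\le M,\quad R_0+R_1\le M+I(V;Y|U,X_1),\quad R_e\le I(V;Y|U,X_1)-I(V;Z|U,X_1)$$ belongs to $\mathcal R^{(C)}$.
   Context: Discrete memoryless relay broadcast channel with one confidential message and one common message: finite alphabets $\mathcal X,\mathcal X_1,\mathcal Y,\mathcal Y_1,\mathcal Z$ and a transition probability $p(y,y_1,z|x,x_1)$, used memorylessly over $N$ channel uses. $X$ is the transmitter input, $X_1$ the relay input, $Y$ the output at receiver 1, $Y_1$ the output at the relay, $Z$ the output at receiver 2. Messages $W_0$ (common) and $W_1$ (confidential) are independent and uniform over finite sets $\mathcal W_0,\mathcal W_1$. A code of length $N$: a stochastic encoder mapping $(w_0,w_1)$ to $x^N$; a stochastic relay encoder producing $x_{1,i}$ from $(y_{1,1},\dots,y_{1,i-1})$; a decoder at receiver 1 mapping $y^N$ to an estimate of $(W_0,W_1)$ with error probability $P_{e1}$; a decoder at receiver 2 mapping $z^N$ to an estimate of $W_0$ with error probability $P_{e2}$. Equivocation $\Delta=\frac1N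 H(W_1|Z^N)$. A triple $(R_0,R_1,R_e)$ of positive reals is achievable if for every $\epsilon>0$ there exist codes with $\lim_N\frac{\log|\mathcal W_j|}{N}=R_j$ ($j=0,1$), $\lim_N\Delta\ge R_e$, $P_{e1},P_{e2}\le\epsilon$. $\mathcal R^{(C)}$ is the set of achievable triples. Logarithms are base 2. *)

theory Defs
  imports "HOL-Probability.Probability"
begin

definition entropy_pmf :: "'a pmf \<Rightarrow> real" where
  "entropy_pmf p = - (\<Sum>a\<in>set_pmf p. pmf p a * log 2 (pmf p a))"

definition Ent :: "'w pmf \<Rightarrow> ('w \<Rightarrow> 'a) \<Rightarrow> real" where
  "Ent q f = entropy_pmf (map_pmf f q)"

definition cEnt :: "'w pmf \<Rightarrow> ('w \<Rightarrow> 'a) \<Rightarrow> ('w \<Rightarrow> 'b) \<Rightarrow> real" where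
  "cEnt q f g = Ent q (\<lambda>w. (f w, g w)) - Ent q g"

definition MI :: "'w pmf \<Rightarrow> ('w \<Rightarrow> 'a) \<Rightarrow> ('w \<Rightarrow> 'b) \<Rightarrow> real" where
  "MI q f g = Ent q f + Ent q g - Ent q (\<lambda>w. (f w, g w))"

definition cMI :: "'w pmf \<Rightarrow> ('w \<Rightarrow> 'a) \<Rightarrow> ('w \<Rightarrow> 'b) \<Rightarrow> ('w \<Rightarrow> 'c) \<Rightarrow> real" where
  "cMI q f g h = Ent q (\<lambda>w. (f w, h w)) + Ent q (\<lambda>w. (g w, h w))
                 - Ent q (\<lambda>w. (f w, g w, h w)) - Ent q h"

record ('x, 'x1, 'y, 'y1, 'z) rbc_code =
  nW0 :: nat                               \<comment> \<open>|W0|, messages {..<nW0}\<close>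
  nW1 :: nat                               \<comment> \<open>|W1|, messages {..<nW1}\<close>
  enc :: "nat \<Rightarrow> nat \<Rightarrow> 'x list pmf"
  relay :: "'y1 list \<Rightarrow> 'x1 pmf"          \<comment> \<open>x_{1,i} from (y_{1,1},...,y_{1,i-1})\<close>
  dec1 :: "'y list \<Rightarrow> nat \<times> nat"
  dec2 :: "'z list \<Rightarrow> nat"

primrec run_channel ::
  "('x \<Rightarrow> 'x1 \<Rightarrow> ('y \<times> 'y1 \<times> 'z) pmf) \<Rightarrow> ('y1 list \<Rightarrow> 'x1 pmf) \<Rightarrow> 'x list \<Rightarrow> 'y1 list
     \<Rightarrow> ('y list \<times> 'z list) pmf" where
  "run_channel W r [] past = return_pmf ([], [])"
| "run_channel W r (x # xs) past =
     bind_pmf (r past) (\<lambda>x1. bind_pmf (W x x1) (\<lambda>(y, y1, z).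
       map_pmf (\<lambda>(ys, zs). (y # ys, z # zs)) (run_channel W r xs (past @ [y1]))))"

definition code_joint ::
  "('x \<Rightarrow> 'x1 \<Rightarrow> ('y \<times> 'y1 \<times> 'z) pmf) \<Rightarrow> ('x, 'x1, 'y, 'y1, 'z) rbc_code
     \<Rightarrow> (nat \<times> nat \<times> 'y list \<times> 'z list) pmf" where
  "code_joint W c =
     bind_pmf (pmf_of_set {..<nW0 c}) (\<lambda>w0.
     bind_pmf (pmf_of_set {..<nW1 c}) (\<lambda>w1.
     bind_pmf (enc c w0 w1) (\<lambda>xs.
     map_pmf (\<lambda>(ys, zs). (w0, w1, ys, zs)) (run_channel W (relay c) xs []))))"

definition valid_code :: "nat \<Rightarrow> ('x, 'x1, 'y, 'y1, 'z) rbc_code \<Rightarrow> bool" where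
  "valid_code N c \<longleftrightarrow> nW0 c \<ge> 1 \<and> nW1 c \<ge> 1 \<and>
     (\<forall>w0<nW0 c. \<forall>w1<nW1 c. \<forall>xs\<in>set_pmf (enc c w0 w1). length xs = N)"

definition Pe1 :: "('x \<Rightarrow> 'x1 \<Rightarrow> ('y \<times> 'y1 \<times> 'z) pmf) \<Rightarrow> ('x, 'x1, 'y, 'y1, 'z) rbc_code \<Rightarrow> real" where
  "Pe1 W c = measure_pmf.prob (code_joint W c)
              {(w0, w1, ys, zs). dec1 c ys \<noteq> (w0, w1)}"

definition Pe2 :: "('x \<Rightarrow> 'x1 \<Rightarrow> ('y \<times> 'y1 \<times> 'z) pmf) \<Rightarrow> ('x, 'x1, 'y, 'y1, 'z) rbc_code \<Rightarrow> real" where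
  "Pe2 W c = measure_pmf.prob (code_joint W c)
              {(w0, w1, ys, zs). dec2 c zs \<noteq> w0}"

definition equivocation ::
  "('x \<Rightarrow> 'x1 \<Rightarrow> ('y \<times> 'y1 \<times> 'z) pmf) \<Rightarrow> nat \<Rightarrow> ('x, 'x1, 'y, 'y1, 'z) rbc_code \<Rightarrow> real" where
  "equivocation W N c =
     cEnt (code_joint W c) (\<lambda>(w0, w1, ys, zs). w1) (\<lambda>(w0, w1, ys, zs). zs) / real N"

definition achievable ::
  "('x \<Rightarrow> 'x1 \<Rightarrow> ('y \<times> 'y1 \<times> 'z) pmf) \<Rightarrow> real \<times> real \<times> real \<Rightarrow> bool" where
  "achievable W R \<longleftrightarrow> (case R of (R0, R1, Req) \<Rightarrow>
     R0 > 0 \<and> R1 > 0 \<and> Req > 0 \<and>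
     (\<forall>\<epsilon>>0. \<exists>code :: nat \<Rightarrow> ('x, 'x1, 'y, 'y1, 'z) rbc_code.
        (\<forall>N. valid_code N (code N)) \<and>
        (\<lambda>N. log 2 (real (nW0 (code N))) / real N) \<longlonglongrightarrow> R0 \<and>
        (\<lambda>N. log 2 (real (nW1 (code N))) / real N) \<longlonglongrightarrow> R1 \<and>
        liminf (\<lambda>N. ereal (equivocation W N (code N))) \<ge> ereal Req \<and>
        (\<forall>\<^sub>F N in sequentially. Pe1 W (code N) \<le> \<epsilon> \<and> Pe2 W (code N) \<le> \<epsilon>)))"

definition capacity_region ::
  "('x \<Rightarrow> 'x1 \<Rightarrow> ('y \<times> 'y1 \<times> 'z) pmf) \<Rightarrow> (real \<times> real \<times> real) set" where
  "capacity_region W = {R. achievable W R}"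

definition single_letter ::
  "('x \<Rightarrow> 'x1 \<Rightarrow> ('y \<times> 'y1 \<times> 'z) pmf) \<Rightarrow> ('u \<times> 'v) pmf \<Rightarrow> ('u \<Rightarrow> 'v \<Rightarrow> ('x \<times> 'x1) pmf)
     \<Rightarrow> ('u \<times> 'v \<times> 'x \<times> 'x1 \<times> 'y \<times> 'y1 \<times> 'z) pmf" where
  "single_letter W PUV PX =
     bind_pmf PUV (\<lambda>(u, v). bind_pmf (PX u v) (\<lambda>(x, x1).
       map_pmf (\<lambda>(y, y1, z). (u, v, x, x1, y, y1, z)) (W x x1)))"

end

theory Submission
  imports Defs "HOL-Real_Asymp.Real_Asymp"
begin

text \<open>
  Decode-and-forward with block Markov superposition coding. Relay words, cloud words and
  satellite words are drawn at random; all decoders compare an information density with a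
  threshold, so their errors are controlled by Chebyshev's inequality and by pairwise
  independence of codewords, without typical sequences. The confidential message is hidden by
  soft covering: each of its values labels at least \<open>2 powr (n * I(V;Z|U,X1))\<close> satellites, hence
  barely changes the law of the block received by the second receiver.

  Over \<open>B\<close> blocks the relay forwards the cloud index of the previous block, and the receivers
  decode the cloud indices backwards. As long as no block fails, the system is
  indistinguishable from an ideal one in which the relay knows the index, and there block
  likelihoods multiply. Averaging a weighted sum of failure and
  leakage over the codebook gives one that is good for both.
\<close>

section \<open>Finitely supported distributions\<close>

text \<open>The satellite index has three components. The first carries the protected part of the
  confidential message, at a rate just below \<open>Req\<close>; the second carries further
  confidential message; the third is a dummy drawn by the encoder. The last two together form the
  mask. Their joint rate is I(V;Y|U,X1) - \<open>Req\<close>, and soft covering asks for at least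
  I(V;Z|U,X1): this is precisely the last hypothesis on \<open>Req\<close>. Confidential message
  that does not fit into the satellites goes into the clouds, which every terminal decodes and which
  are therefore counted as known to the eavesdropper.

  The obstacle is feedback: the relay input depends on a noisy past, so the true output law does not
  factor over letters. Probabilities are therefore compared outcome by outcome, and only where all
  decoders succeed. Equivocation, however, is an average over all outcomes, so the entropy bound
  must tolerate restriction to an event, and the leakage must be a nonnegative quantity that can be
  averaged without that restriction. One codebook serves all blocks; \<open>B\<close> is fixed
  before \<open>n\<close> grows, so a union bound over blocks suffices.\<close>

abbreviation expect :: "'a pmf \<Rightarrow> ('a \<Rightarrow> real) \<Rightarrow> real" where
  "expect p f \<equiv> measure_pmf.expectation p f"

lemma integrable_fin [simp]:
  "finite (set_pmf p) \<Longrightarrow> integrable (measure_pmf p) (f :: _ \<Rightarrow> real)"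
  by (rule integrable_measure_pmf_finite)

lemma expect_sum_pmf:
  assumes "finite (set_pmf p)"
  shows "expect p f = (\<Sum>x\<in>set_pmf p. pmf p x * f x)"
  using integral_measure_pmf_real[OF assms, of p f] by (simp add: mult.commute)

lemma expect_cong:
  assumes "\<And>x. x \<in> set_pmf p \<Longrightarrow> f x = g x"
  shows "expect p f = expect p g"
  using assms by (intro integral_cong_AE) (auto simp: AE_measure_pmf_iff)

lemma expect_bind:
  assumes "finite (set_pmf p)" "\<And>x. x \<in> set_pmf p \<Longrightarrow> finite (set_pmf (K x))"
  shows "expect (bind_pmf p K) f = expect p (\<lambda>x. expect (K x) f)"
  using assms by (subst pmf_expectation_bind[where A="set_pmf p"]) (auto simp: expect_sum_pmf)

lemma expect_mono:
  assumes "finite (set_pmf p)" "\<And>x. x \<in> set_pmf p \<Longrightarrow> f x \<le> g x"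
  shows "expect p f \<le> expect p g"
  using assms by (intro integral_mono_AE) (auto simp: AE_measure_pmf_iff)

lemma expect_le_const:
  assumes "finite (set_pmf p)" "\<And>x. x \<in> set_pmf p \<Longrightarrow> f x \<le> c"
  shows "expect p f \<le> c"
  using expect_mono[of p f "\<lambda>_. c"] assms by simp

lemma expect_ge_const:
  assumes "finite (set_pmf p)" "\<And>x. x \<in> set_pmf p \<Longrightarrow> c \<le> f x"
  shows "c \<le> expect p f"
  using expect_mono[of p "\<lambda>_. c" f] assms by simp

lemma expect_add:
  assumes "finite (set_pmf p)"
  shows "expect p (\<lambda>x. f x + g x) = expect p f + expect p g"
  using assms by simp

lemma expect_sum:
  assumes "finite (set_pmf p)"
  shows "expect p (\<lambda>x. \<Sum>i\<in>I. f i x) = (\<Sum>i\<in>I. expect p (f i))"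
  using assms by simp

lemma expect_swap:
  assumes "finite (set_pmf p)" "finite (set_pmf q)"
  shows "expect p (\<lambda>x. expect q (f x)) = expect q (\<lambda>y. expect p (\<lambda>x. f x y))"
  using assms by (simp add: expect_sum_pmf sum_distrib_left sum.swap[of _ "set_pmf p"] algebra_simps)

lemma prob_expect: "measure_pmf.prob p A = expect p (\<lambda>x. of_bool (x \<in> A))"
proof -
  have "(\<lambda>x. of_bool (x \<in> A) :: real) = indicat_real A"
    by (auto simp: indicator_def)
  then show ?thesis by simp
qed

text \<open>Derandomisation. The witness lies in the support because the chosen codebook must
  inherit the layer structure of the random one.\<close>

lemma exists_le_expect:
  assumes "finite (set_pmf p)" "expect p f \<le> \<beta>"
  shows "\<exists>x\<in>set_pmf p. f x \<le> \<beta>"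
proof (rule ccontr)
  assume "\<not> ?thesis"
  then have *: "\<And>x. x \<in> set_pmf p \<Longrightarrow> \<beta> < f x" by force
  have "(\<Sum>x\<in>set_pmf p. pmf p x * \<beta>) < (\<Sum>x\<in>set_pmf p. pmf p x * f x)"
    using assms * by (intro sum_strict_mono) (auto simp: set_pmf_not_empty pmf_positive)
  moreover have "(\<Sum>x\<in>set_pmf p. pmf p x * \<beta>) = \<beta>"
    using sum_pmf_eq_1[OF assms(1) order_refl] by (simp flip: sum_distrib_right)
  ultimately show False using assms by (simp add: expect_sum_pmf)
qed

lemma finite_set_Pi_pmf [simp]:
  assumes "finite A" "\<And>i. i \<in> A \<Longrightarrow> finite (set_pmf (p i))"
  shows "finite (set_pmf (Pi_pmf A d p))"
  using assms by (simp add: set_Pi_pmf finite_PiE_dflt)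

lemma expect_Pi_1:
  assumes "finite A" "i \<in> A"
  shows "expect (Pi_pmf A d p) (\<lambda>f. F (f i)) = expect (p i) F"
  using integral_map_pmf[of "\<lambda>f. f i" "Pi_pmf A d p" F] assms by (simp add: Pi_pmf_component)

lemma expect_Pi_insert:
  assumes "finite A" "i \<in> A" "\<And>i. i \<in> A \<Longrightarrow> finite (set_pmf (p i))"
  shows "expect (Pi_pmf A d p) F = expect (p i) (\<lambda>x. expect (Pi_pmf (A - {i}) d p) (\<lambda>f. F (f(i := x))))"
proof -
  have A: "A = insert i (A - {i})" using assms by auto
  have "finite (set_pmf (p i))" using assms by blast
  moreover have "finite (set_pmf (Pi_pmf (A - {i}) d p))"
    using assms(1,3) by (intro finite_set_Pi_pmf) blast+
  ultimately show ?thesis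
    using assms(1) by (subst A, subst Pi_pmf_insert') (auto simp: expect_bind)
qed

lemma expect_Pi_2:
  assumes "finite A" "i \<in> A" "j \<in> A" "i \<noteq> j" "\<And>i. i \<in> A \<Longrightarrow> finite (set_pmf (p i))"
  shows "expect (Pi_pmf A d p) (\<lambda>f. F (f i) (f j)) = expect (p i) (\<lambda>x. expect (p j) (F x))"
  using assms by (subst expect_Pi_insert[of A i]) (auto simp: expect_Pi_1)

text \<open>Markov's inequality for the likelihood ratio \<open>P / Q\<close>, whose mean under
  \<open>Q\<close> is at most 1.\<close>

lemma false_alarm:
  fixes T :: real
  assumes "finite (set_pmf Q)" "T > 0"
  shows "expect Q (\<lambda>y. of_bool (T * pmf Q y < pmf P y)) \<le> 1 / T"
proof -
  have "expect Q (\<lambda>y. of_bool (T * pmf Q y < pmf P y)) \<le> (\<Sum>y\<in>set_pmf Q. pmf P y / T)"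
    unfolding expect_sum_pmf[OF assms(1)] using assms(2)
    by (intro sum_mono) (auto simp: field_simps)
  also have "\<dots> \<le> 1 / T"
    using assms measure_measure_pmf_finite[OF assms(1), of P, symmetric]
    by (simp add: divide_right_mono measure_pmf.prob_le_1 flip: sum_divide_distrib)
  finally show ?thesis .
qed

lemma false_alarm_averaged:
  fixes T :: real
  assumes "finite (set_pmf Q)" "finite (set_pmf p)" "T > 0"
  shows "expect Q (\<lambda>y. expect p (\<lambda>b. of_bool (T * pmf Q y < pmf (R b) y))) \<le> 1 / T"
  using assms by (subst expect_swap) (auto intro!: expect_le_const false_alarm)

text \<open>Concavity of the logarithm. The tangent point \<open>m\<close> stays free: it will be 1,
  or an upper bound of a mean, which yields Jensen's inequality with the mean replaced by that
  bound.\<close>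

lemma log2_tangent:
  fixes x m :: real
  assumes "x > 0" "m > 0"
  shows "log 2 x \<le> log 2 m + (x - m) / (m * ln 2)"
proof -
  have "ln (x / m) \<le> x / m - 1" using assms by (intro ln_le_minus_one) auto
  then have "ln x \<le> ln m + (x - m) / m" using assms by (simp add: ln_div diff_divide_distrib)
  then have "ln x / ln 2 \<le> (ln m + (x - m) / m) / ln 2" by (intro divide_right_mono) auto
  then show ?thesis by (simp add: log_def add_divide_distrib)
qed

section \<open>Superposition codebooks\<close>

text \<open>The layers are abstract and no block length occurs: later \<open>pA\<close>,
  \<open>KB\<close>, \<open>KC\<close> and \<open>Ch\<close> are laws and kernels on words. The
  output depends on the satellite alone, since a satellite will carry the letters of the layers
  above it.\<close>

locale superposition =
  fixes pA :: "'a pmf" and KB :: "'a \<Rightarrow> 'b pmf" and KC :: "'b \<Rightarrow> 'c pmf"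
    and Ch :: "'c \<Rightarrow> 'o pmf"
    and Ws :: "'w set" and Ss :: "'s set" and Js :: "'j set"
  assumes fin_pA [simp]: "finite (set_pmf pA)"
    and fin_KB [simp]: "\<And>a. finite (set_pmf (KB a))"
    and fin_KC [simp]: "\<And>b. finite (set_pmf (KC b))"
    and fin_Ch [simp]: "\<And>c. finite (set_pmf (Ch c))"
    and fin_Ws [simp]: "finite Ws" and fin_Ss [simp]: "finite Ss" and fin_Js [simp]: "finite Js"
begin

text \<open>\<open>f\<close> selects what one terminal sees of the output, so the same laws serve
  the relay and both receivers.\<close>

definition chan_c :: "('o \<Rightarrow> 'r) \<Rightarrow> 'c \<Rightarrow> 'r pmf" where "chan_c f c = map_pmf f (Ch c)"
definition chan_b :: "('o \<Rightarrow> 'r) \<Rightarrow> 'b \<Rightarrow> 'r pmf" where "chan_b f b = bind_pmf (KC b) (chan_c f)"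
definition chan_a :: "('o \<Rightarrow> 'r) \<Rightarrow> 'a \<Rightarrow> 'r pmf" where "chan_a f a = bind_pmf (KB a) (chan_b f)"
definition chan_0 :: "('o \<Rightarrow> 'r) \<Rightarrow> 'r pmf" where "chan_0 f = bind_pmf pA (chan_a f)"

lemma fin_chan [simp]:
  "finite (set_pmf (chan_c f c))" "finite (set_pmf (chan_b f b))"
  "finite (set_pmf (chan_a f a))" "finite (set_pmf (chan_0 f))"
  by (auto simp: chan_c_def chan_b_def chan_a_def chan_0_def)

lemma expect_chan_c: "expect (chan_c f c) F = expect (Ch c) (\<lambda>r. F (f r))"
  by (simp add: chan_c_def)
lemma expect_chan_b: "expect (chan_b f b) F = expect (KC b) (\<lambda>c. expect (chan_c f c) F)"
  by (simp add: chan_b_def expect_bind)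
lemma expect_chan_a: "expect (chan_a f a) F = expect (KB a) (\<lambda>b. expect (chan_b f b) F)"
  by (simp add: chan_a_def expect_bind)
lemma expect_chan_0: "expect (chan_0 f) F = expect pA (\<lambda>a. expect (chan_a f a) F)"
  by (simp add: chan_0_def expect_bind)

definition Ks :: "('s \<times> 'j) set" where "Ks = Ss \<times> Js"
lemma fin_Ks [simp]: "finite Ks" by (simp add: Ks_def)

text \<open>A random codebook is a tree: independent roots (relay words), below each root conditionally
  independent cloud words, below each cloud word conditionally independent satellites. Index
  \<open>v\<close> is the message of the previous block, \<open>w\<close> the one of the current block.\<close>

definition bookC :: "'b \<Rightarrow> ('s \<times> 'j \<Rightarrow> 'c) pmf" where
  "bookC b = Pi_pmf Ks undefined (\<lambda>_. KC b)"
definition nodeB :: "'a \<Rightarrow> ('b \<times> ('s \<times> 'j \<Rightarrow> 'c)) pmf" where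
  "nodeB a = bind_pmf (KB a) (\<lambda>b. map_pmf (Pair b) (bookC b))"
definition bookB :: "'a \<Rightarrow> ('w \<Rightarrow> 'b \<times> ('s \<times> 'j \<Rightarrow> 'c)) pmf" where
  "bookB a = Pi_pmf Ws undefined (\<lambda>_. nodeB a)"
definition nodeA :: "('a \<times> ('w \<Rightarrow> 'b \<times> ('s \<times> 'j \<Rightarrow> 'c))) pmf" where
  "nodeA = bind_pmf pA (\<lambda>a. map_pmf (Pair a) (bookB a))"
definition book :: "('w \<Rightarrow> 'a \<times> ('w \<Rightarrow> 'b \<times> ('s \<times> 'j \<Rightarrow> 'c))) pmf" where
  "book = Pi_pmf Ws undefined (\<lambda>_. nodeA)"

definition wa :: "('w \<Rightarrow> 'a \<times> ('w \<Rightarrow> 'b \<times> ('s \<times> 'j \<Rightarrow> 'c))) \<Rightarrow> 'w \<Rightarrow> 'a" where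
  "wa C v = fst (C v)"
definition wb :: "('w \<Rightarrow> 'a \<times> ('w \<Rightarrow> 'b \<times> ('s \<times> 'j \<Rightarrow> 'c))) \<Rightarrow> 'w \<Rightarrow> 'w \<Rightarrow> 'b" where
  "wb C v w = fst (snd (C v) w)"
definition wc :: "('w \<Rightarrow> 'a \<times> ('w \<Rightarrow> 'b \<times> ('s \<times> 'j \<Rightarrow> 'c))) \<Rightarrow> 'w \<Rightarrow> 'w \<Rightarrow> 's \<times> 'j \<Rightarrow> 'c" where
  "wc C v w = snd (snd (C v) w)"

lemma fin_books [simp]:
  "finite (set_pmf (bookC b))" "finite (set_pmf (nodeB a))" "finite (set_pmf (bookB a))"
  "finite (set_pmf nodeA)" "finite (set_pmf book)"
proof -
  show 1: "finite (set_pmf (bookC b))" for b by (simp add: bookC_def)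
  show 2: "finite (set_pmf (nodeB a))" for a by (simp add: nodeB_def 1)
  show 3: "finite (set_pmf (bookB a))" for a by (simp add: bookB_def 2)
  show 4: "finite (set_pmf nodeA)" by (simp add: nodeA_def 3)
  show "finite (set_pmf book)" by (simp add: book_def 4)
qed

lemma book_support:
  assumes "C \<in> set_pmf book" "v \<in> Ws" "w \<in> Ws" "k \<in> Ks"
  shows "wa C v \<in> set_pmf pA" "wb C v w \<in> set_pmf (KB (wa C v))" "wc C v w k \<in> set_pmf (KC (wb C v w))"
proof -
  have "C v \<in> set_pmf nodeA" using assms by (auto simp: book_def set_Pi_pmf PiE_dflt_def)
  then have a: "wa C v \<in> set_pmf pA" and b: "snd (C v) \<in> set_pmf (bookB (wa C v))"
    by (auto simp: nodeA_def wa_def)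
  have "snd (C v) w \<in> set_pmf (nodeB (wa C v))"
    using assms b by (auto simp: bookB_def set_Pi_pmf PiE_dflt_def)
  then have b: "wb C v w \<in> set_pmf (KB (wa C v))" and c: "wc C v w \<in> set_pmf (bookC (wb C v w))"
    by (auto simp: nodeB_def wb_def wc_def)
  show "wa C v \<in> set_pmf pA" "wb C v w \<in> set_pmf (KB (wa C v))" by fact+
  show "wc C v w k \<in> set_pmf (KC (wb C v w))"
    using assms(4) c by (cases k) (auto simp: bookC_def set_Pi_pmf PiE_dflt_def)
qed

lemma expect_nodeB: "expect (nodeB a) F = expect (KB a) (\<lambda>b. expect (bookC b) (\<lambda>t. F (b, t)))"
  by (simp add: nodeB_def expect_bind)

lemma expect_nodeA: "expect nodeA F = expect pA (\<lambda>a. expect (bookB a) (\<lambda>t. F (a, t)))"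
  by (simp add: nodeA_def expect_bind)

lemma expect_book_leaves:
  assumes "v \<in> Ws" "w \<in> Ws"
  shows "expect book (\<lambda>C. F (wa C v) (wb C v w) (wc C v w))
       = expect pA (\<lambda>a. expect (KB a) (\<lambda>b. expect (bookC b) (F a b)))"
  unfolding book_def wa_def wb_def wc_def
  apply (subst expect_Pi_1[where F="\<lambda>n. F (fst n) (fst (snd n w)) (snd (snd n w))"])
    apply (simp_all add: assms expect_nodeA bookB_def)
  apply (subst expect_Pi_1)
    apply (simp_all add: assms expect_nodeB)
  done

lemma expect_book:
  assumes "v \<in> Ws" "w \<in> Ws" "k \<in> Ks"
  shows "expect book (\<lambda>C. F (wa C v) (wb C v w) (wc C v w k))
       = expect pA (\<lambda>a. expect (KB a) (\<lambda>b. expect (KC b) (F a b)))"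
  using assms expect_book_leaves[OF assms(1,2), of "\<lambda>a b t. F a b (t k)"]
  by (simp add: bookC_def expect_Pi_1)

text \<open>This lemma and the next two give the joint law of the sent satellite and one wrong
  codeword, for the three kinds of confusion: another cloud under the same root, a cloud under
  another root, another satellite under the same cloud.\<close>

lemma expect_book_relay:
  assumes "v \<in> Ws" "w \<in> Ws" "w2 \<in> Ws" "w2 \<noteq> w" "k \<in> Ks"
  shows "expect book (\<lambda>C. F (wa C v) (wc C v w k) (wb C v w2))
       = expect pA (\<lambda>a. expect (KB a) (\<lambda>b. expect (KC b) (\<lambda>c. expect (KB a) (F a c))))"
  unfolding book_def wa_def wb_def wc_def
  apply (subst expect_Pi_1[where F="\<lambda>n. F (fst n) (snd (snd n w) k) (fst (snd n w2))"])
    apply (simp_all add: assms expect_nodeA bookB_def)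
  apply (subst expect_Pi_2)
    apply (use assms in \<open>simp_all add: expect_nodeB\<close>)
  apply (simp add: bookC_def)
  apply (subst expect_Pi_1)
    apply (use assms in \<open>simp_all add: expect_nodeB\<close>)
  done

lemma expect_book_cloud:
  assumes "v \<in> Ws" "w \<in> Ws" "v2 \<in> Ws" "v2 \<noteq> v" "k \<in> Ks"
  shows "expect book (\<lambda>C. F (wc C v w k) (wb C v2 w))
       = expect pA (\<lambda>a. expect (KB a) (\<lambda>b. expect (KC b) (\<lambda>c. expect pA (\<lambda>a2. expect (KB a2) (F c)))))"
proof -
  have "expect book (\<lambda>C. F (wc C v w k) (wb C v2 w))
      = expect nodeA (\<lambda>n. expect nodeA (\<lambda>n2. F (snd (snd n w) k) (fst (snd n2 w))))"
    unfolding book_def wb_def wc_def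
    by (subst expect_Pi_2[where F="\<lambda>n n2. F (snd (snd n w) k) (fst (snd n2 w))"])
       (use assms in auto)
  also have "\<dots> = expect nodeA (\<lambda>n. expect pA (\<lambda>a2. expect (KB a2) (F (snd (snd n w) k))))"
    using assms by (simp add: expect_nodeA bookB_def expect_Pi_1[where F="\<lambda>m. F _ (fst m)"] expect_nodeB)
  also have "\<dots> = expect pA (\<lambda>a. expect (KB a) (\<lambda>b. expect (KC b) (\<lambda>c. expect pA (\<lambda>a2. expect (KB a2) (F c)))))"
    using expect_book[OF assms(1,2,5), of "\<lambda>_ _ c. expect pA (\<lambda>a2. expect (KB a2) (F c))"] assms
    unfolding book_def wa_def wb_def wc_def
    by (subst (asm) expect_Pi_1[where F="\<lambda>n. expect pA (\<lambda>a2. expect (KB a2) (F (snd (snd n w) k)))"]) auto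
  finally show ?thesis .
qed

lemma expect_book_leaf:
  assumes "v \<in> Ws" "w \<in> Ws" "k \<in> Ks" "k2 \<in> Ks" "k2 \<noteq> k"
  shows "expect book (\<lambda>C. F (wb C v w) (wc C v w k) (wc C v w k2))
       = expect pA (\<lambda>a. expect (KB a) (\<lambda>b. expect (KC b) (\<lambda>c. expect (KC b) (F b c))))"
  using assms expect_book_leaves[OF assms(1,2), of "\<lambda>a b t. F b (t k) (t k2)"]
  by (simp add: bookC_def expect_Pi_2)

end

section \<open>Threshold decoding with a unique candidate\<close>

lemma of_bool_unique_decoding:
  assumes "finite I"
  shows "(of_bool (\<not> (P i \<and> (\<forall>j\<in>I - {i}. \<not> P j))) :: real)
       \<le> of_bool (\<not> P i) + (\<Sum>j\<in>I - {i}. of_bool (P j))"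
proof (cases "\<exists>j\<in>I - {i}. P j")
  case True
  then obtain j where j: "j \<in> I - {i}" "P j" by blast
  have "(1::real) = of_bool (P j)" using j by simp
  also have "\<dots> \<le> (\<Sum>j\<in>I - {i}. of_bool (P j))"
    using j assms by (intro member_le_sum) auto
  finally have "1 \<le> (\<Sum>j\<in>I - {i}. of_bool (P j) :: real)" .
  then show ?thesis by (auto simp: of_bool_def simp del: sum_of_bool_eq)
next
  case False
  then show ?thesis by (auto simp: of_bool_def sum_nonneg)
qed

lemma log2_one_plus_nonneg: "x \<ge> 0 \<Longrightarrow> 0 \<le> log 2 (1 + x)" for x :: real
  by (subst zero_le_log_cancel_iff) auto

text \<open>A likelihood-ratio test, multiplied out to avoid division by zero.\<close>

abbreviation exceeds :: "real \<Rightarrow> 'r pmf \<Rightarrow> 'r pmf \<Rightarrow> 'r \<Rightarrow> bool" where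
  "exceeds T Q P y \<equiv> T * pmf Q y < pmf P y"

context superposition
begin

abbreviation trial where
  "trial v w k F \<equiv> expect book (\<lambda>C. expect (Ch (wc C v w k)) (\<lambda>r. of_bool (F C r)))"

lemma expect_unique_decoding:
  fixes e :: real
  assumes "finite I" "\<And>j. j \<in> I - {i} \<Longrightarrow>
      trial v w k (\<lambda>C r. P C j r) \<le> e" "e \<ge> 0"
  shows "trial v w k (\<lambda>C r. \<not> (P C i r \<and> (\<forall>j\<in>I - {i}. \<not> P C j r)))
     \<le> trial v w k (\<lambda>C r. \<not> P C i r) + card I * e"
proof -
  have "trial v w k (\<lambda>C r. \<not> (P C i r \<and> (\<forall>j\<in>I - {i}. \<not> P C j r)))
     \<le> expect book (\<lambda>C. expect (Ch (wc C v w k)) (\<lambda>r. of_bool (\<not> P C i r) + (\<Sum>j\<in>I - {i}. of_bool (P C j r))))"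
    using assms(1) by (intro expect_mono of_bool_unique_decoding) auto
  also have "\<dots> = trial v w k (\<lambda>C r. \<not> P C i r)
      + (\<Sum>j\<in>I - {i}. trial v w k (\<lambda>C r. P C j r))"
    by (simp add: expect_add expect_sum del: sum_of_bool_eq)
  also have "(\<Sum>j\<in>I - {i}. trial v w k (\<lambda>C r. P C j r))
      \<le> (\<Sum>j\<in>I - {i}. e)"
    using assms by (intro sum_mono) auto
  also have "\<dots> \<le> card I * e"
    using assms by (auto intro!: mult_right_mono card_mono)
  finally show ?thesis by simp
qed

text \<open>The relay knows \<open>v\<close> and looks for \<open>w\<close>; a backward receiver
  knows \<open>w\<close> and looks for \<open>v\<close>. A wrong \<open>v\<close> replaces the relay
  word as well, so the receivers test against the unconditional output law \<open>chan_0\<close>.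
  This is where I(U,X1;Y) arises instead of I(U;Y|X1).\<close>

definition unique_ab :: "('o \<Rightarrow> 'r) \<Rightarrow> real \<Rightarrow> _ \<Rightarrow> 'w \<Rightarrow> 'w \<Rightarrow> 'r \<Rightarrow> bool" where
  "unique_ab f T C v w y \<longleftrightarrow> exceeds T (chan_a f (wa C v)) (chan_b f (wb C v w)) y
     \<and> (\<forall>w2\<in>Ws - {w}. \<not> exceeds T (chan_a f (wa C v)) (chan_b f (wb C v w2)) y)"
definition unique_0b :: "('o \<Rightarrow> 'r) \<Rightarrow> real \<Rightarrow> _ \<Rightarrow> 'w \<Rightarrow> 'w \<Rightarrow> 'r \<Rightarrow> bool" where
  "unique_0b f T C v w y \<longleftrightarrow> exceeds T (chan_0 f) (chan_b f (wb C v w)) y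
     \<and> (\<forall>v2\<in>Ws - {v}. \<not> exceeds T (chan_0 f) (chan_b f (wb C v2 w)) y)"
definition unique_bc :: "('o \<Rightarrow> 'r) \<Rightarrow> real \<Rightarrow> _ \<Rightarrow> 'w \<Rightarrow> 'w \<Rightarrow> 's \<times> 'j \<Rightarrow> 'r \<Rightarrow> bool" where
  "unique_bc f T C v w k y \<longleftrightarrow> exceeds T (chan_b f (wb C v w)) (chan_c f (wc C v w k)) y
     \<and> (\<forall>k2\<in>Ks - {k}. \<not> exceeds T (chan_b f (wb C v w)) (chan_c f (wc C v w k2)) y)"

definition miss_ab :: "('o \<Rightarrow> 'r) \<Rightarrow> real \<Rightarrow> real" where
  "miss_ab f T = expect pA (\<lambda>a. expect (KB a) (\<lambda>b. expect (chan_b f b) (\<lambda>y.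
      of_bool (\<not> exceeds T (chan_a f a) (chan_b f b) y))))"
definition miss_0b :: "('o \<Rightarrow> 'r) \<Rightarrow> real \<Rightarrow> real" where
  "miss_0b f T = expect pA (\<lambda>a. expect (KB a) (\<lambda>b. expect (chan_b f b) (\<lambda>y.
      of_bool (\<not> exceeds T (chan_0 f) (chan_b f b) y))))"
definition miss_bc :: "('o \<Rightarrow> 'r) \<Rightarrow> real \<Rightarrow> real" where
  "miss_bc f T = expect pA (\<lambda>a. expect (KB a) (\<lambda>b. expect (KC b) (\<lambda>c. expect (chan_c f c) (\<lambda>y.
      of_bool (\<not> exceeds T (chan_b f b) (chan_c f c) y)))))"

text \<open>Given the root, a wrong cloud word is independent of the output, and the output then has
  exactly the law in the denominator of the test. Hence each wrong candidate costs at most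
  \<open>1 / T\<close>. The two error lemmas below rest on the same argument with other
  layers.\<close>

lemma unique_ab_error:
  assumes "v \<in> Ws" "w \<in> Ws" "k \<in> Ks" "T > 0"
  shows "trial v w k (\<lambda>C r. \<not> unique_ab f T C v w (f r))
       \<le> miss_ab f T + card Ws / T"
proof -
  have "trial v w k (\<lambda>C r. \<not> unique_ab f T C v w (f r))
    \<le> trial v w k (\<lambda>C r. \<not> exceeds T (chan_a f (wa C v)) (chan_b f (wb C v w)) (f r))
      + card Ws * (1 / T)"
    unfolding unique_ab_def
  proof (rule expect_unique_decoding[where e="1 / T" and P="\<lambda>C w2 r. exceeds T (chan_a f (wa C v)) (chan_b f (wb C v w2)) (f r)"])
    fix w2 assume w2: "w2 \<in> Ws - {w}"
    have "trial v w k (\<lambda>C r. exceeds T (chan_a f (wa C v)) (chan_b f (wb C v w2)) (f r))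
      = expect pA (\<lambda>a. expect (KB a) (\<lambda>b. expect (KC b) (\<lambda>c. expect (KB a) (\<lambda>b2. expect (Ch c)
          (\<lambda>r. of_bool (exceeds T (chan_a f a) (chan_b f b2) (f r)))))))"
      using expect_book_relay[OF assms(1,2) _ _ assms(3), of w2
          "\<lambda>a c b2. expect (Ch c) (\<lambda>r. of_bool (exceeds T (chan_a f a) (chan_b f b2) (f r)))"] w2 by simp
    also have "\<dots> = expect pA (\<lambda>a. expect (KB a) (\<lambda>b. expect (KC b) (\<lambda>c. expect (Ch c) (\<lambda>r. expect (KB a)
          (\<lambda>b2. of_bool (exceeds T (chan_a f a) (chan_b f b2) (f r)))))))"
      by (subst (2) expect_swap) auto
    also have "\<dots> = expect pA (\<lambda>a. expect (chan_a f a) (\<lambda>y. expect (KB a)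
          (\<lambda>b2. of_bool (exceeds T (chan_a f a) (chan_b f b2) y))))"
      by (simp add: expect_chan_a expect_chan_b expect_chan_c)
    also have "\<dots> \<le> 1 / T"
      using assms by (intro expect_le_const false_alarm_averaged) auto
    finally show "trial v w k (\<lambda>C r. exceeds T (chan_a f (wa C v)) (chan_b f (wb C v w2)) (f r)) \<le> 1 / T" .
  qed (use assms in auto)
  also have "trial v w k (\<lambda>C r. \<not> exceeds T (chan_a f (wa C v)) (chan_b f (wb C v w)) (f r)) = miss_ab f T"
    using expect_book[OF assms(1-3), of "\<lambda>a b c. expect (Ch c) (\<lambda>r. of_bool (\<not> exceeds T (chan_a f a) (chan_b f b) (f r)))"]
    by (simp add: miss_ab_def expect_chan_b expect_chan_c)
  finally show ?thesis by simp
qed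

lemma unique_0b_error:
  assumes "v \<in> Ws" "w \<in> Ws" "k \<in> Ks" "T > 0"
  shows "trial v w k (\<lambda>C r. \<not> unique_0b f T C v w (f r))
       \<le> miss_0b f T + card Ws / T"
proof -
  have "trial v w k (\<lambda>C r. \<not> unique_0b f T C v w (f r))
    \<le> trial v w k (\<lambda>C r. \<not> exceeds T (chan_0 f) (chan_b f (wb C v w)) (f r))
      + card Ws * (1 / T)"
    unfolding unique_0b_def
  proof (rule expect_unique_decoding[where e="1 / T" and P="\<lambda>C v2 r. exceeds T (chan_0 f) (chan_b f (wb C v2 w)) (f r)"])
    fix v2 assume v2: "v2 \<in> Ws - {v}"
    have "trial v w k (\<lambda>C r. exceeds T (chan_0 f) (chan_b f (wb C v2 w)) (f r))
      = expect pA (\<lambda>a. expect (KB a) (\<lambda>b. expect (KC b) (\<lambda>c. expect pA (\<lambda>a2. expect (KB a2) (\<lambda>b2. expect (Ch c)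
          (\<lambda>r. of_bool (exceeds T (chan_0 f) (chan_b f b2) (f r))))))))"
      using expect_book_cloud[OF assms(1,2) _ _ assms(3), of v2
          "\<lambda>c b2. expect (Ch c) (\<lambda>r. of_bool (exceeds T (chan_0 f) (chan_b f b2) (f r)))"] v2 by simp
    also have "\<dots> = expect (chan_0 f) (\<lambda>y. expect (bind_pmf pA KB)
          (\<lambda>b2. of_bool (exceeds T (chan_0 f) (chan_b f b2) y)))"
    proof -
      have "expect (chan_0 f) (\<lambda>y. expect (bind_pmf pA KB)
          (\<lambda>b2. of_bool (exceeds T (chan_0 f) (chan_b f b2) y)))
        = expect pA (\<lambda>a. expect (KB a) (\<lambda>b. expect (KC b) (\<lambda>c. expect (Ch c) (\<lambda>r. expect (bind_pmf pA KB)
          (\<lambda>b2. of_bool (exceeds T (chan_0 f) (chan_b f b2) (f r)))))))"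
        by (simp add: expect_chan_0 expect_chan_a expect_chan_b expect_chan_c)
      also have "\<dots> = expect pA (\<lambda>a. expect (KB a) (\<lambda>b. expect (KC b) (\<lambda>c. expect (bind_pmf pA KB) (\<lambda>b2. expect (Ch c)
          (\<lambda>r. of_bool (exceeds T (chan_0 f) (chan_b f b2) (f r)))))))"
        by (subst expect_swap) auto
      finally show ?thesis by (simp add: expect_bind)
    qed
    also have "\<dots> \<le> 1 / T"
      using assms by (intro false_alarm_averaged) auto
    finally show "trial v w k (\<lambda>C r. exceeds T (chan_0 f) (chan_b f (wb C v2 w)) (f r)) \<le> 1 / T" .
  qed (use assms in auto)
  also have "trial v w k (\<lambda>C r. \<not> exceeds T (chan_0 f) (chan_b f (wb C v w)) (f r)) = miss_0b f T"
    using expect_book[OF assms(1-3), of "\<lambda>a b c. expect (Ch c) (\<lambda>r. of_bool (\<not> exceeds T (chan_0 f) (chan_b f b) (f r)))"]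
    by (simp add: miss_0b_def expect_chan_b expect_chan_c)
  finally show ?thesis by simp
qed

lemma unique_bc_error:
  assumes "v \<in> Ws" "w \<in> Ws" "k \<in> Ks" "T > 0"
  shows "trial v w k (\<lambda>C r. \<not> unique_bc f T C v w k (f r))
       \<le> miss_bc f T + card Ks / T"
proof -
  have "trial v w k (\<lambda>C r. \<not> unique_bc f T C v w k (f r))
    \<le> trial v w k (\<lambda>C r. \<not> exceeds T (chan_b f (wb C v w)) (chan_c f (wc C v w k)) (f r))
      + card Ks * (1 / T)"
    unfolding unique_bc_def
  proof (rule expect_unique_decoding[where e="1 / T" and P="\<lambda>C k2 r. exceeds T (chan_b f (wb C v w)) (chan_c f (wc C v w k2)) (f r)"])
    fix k2 assume k2: "k2 \<in> Ks - {k}"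
    have "trial v w k (\<lambda>C r. exceeds T (chan_b f (wb C v w)) (chan_c f (wc C v w k2)) (f r))
      = expect pA (\<lambda>a. expect (KB a) (\<lambda>b. expect (KC b) (\<lambda>c. expect (KC b) (\<lambda>c2. expect (Ch c)
          (\<lambda>r. of_bool (exceeds T (chan_b f b) (chan_c f c2) (f r)))))))"
      using expect_book_leaf[OF assms(1-3), of k2
          "\<lambda>b c c2. expect (Ch c) (\<lambda>r. of_bool (exceeds T (chan_b f b) (chan_c f c2) (f r)))"] k2 by simp
    also have "\<dots> = expect pA (\<lambda>a. expect (KB a) (\<lambda>b. expect (KC b) (\<lambda>c. expect (Ch c) (\<lambda>r. expect (KC b)
          (\<lambda>c2. of_bool (exceeds T (chan_b f b) (chan_c f c2) (f r)))))))"
      by (subst (2) expect_swap) auto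
    also have "\<dots> = expect pA (\<lambda>a. expect (KB a) (\<lambda>b. expect (chan_b f b) (\<lambda>y. expect (KC b)
          (\<lambda>c2. of_bool (exceeds T (chan_b f b) (chan_c f c2) y)))))"
      by (simp add: expect_chan_b expect_chan_c)
    also have "\<dots> \<le> 1 / T"
      using assms by (intro expect_le_const false_alarm_averaged) auto
    finally show "trial v w k (\<lambda>C r. exceeds T (chan_b f (wb C v w)) (chan_c f (wc C v w k2)) (f r)) \<le> 1 / T" .
  qed (use assms in auto)
  also have "trial v w k (\<lambda>C r. \<not> exceeds T (chan_b f (wb C v w)) (chan_c f (wc C v w k)) (f r)) = miss_bc f T"
    using expect_book[OF assms(1-3), of "\<lambda>a b c. expect (Ch c) (\<lambda>r. of_bool (\<not> exceeds T (chan_b f b) (chan_c f c) (f r)))"]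
    by (simp add: miss_bc_def expect_chan_c)
  finally show ?thesis by simp
qed

text \<open>The second component of the satellite index is the randomness that hides the first one.
  Using \<open>1 + ratio\<close> instead of the likelihood ratio makes the cost nonnegative, so that later
  the bad event can simply be dropped; the price is one bit per block.\<close>

definition mixture :: "('o \<Rightarrow> 'r) \<Rightarrow> ('s \<times> 'j \<Rightarrow> 'c) \<Rightarrow> 's \<Rightarrow> 'r \<Rightarrow> real" where
  "mixture f t s z = (\<Sum>j\<in>Js. pmf (chan_c f (t (s, j))) z) / card Js"

definition leak :: "('o \<Rightarrow> 'r) \<Rightarrow> _ \<Rightarrow> 'w \<Rightarrow> 'w \<Rightarrow> 's \<times> 'j \<Rightarrow> real" where
  "leak f C v w k = expect (chan_c f (wc C v w k)) (\<lambda>z.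
      log 2 (1 + mixture f (wc C v w) (fst k) z / pmf (chan_b f (wb C v w)) z))"

text \<open>The 2 collects the offset 1 and the other words of the bin, whose averaged ratio is at
  most 1; the fraction is the contribution of the transmitted word itself.\<close>

definition leak_bound :: "('o \<Rightarrow> 'r) \<Rightarrow> real" where
  "leak_bound f = expect pA (\<lambda>a. expect (KB a) (\<lambda>b. expect (KC b) (\<lambda>c. expect (chan_c f c) (\<lambda>z.
      log 2 (2 + pmf (chan_c f c) z / (card Js * pmf (chan_b f b) z))))))"

lemma mixture_nonneg: "mixture f t s z \<ge> 0"
  by (simp add: mixture_def sum_nonneg)

lemma chan_b_support:
  assumes "c \<in> set_pmf (KC b)" "z \<in> set_pmf (chan_c f c)"
  shows "pmf (chan_b f b) z > 0"
  using assms by (auto simp: chan_b_def intro!: pmf_positive)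

text \<open>Soft covering: given the transmitted word, replace the concave logarithm by its tangent at an
  upper bound of the conditional mean; the remaining average is linear in the other words.\<close>

lemma expect_leaves_leak:
  assumes k: "(s, j) \<in> Ks"
  shows "expect (bookC b) (\<lambda>t. expect (chan_c f (t (s, j))) (\<lambda>z. log 2 (1 + mixture f t s z / pmf (chan_b f b) z)))
    \<le> expect (KC b) (\<lambda>c. expect (chan_c f c) (\<lambda>z.
        log 2 (2 + pmf (chan_c f c) z / (card Js * pmf (chan_b f b) z))))"
proof -
  let ?k = "(s, j)" and ?q = "pmf (chan_b f b)"
  let ?rest = "Pi_pmf (Ks - {?k}) undefined (\<lambda>_. KC b)"
  have j: "j \<in> Js" using k by (simp add: Ks_def)
  then have m: "real (card Js) > 0" by (auto simp: card_gt_0_iff)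
  have fin: "finite (set_pmf ?rest)" by (intro finite_set_Pi_pmf) auto
  have "expect (bookC b) (\<lambda>t. expect (chan_c f (t ?k)) (\<lambda>z. log 2 (1 + mixture f t s z / ?q z)))
    = expect (KC b) (\<lambda>c. expect ?rest (\<lambda>t. expect (chan_c f c) (\<lambda>z. log 2 (1 + mixture f (t(?k := c)) s z / ?q z))))"
    unfolding bookC_def using k by (subst expect_Pi_insert[of _ ?k]) auto
  also have "\<dots> = expect (KC b) (\<lambda>c. expect (chan_c f c) (\<lambda>z. expect ?rest (\<lambda>t. log 2 (1 + mixture f (t(?k := c)) s z / ?q z))))"
    by (subst expect_swap) (use fin in auto)
  also have "\<dots> \<le> expect (KC b) (\<lambda>c. expect (chan_c f c) (\<lambda>z.
        log 2 (2 + pmf (chan_c f c) z / (card Js * ?q z))))"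
  proof (intro expect_mono)
    fix c z assume c: "c \<in> set_pmf (KC b)" "z \<in> set_pmf (chan_c f c)"
    have q: "?q z > 0" using c by (rule chan_b_support)
    define M where "M = 2 + pmf (chan_c f c) z / (card Js * ?q z)"
    have M: "M > 0" using q m by (simp add: M_def add_pos_nonneg)
    have mix: "mixture f (t(?k := c)) s z = (pmf (chan_c f c) z + (\<Sum>j'\<in>Js - {j}. pmf (chan_c f (t (s, j'))) z)) / card Js" for t
      unfolding mixture_def using j by (subst sum.remove[of _ j]) (auto intro!: sum.cong)
    \<comment> \<open>A satellite averaged over its own law reproduces the output law of its cloud
      word, so every other word of the bin contributes the reference likelihood.\<close>
    have E: "expect ?rest (\<lambda>t. pmf (chan_c f (t (s, j'))) z) = ?q z" if "j' \<in> Js - {j}" for j'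
      using that k by (subst expect_Pi_1) (auto simp: Ks_def chan_b_def pmf_bind)
    have "expect ?rest (\<lambda>t. 1 + mixture f (t(?k := c)) s z / ?q z)
        = 1 + (pmf (chan_c f c) z + (\<Sum>j'\<in>Js - {j}. ?q z)) / card Js / ?q z"
      unfolding mix using fin by (simp add: E)
    also have "\<dots> = 1 + pmf (chan_c f c) z / (card Js * ?q z) + real (card (Js - {j})) / card Js"
      using q m by (simp add: add_divide_distrib)
    also have "\<dots> \<le> M"
      using m by (auto simp: M_def intro!: card_mono)
    finally have EM: "expect ?rest (\<lambda>t. 1 + mixture f (t(?k := c)) s z / ?q z) \<le> M" .
    have "expect ?rest (\<lambda>t. log 2 (1 + mixture f (t(?k := c)) s z / ?q z))
      \<le> expect ?rest (\<lambda>t. log 2 M + ((1 + mixture f (t(?k := c)) s z / ?q z) - M) / (M * ln 2))"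
      using fin M q by (intro expect_mono log2_tangent) (auto intro!: add_pos_nonneg divide_nonneg_pos mixture_nonneg)
    also have "\<dots> = log 2 M + (expect ?rest (\<lambda>t. 1 + mixture f (t(?k := c)) s z / ?q z) - M) / (M * ln 2)"
      using fin by simp
    also have "\<dots> \<le> log 2 M"
      using EM M by (simp add: divide_nonpos_pos)
    finally show "expect ?rest (\<lambda>t. log 2 (1 + mixture f (t(?k := c)) s z / ?q z)) \<le> log 2 (2 + pmf (chan_c f c) z / (card Js * ?q z))"
      by (simp add: M_def)
  qed auto
  finally show ?thesis .
qed

lemma expect_leak:
  assumes "v \<in> Ws" "w \<in> Ws" "k \<in> Ks"
  shows "expect book (\<lambda>C. leak f C v w k) \<le> leak_bound f"
proof -
  obtain s j where k: "k = (s, j)" by (cases k)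
  have "expect book (\<lambda>C. leak f C v w k) = expect pA (\<lambda>a. expect (KB a) (\<lambda>b.
     expect (bookC b) (\<lambda>t. expect (chan_c f (t (s, j))) (\<lambda>z. log 2 (1 + mixture f t s z / pmf (chan_b f b) z)))))"
    using expect_book_leaves[OF assms(1,2), of "\<lambda>a b t. expect (chan_c f (t (s, j))) (\<lambda>z. log 2 (1 + mixture f t s z / pmf (chan_b f b) z))"]
    by (simp add: leak_def k)
  also have "\<dots> \<le> leak_bound f"
    unfolding leak_bound_def using assms k by (intro expect_mono expect_leaves_leak) auto
  finally show ?thesis .
qed

lemma leak_nonneg: "leak f C v w k \<ge> 0"
  unfolding leak_def
  by (intro expect_ge_const log2_one_plus_nonneg divide_nonneg_nonneg mixture_nonneg) auto

text \<open>\<open>THE\<close> is junk unless exactly one candidate passes the threshold; this is only used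
  on the events \<open>unique_\<dots>\<close>.\<close>

definition dec_ab :: "('o \<Rightarrow> 'r) \<Rightarrow> real \<Rightarrow> _ \<Rightarrow> 'w \<Rightarrow> 'r \<Rightarrow> 'w" where
  "dec_ab f T C v y = (THE w. w \<in> Ws \<and> exceeds T (chan_a f (wa C v)) (chan_b f (wb C v w)) y)"
definition dec_0b :: "('o \<Rightarrow> 'r) \<Rightarrow> real \<Rightarrow> _ \<Rightarrow> 'w \<Rightarrow> 'r \<Rightarrow> 'w" where
  "dec_0b f T C w y = (THE v. v \<in> Ws \<and> exceeds T (chan_0 f) (chan_b f (wb C v w)) y)"
definition dec_bc :: "('o \<Rightarrow> 'r) \<Rightarrow> real \<Rightarrow> _ \<Rightarrow> 'w \<Rightarrow> 'w \<Rightarrow> 'r \<Rightarrow> 's \<times> 'j" where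
  "dec_bc f T C v w y = (THE k. k \<in> Ks \<and> exceeds T (chan_b f (wb C v w)) (chan_c f (wc C v w k)) y)"

lemma dec_unique:
  "w \<in> Ws \<Longrightarrow> unique_ab f T C v w y \<Longrightarrow> dec_ab f T C v y = w"
  "v \<in> Ws \<Longrightarrow> unique_0b f T C v w y \<Longrightarrow> dec_0b f T C w y = v"
  "k \<in> Ks \<Longrightarrow> unique_bc f T C v w k y \<Longrightarrow> dec_bc f T C v w y = k"
  unfolding dec_ab_def unique_ab_def dec_0b_def unique_0b_def dec_bc_def unique_bc_def
  by (rule the_equality; blast)+

text \<open>Failure and leakage are both nonnegative, so a codebook that is good for the weighted
  sum is good for each; the weight \<kappa> will be \<open>1 / n\<close>, since leakage may grow
  linearly. The averages are bounded for every index separately, which is why the index law \<nu>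
  may be arbitrary, with \<open>v\<close> and \<open>w\<close> equal or dependent.\<close>

theorem exists_code:
  fixes fr :: "'o \<Rightarrow> 'r" and fy :: "'o \<Rightarrow> 'y" and fz :: "'o \<Rightarrow> 'z" and \<nu> :: "('w \<times> 'w \<times> 's \<times> 'j) pmf"
  assumes \<nu>: "set_pmf \<nu> \<subseteq> Ws \<times> Ws \<times> Ks"
    and T: "Tr > 0" "Ty > 0" "Tz > 0" "Tk > 0" and \<kappa>: "\<kappa> > 0"
    and \<beta>: "miss_ab fr Tr + card Ws / Tr + (miss_0b fy Ty + card Ws / Ty) + (miss_0b fz Tz + card Ws / Tz)
        + (miss_bc fy Tk + card Ks / Tk) + \<kappa> * leak_bound fz \<le> \<beta>" (is "?\<beta> \<le> _")
  shows "\<exists>ca cb cc dr dy dz dk.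
    (\<forall>v\<in>Ws. \<forall>w\<in>Ws. \<forall>k\<in>Ks. ca v \<in> set_pmf pA \<and> cb v w \<in> set_pmf (KB (ca v)) \<and> cc v w k \<in> set_pmf (KC (cb v w))) \<and>
    expect \<nu> (\<lambda>(v, w, k). expect (Ch (cc v w k)) (\<lambda>r. of_bool (\<not> (dr v (fr r) = w
        \<and> dy w (fy r) = v \<and> dz w (fz r) = v \<and> dk v w (fy r) = k)))) \<le> \<beta> \<and>
    expect \<nu> (\<lambda>(v, w, k). expect (chan_c fz (cc v w k)) (\<lambda>z. log 2 (1 +
        (\<Sum>j\<in>Js. pmf (chan_c fz (cc v w (fst k, j))) z) / card Js / pmf (chan_b fz (cb v w)) z))) \<le> \<beta> / \<kappa>"
proof -
  have fin: "finite (set_pmf \<nu>)" by (rule finite_subset[OF \<nu>]) simp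
  define E where "E = (\<lambda>C (v, w, k). expect (Ch (wc C v w k)) (\<lambda>r. of_bool (\<not> (dec_ab fr Tr C v (fr r) = w
        \<and> dec_0b fy Ty C w (fy r) = v \<and> dec_0b fz Tz C w (fz r) = v \<and> dec_bc fy Tk C v w (fy r) = k))))"
  define L where "L = (\<lambda>C (v, w, k). leak fz C v w k)"
  have E: "E C i \<ge> 0" and L: "L C i \<ge> 0" for C i
    by (cases i; simp add: E_def L_def leak_nonneg expect_ge_const)+
  have "expect book (\<lambda>C. expect \<nu> (\<lambda>i. E C i + \<kappa> * L C i)) = expect \<nu> (\<lambda>i. expect book (\<lambda>C. E C i + \<kappa> * L C i))"
    using fin by (intro expect_swap) auto
  also have "\<dots> \<le> ?\<beta>"
  proof (rule expect_le_const[OF fin])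
    fix i assume "i \<in> set_pmf \<nu>"
    moreover obtain v w k where i: "i = (v, w, k)" by (cases i)
    ultimately have vwk: "v \<in> Ws" "w \<in> Ws" "k \<in> Ks" using \<nu> by auto
    have "expect book (\<lambda>C. E C i + \<kappa> * L C i) \<le> expect book (\<lambda>C.
        expect (Ch (wc C v w k)) (\<lambda>r. of_bool (\<not> unique_ab fr Tr C v w (fr r)) + of_bool (\<not> unique_0b fy Ty C v w (fy r))
          + of_bool (\<not> unique_0b fz Tz C v w (fz r)) + of_bool (\<not> unique_bc fy Tk C v w k (fy r))) + \<kappa> * leak fz C v w k)"
      unfolding i E_def L_def prod.case using vwk
      by (intro expect_mono add_mono order_refl) (auto simp: of_bool_def dec_unique)
    also have "\<dots> = trial v w k (\<lambda>C r. \<not> unique_ab fr Tr C v w (fr r))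
        + trial v w k (\<lambda>C r. \<not> unique_0b fy Ty C v w (fy r))
        + trial v w k (\<lambda>C r. \<not> unique_0b fz Tz C v w (fz r))
        + trial v w k (\<lambda>C r. \<not> unique_bc fy Tk C v w k (fy r))
        + \<kappa> * expect book (\<lambda>C. leak fz C v w k)"
      by (simp add: expect_add)
    also have "\<dots> \<le> ?\<beta>"
      using \<kappa> by (intro add_mono mult_left_mono unique_ab_error unique_0b_error unique_bc_error expect_leak vwk T) simp
    finally show "expect book (\<lambda>C. E C i + \<kappa> * L C i) \<le> ?\<beta>" .
  qed
  finally obtain C where C: "C \<in> set_pmf book" "expect \<nu> (\<lambda>i. E C i + \<kappa> * L C i) \<le> \<beta>"
    using exists_le_expect[of book "\<lambda>C. expect \<nu> (\<lambda>i. E C i + \<kappa> * L C i)" \<beta>] \<beta> by auto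
  have sum: "expect \<nu> (E C) + \<kappa> * expect \<nu> (L C) \<le> \<beta>" using C(2) fin by simp
  have "expect \<nu> (E C) \<ge> 0" "expect \<nu> (L C) \<ge> 0" using fin E L by (auto intro: expect_ge_const)
  moreover from this \<kappa> have "\<kappa> * expect \<nu> (L C) \<ge> 0" by simp
  ultimately have "expect \<nu> (E C) \<le> \<beta>" "expect \<nu> (L C) \<le> \<beta> / \<kappa>"
    unfolding pos_le_divide_eq[OF \<kappa>] using sum by (linarith, simp add: mult.commute)
  then show ?thesis
    using book_support[OF C(1)]
    by (intro exI[of _ "wa C"] exI[of _ "wb C"] exI[of _ "wc C"] exI[of _ "dec_ab fr Tr C"]
        exI[of _ "dec_0b fy Ty C"] exI[of _ "dec_0b fz Tz C"] exI[of _ "dec_bc fy Tk C"])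
       (auto simp: E_def L_def leak_def mixture_def)
qed

end

section \<open>Memoryless extensions\<close>

primrec chanl :: "('a \<Rightarrow> 'b pmf) \<Rightarrow> 'a list \<Rightarrow> 'b list pmf" where
  "chanl K [] = return_pmf []"
| "chanl K (x # xs) = bind_pmf (K x) (\<lambda>y. map_pmf ((#) y) (chanl K xs))"

lemma set_chanl: "ys \<in> set_pmf (chanl K xs) \<longleftrightarrow> list_all2 (\<lambda>x y. y \<in> set_pmf (K x)) xs ys"
  by (induction xs arbitrary: ys) (auto simp: list_all2_Cons1)

lemma length_chanl: "ys \<in> set_pmf (chanl K xs) \<Longrightarrow> length ys = length xs"
  by (auto simp: set_chanl dest: list_all2_lengthD)

lemma finite_chanl [simp]: "(\<And>x. finite (set_pmf (K x))) \<Longrightarrow> finite (set_pmf (chanl K xs))"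
  by (induction xs) auto

text \<open>Composition acts letter by letter; this makes the word-level output laws of all layers
  memoryless.\<close>

lemma chanl_bind: "bind_pmf (chanl K xs) (chanl L) = chanl (\<lambda>x. bind_pmf (K x) L) xs"
proof (induction xs)
  case (Cons x xs)
  have "bind_pmf (chanl K (x # xs)) (chanl L)
      = bind_pmf (K x) (\<lambda>y. bind_pmf (chanl K xs) (\<lambda>ys. bind_pmf (L y) (\<lambda>z. map_pmf ((#) z) (chanl L ys))))"
    by (simp add: bind_assoc_pmf bind_map_pmf)
  also have "\<dots> = bind_pmf (K x) (\<lambda>y. bind_pmf (L y) (\<lambda>z. bind_pmf (chanl K xs) (\<lambda>ys. map_pmf ((#) z) (chanl L ys))))"
    by (subst (2) bind_commute_pmf) simp
  finally show ?case by (simp add: bind_assoc_pmf map_bind_pmf flip: Cons.IH)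
qed (simp add: bind_return_pmf)

lemma chanl_map: "map_pmf (map f) (chanl K xs) = chanl (\<lambda>x. map_pmf f (K x)) xs"
proof (induction xs)
  case (Cons x xs)
  show ?case by (simp add: map_bind_pmf bind_map_pmf pmf.map_comp o_def flip: Cons.IH)
qed simp

lemma chanl_map_input: "chanl K (map f xs) = chanl (\<lambda>x. K (f x)) xs"
  by (induction xs) simp_all

lemma pmf_bind_Cons:
  "pmf (bind_pmf p (\<lambda>y. map_pmf ((#) y) (q y))) (y # ys) = pmf p y * pmf (q y) ys"
proof -
  have "pmf (map_pmf ((#) y') (q y')) (y # ys) = indicator {y} y' * pmf (q y) ys" for y'
  proof (cases "y' = y")
    case True
    then show ?thesis using pmf_map_inj'[of "(#) y" "q y" ys] by simp
  next
    case False
    then show ?thesis by (auto simp: pmf_eq_0_set_pmf)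
  qed
  then show ?thesis by (simp add: pmf_bind measure_pmf_single)
qed

lemma pmf_chanl_Cons [simp]: "pmf (chanl K (x # xs)) (y # ys) = pmf (K x) y * pmf (chanl K xs) ys"
  by (simp add: pmf_bind_Cons)

declare chanl.simps(2) [simp del]

lemma pmf_chanl_append:
  "length us = length xs \<Longrightarrow>
    pmf (chanl K (xs @ ys)) (us @ vs) = pmf (chanl K xs) us * pmf (chanl K ys) vs"
  by (induction us xs rule: list_induct2) simp_all

lemma pmf_chanl_map: "pmf (chanl K (map g ms)) (map h ms) = (\<Prod>m\<leftarrow>ms. pmf (K (g m)) (h m))"
  by (induction ms) simp_all

definition joint :: "('a \<Rightarrow> 'b pmf) \<Rightarrow> ('b \<Rightarrow> 'c pmf) \<Rightarrow> 'a \<Rightarrow> ('b \<times> 'c) pmf" where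
  "joint K L x = bind_pmf (K x) (\<lambda>y. map_pmf (Pair y) (L y))"

lemma finite_joint [simp]:
  "(\<And>x. finite (set_pmf (K x))) \<Longrightarrow> (\<And>y. finite (set_pmf (L y))) \<Longrightarrow> finite (set_pmf (joint K L x))"
  by (simp add: joint_def)

lemma expect_joint:
  assumes "\<And>x. finite (set_pmf (K x))" "\<And>y. finite (set_pmf (L y))"
  shows "expect (joint K L x) F = expect (K x) (\<lambda>y. expect (L y) (\<lambda>z. F (y, z)))"
  using assms by (simp add: joint_def expect_bind)

text \<open>Merges nested averages over layers into one average over words of pairs. Repeated use
  reduces a codebook average to one iid sequence of tuples, where log-likelihood ratios are sums of
  independent terms.\<close>

lemma expect_chanl_joint:
  assumes [simp]: "\<And>x. finite (set_pmf (K x))" "\<And>y. finite (set_pmf (L y))"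
  shows "expect (chanl K xs) (\<lambda>ys. expect (chanl L ys) (F ys))
       = expect (chanl (joint K L) xs) (\<lambda>ps. F (map fst ps) (map snd ps))"
proof (induction xs arbitrary: F)
  case (Cons x xs)
  have "expect (chanl K (x # xs)) (\<lambda>ys. expect (chanl L ys) (F ys))
    = expect (K x) (\<lambda>y. expect (chanl K xs) (\<lambda>ys. expect (L y) (\<lambda>z. expect (chanl L ys) (\<lambda>zs. F (y # ys) (z # zs)))))"
    by (simp add: chanl.simps expect_bind)
  also have "\<dots> = expect (K x) (\<lambda>y. expect (L y) (\<lambda>z. expect (chanl K xs) (\<lambda>ys. expect (chanl L ys) (\<lambda>zs. F (y # ys) (z # zs)))))"
    by (subst (2) expect_swap) auto
  also have "\<dots> = expect (chanl (joint K L) (x # xs)) (\<lambda>ps. F (map fst ps) (map snd ps))"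
    by (simp add: chanl.simps expect_bind expect_joint Cons.IH[of "\<lambda>ys zs. F (_ # ys) (_ # zs)"])
  finally show ?case .
qed simp

text \<open>Encoded as a channel with a trivial input so that the facts on \<open>chanl\<close>
  apply.\<close>

definition iid :: "nat \<Rightarrow> 'a pmf \<Rightarrow> 'a list pmf" where
  "iid n p = chanl (\<lambda>_. p) (replicate n ())"

lemma finite_iid [simp]: "finite (set_pmf p) \<Longrightarrow> finite (set_pmf (iid n p))"
  by (simp add: iid_def)

lemma set_iid: "ms \<in> set_pmf (iid n p) \<Longrightarrow> length ms = n \<and> set ms \<subseteq> set_pmf p"
  by (auto simp: iid_def set_chanl list_all2_conv_all_nth in_set_conv_nth)

lemma expect_iid_Suc:
  "finite (set_pmf p) \<Longrightarrow> expect (iid (Suc n) p) F = expect p (\<lambda>m. expect (iid n p) (\<lambda>ms. F (m # ms)))"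
  by (simp add: iid_def chanl.simps expect_bind)

lemma expect_iid_sum:
  assumes "finite (set_pmf p)" "expect p g = 0"
  shows "expect (iid n p) (\<lambda>ms. \<Sum>m\<leftarrow>ms. g m) = 0"
  using assms by (induction n) (simp_all add: expect_iid_Suc, simp add: iid_def)

lemma expect_iid_sum_square:
  assumes "finite (set_pmf p)" "expect p g = 0"
  shows "expect (iid n p) (\<lambda>ms. (\<Sum>m\<leftarrow>ms. g m)\<^sup>2) = n * expect p (\<lambda>m. (g m)\<^sup>2)"
proof (induction n)
  case (Suc n)
  have "expect (iid (Suc n) p) (\<lambda>ms. (\<Sum>m\<leftarrow>ms. g m)\<^sup>2)
      = expect p (\<lambda>m. expect (iid n p) (\<lambda>ms. (g m)\<^sup>2 + 2 * g m * (\<Sum>m\<leftarrow>ms. g m) + (\<Sum>m\<leftarrow>ms. g m)\<^sup>2))"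
    using assms by (simp add: expect_iid_Suc power2_sum algebra_simps)
  also have "\<dots> = expect p (\<lambda>m. (g m)\<^sup>2) + n * expect p (\<lambda>m. (g m)\<^sup>2)"
    using assms by (simp add: expect_iid_sum Suc)
  finally show ?case by (simp add: algebra_simps)
qed (simp add: iid_def)

section \<open>Second-moment bounds for information densities\<close>

definition dev :: "'m pmf \<Rightarrow> ('m \<Rightarrow> real) \<Rightarrow> real" where
  "dev J i = expect J (\<lambda>m. (i m - expect J i)\<^sup>2)"

lemma expect_iid_dev:
  assumes "finite (set_pmf J)"
  shows "expect (iid n J) (\<lambda>ms. ((\<Sum>m\<leftarrow>ms. i m) - n * expect J i)\<^sup>2) = n * dev J i"
proof -
  have "expect (iid n J) (\<lambda>ms. ((\<Sum>m\<leftarrow>ms. i m) - n * expect J i)\<^sup>2)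
      = expect (iid n J) (\<lambda>ms. (\<Sum>m\<leftarrow>ms. i m - expect J i)\<^sup>2)"
    by (intro expect_cong) (auto dest!: set_iid simp: sum_list_subtractf sum_list_triv)
  also have "\<dots> = n * dev J i"
    unfolding dev_def using assms by (subst expect_iid_sum_square) simp_all
  finally show ?thesis .
qed

lemma log_prod_list:
  assumes "\<And>m. m \<in> set ms \<Longrightarrow> P m > 0" "\<And>m. m \<in> set ms \<Longrightarrow> Q m > (0::real)"
  shows "(\<Prod>m\<leftarrow>ms. P m) > 0" "(\<Prod>m\<leftarrow>ms. Q m) > 0"
    "log 2 ((\<Prod>m\<leftarrow>ms. P m) / (\<Prod>m\<leftarrow>ms. Q m)) = (\<Sum>m\<leftarrow>ms. log 2 (P m / Q m))"
proof -
  have "(\<Prod>m\<leftarrow>ms. P m) > 0 \<and> (\<Prod>m\<leftarrow>ms. Q m) > 0 \<and>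
    log 2 ((\<Prod>m\<leftarrow>ms. P m) / (\<Prod>m\<leftarrow>ms. Q m)) = (\<Sum>m\<leftarrow>ms. log 2 (P m / Q m))"
    using assms
  proof (induction ms)
    case (Cons a ms)
    then have IH: "(\<Prod>m\<leftarrow>ms. P m) > 0" "(\<Prod>m\<leftarrow>ms. Q m) > 0"
      "log 2 ((\<Prod>m\<leftarrow>ms. P m) / (\<Prod>m\<leftarrow>ms. Q m)) = (\<Sum>m\<leftarrow>ms. log 2 (P m / Q m))"
      and a: "P a > 0" "Q a > 0"
      by auto
    have "log 2 ((\<Prod>m\<leftarrow>a # ms. P m) / (\<Prod>m\<leftarrow>a # ms. Q m))
        = log 2 (P a / Q a) + log 2 ((\<Prod>m\<leftarrow>ms. P m) / (\<Prod>m\<leftarrow>ms. Q m))"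
      using IH(1,2) a by (simp add: log_mult log_divide)
    then show ?case using IH a by simp
  qed simp
  then show "(\<Prod>m\<leftarrow>ms. P m) > 0" "(\<Prod>m\<leftarrow>ms. Q m) > 0"
    "log 2 ((\<Prod>m\<leftarrow>ms. P m) / (\<Prod>m\<leftarrow>ms. Q m)) = (\<Sum>m\<leftarrow>ms. log 2 (P m / Q m))"
    by auto
qed

text \<open>Chebyshev's inequality: to miss the threshold, the sum of the densities \<open>i\<close>
  must fall \<open>n * \<delta>\<close> below its mean.\<close>

lemma threshold_tail:
  fixes P Q :: "'m \<Rightarrow> real"
  assumes fin: "finite (set_pmf J)" and pos: "\<And>m. m \<in> set_pmf J \<Longrightarrow> P m > 0" "\<And>m. m \<in> set_pmf J \<Longrightarrow> Q m > 0"
    and \<delta>: "\<delta> > 0" and n: "n > 0"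
  defines "i \<equiv> \<lambda>m. log 2 (P m / Q m)"
  shows "expect (iid n J) (\<lambda>ms. of_bool (\<not> 2 powr (n * (expect J i - \<delta>)) * (\<Prod>m\<leftarrow>ms. Q m) < (\<Prod>m\<leftarrow>ms. P m)))
      \<le> dev J i / (n * \<delta>\<^sup>2)"
proof -
  have "expect (iid n J) (\<lambda>ms. of_bool (\<not> 2 powr (n * (expect J i - \<delta>)) * (\<Prod>m\<leftarrow>ms. Q m) < (\<Prod>m\<leftarrow>ms. P m)))
     \<le> expect (iid n J) (\<lambda>ms. ((\<Sum>m\<leftarrow>ms. i m) - n * expect J i)\<^sup>2 / (n * \<delta>)\<^sup>2)"
  proof (rule expect_mono)
    fix ms assume "ms \<in> set_pmf (iid n J)"
    then have ms: "\<And>m. m \<in> set ms \<Longrightarrow> P m > 0" "\<And>m. m \<in> set ms \<Longrightarrow> Q m > 0"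
      using pos by (auto dest!: set_iid)
    show "of_bool (\<not> 2 powr (n * (expect J i - \<delta>)) * (\<Prod>m\<leftarrow>ms. Q m) < (\<Prod>m\<leftarrow>ms. P m))
        \<le> ((\<Sum>m\<leftarrow>ms. i m) - n * expect J i)\<^sup>2 / (n * \<delta>)\<^sup>2"
    proof (cases "2 powr (n * (expect J i - \<delta>)) * (\<Prod>m\<leftarrow>ms. Q m) < (\<Prod>m\<leftarrow>ms. P m)")
      case False
      note l = log_prod_list[of ms P Q, OF ms]
      have "(\<Prod>m\<leftarrow>ms. P m) / (\<Prod>m\<leftarrow>ms. Q m) \<le> 2 powr (n * (expect J i - \<delta>))"
        using False l by (simp add: pos_divide_le_eq not_less)
      then have "log 2 ((\<Prod>m\<leftarrow>ms. P m) / (\<Prod>m\<leftarrow>ms. Q m)) \<le> n * (expect J i - \<delta>)"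
        using l by (subst log_le_iff) auto
      then have "(\<Sum>m\<leftarrow>ms. i m) - n * expect J i \<le> - (n * \<delta>)"
        unfolding i_def using l(3) by (simp add: algebra_simps)
      then have "(n * \<delta>)\<^sup>2 \<le> ((\<Sum>m\<leftarrow>ms. i m) - n * expect J i)\<^sup>2"
        using \<delta> n by (subst abs_le_square_iff[symmetric]) auto
      then show ?thesis using \<delta> n by simp
    qed simp
  qed (use fin in simp)
  also have "\<dots> = dev J i / (n * \<delta>\<^sup>2)"
    using expect_iid_dev[OF fin, of n i] n by (simp add: power2_eq_square)
  finally show ?thesis .
qed

text \<open>The logarithm is at most 2 plus the positive part of the deviation \<open>X\<close> of
  the density from its mean. That part is at most
  \<open>n * \<delta> + X\<^sup>2 / (n * \<delta>)\<close>, whose mean involves only the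
  variance.\<close>

lemma covering_tail:
  fixes P Q :: "'m \<Rightarrow> real"
  assumes fin: "finite (set_pmf J)" and pos: "\<And>m. m \<in> set_pmf J \<Longrightarrow> P m > 0" "\<And>m. m \<in> set_pmf J \<Longrightarrow> Q m > 0"
    and \<delta>: "\<delta> > 0" and n: "n > 0"
  defines "i \<equiv> \<lambda>m. log 2 (P m / Q m)"
  assumes c: "2 powr (n * expect J i) \<le> c"
  shows "expect (iid n J) (\<lambda>ms. log 2 (2 + (\<Prod>m\<leftarrow>ms. P m) / (c * (\<Prod>m\<leftarrow>ms. Q m)))) \<le> 2 + n * \<delta> + dev J i / \<delta>"
proof -
  have c0: "c > 0" using c by (rule less_le_trans[rotated]) simp
  have "expect (iid n J) (\<lambda>ms. log 2 (2 + (\<Prod>m\<leftarrow>ms. P m) / (c * (\<Prod>m\<leftarrow>ms. Q m))))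
     \<le> expect (iid n J) (\<lambda>ms. 2 + n * \<delta> + ((\<Sum>m\<leftarrow>ms. i m) - n * expect J i)\<^sup>2 / (n * \<delta>))"
  proof (rule expect_mono)
    fix ms assume "ms \<in> set_pmf (iid n J)"
    then have ms: "\<And>m. m \<in> set ms \<Longrightarrow> P m > 0" "\<And>m. m \<in> set ms \<Longrightarrow> Q m > 0"
      using pos by (auto dest!: set_iid)
    note l = log_prod_list[of ms P Q, OF ms]
    define R where "R = (\<Prod>m\<leftarrow>ms. P m) / (\<Prod>m\<leftarrow>ms. Q m)"
    define X where "X = (\<Sum>m\<leftarrow>ms. i m) - n * expect J i"
    have R: "R > 0" "log 2 R = (\<Sum>m\<leftarrow>ms. i m)" using l by (auto simp: R_def i_def)
    \<comment> \<open>The factor 3 would do, as the power is at least 1; 4 has the integer logarithm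
      2 that appears in the bound.\<close>
    have "2 + R / c \<le> 4 * 2 powr (max 0 X)"
    proof -
      have "R / c \<le> R / 2 powr (n * expect J i)"
        using R c by (intro divide_left_mono) (auto intro: mult_pos_pos c0)
      also have "\<dots> = 2 powr X"
        using R by (simp add: X_def powr_diff flip: R(2))
      also have "\<dots> \<le> 2 powr (max 0 X)" by simp
      finally show ?thesis using ge_one_powr_ge_zero[of 2 "max 0 X"] by simp
    qed
    then have "log 2 (2 + R / c) \<le> log 2 (4 * 2 powr (max 0 X))"
      using R c0 by (subst log_le_cancel_iff) (auto intro: add_pos_pos)
    also have "\<dots> = 2 + max 0 X"
      using log_powr_cancel[of 2 2] by (subst log_mult) auto
    also have "max 0 X \<le> n * \<delta> + X\<^sup>2 / (n * \<delta>)"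
    proof (cases "X \<le> n * \<delta>")
      case True
      then show ?thesis using \<delta> n by (auto simp: max_def intro: add_increasing2 add_nonneg_nonneg)
    next
      case False
      have "n * \<delta> > 0" using \<delta> n by simp
      moreover from this have "X * (n * \<delta>) \<le> X * X" using False by (intro mult_left_mono) auto
      ultimately have "X \<le> X\<^sup>2 / (n * \<delta>)" by (simp add: pos_le_divide_eq power2_eq_square)
      with \<open>n * \<delta> > 0\<close> False show ?thesis by simp
    qed
    finally show "log 2 (2 + (\<Prod>m\<leftarrow>ms. P m) / (c * (\<Prod>m\<leftarrow>ms. Q m)))
       \<le> 2 + n * \<delta> + ((\<Sum>m\<leftarrow>ms. i m) - n * expect J i)\<^sup>2 / (n * \<delta>)"
      by (simp add: X_def R_def mult.commute)
  qed (use fin in simp)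
  also have "\<dots> = 2 + n * \<delta> + dev J i / \<delta>"
    using expect_iid_dev[OF fin, of n i] n fin by simp
  finally show ?thesis .
qed

lemma iid_joint: "iid n (joint (\<lambda>_::unit. p) L ()) = chanl (joint (\<lambda>_. p) L) (replicate n ())"
proof -
  have "(\<lambda>_::unit. joint (\<lambda>_::unit. p) L ()) = joint (\<lambda>_. p) L" by (rule ext) simp
  then show ?thesis by (simp add: iid_def)
qed

section \<open>Block codes from single-letter kernels\<close>

locale letters =
  fixes pA :: "'a pmf" and KB :: "'a \<Rightarrow> 'b pmf" and KC :: "'b \<Rightarrow> 'c pmf"
    and Ch :: "'c \<Rightarrow> 'o pmf"
    and fr :: "'o \<Rightarrow> 'r" and fy :: "'o \<Rightarrow> 'y" and fz :: "'o \<Rightarrow> 'z"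
  assumes fin_pA [simp]: "finite (set_pmf pA)"
    and fin_KB [simp]: "\<And>a. finite (set_pmf (KB a))"
    and fin_KC [simp]: "\<And>b. finite (set_pmf (KC b))"
    and fin_Ch [simp]: "\<And>c. finite (set_pmf (Ch c))"
begin

definition Lc :: "('o \<Rightarrow> 't) \<Rightarrow> 'c \<Rightarrow> 't pmf" where "Lc f c = map_pmf f (Ch c)"
definition Lb :: "('o \<Rightarrow> 't) \<Rightarrow> 'b \<Rightarrow> 't pmf" where "Lb f b = bind_pmf (KC b) (Lc f)"
definition La :: "('o \<Rightarrow> 't) \<Rightarrow> 'a \<Rightarrow> 't pmf" where "La f a = bind_pmf (KB a) (Lb f)"
definition L0 :: "('o \<Rightarrow> 't) \<Rightarrow> 't pmf" where "L0 f = bind_pmf pA (La f)"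

lemma fin_L [simp]: "finite (set_pmf (Lc f c))" "finite (set_pmf (Lb f b))" "finite (set_pmf (La f a))"
  by (auto simp: Lc_def Lb_def La_def)

text \<open>Letters and output form a Markov chain from \<open>pA\<close> through \<open>KB\<close>,
  \<open>KC\<close> and \<open>Ch\<close>. With A, B, C for the letters and T for the observed
  output, the three quantities are I(B;T|A), I(B;T) = I(A,B;T) and I(C;T|B).\<close>

definition Iab :: "('o \<Rightarrow> 't) \<Rightarrow> real" where
  "Iab f = expect pA (\<lambda>a. expect (KB a) (\<lambda>b. expect (Lb f b) (\<lambda>y. log 2 (pmf (Lb f b) y / pmf (La f a) y))))"
definition I0b :: "('o \<Rightarrow> 't) \<Rightarrow> real" where
  "I0b f = expect pA (\<lambda>a. expect (KB a) (\<lambda>b. expect (Lb f b) (\<lambda>y. log 2 (pmf (Lb f b) y / pmf (L0 f) y))))"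
definition Ibc :: "('o \<Rightarrow> 't) \<Rightarrow> real" where
  "Ibc f = expect pA (\<lambda>a. expect (KB a) (\<lambda>b. expect (KC b) (\<lambda>c. expect (Lc f c) (\<lambda>y. log 2 (pmf (Lc f c) y / pmf (Lb f b) y)))))"

definition Jab :: "('o \<Rightarrow> 't) \<Rightarrow> ('a \<times> 'b \<times> 't) pmf" where
  "Jab f = joint (\<lambda>_::unit. pA) (joint KB (Lb f)) ()"
definition Jbc :: "('o \<Rightarrow> 't) \<Rightarrow> ('a \<times> 'b \<times> 'c \<times> 't) pmf" where
  "Jbc f = joint (\<lambda>_::unit. pA) (joint KB (joint KC (Lc f))) ()"

lemma fin_J [simp]: "finite (set_pmf (Jab f))" "finite (set_pmf (Jbc f))"
  by (simp_all add: Jab_def Jbc_def)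

lemma Jab_pos:
  assumes "(a, b, y) \<in> set_pmf (Jab f)"
  shows "pmf (Lb f b) y > 0" "pmf (La f a) y > 0" "pmf (L0 f) y > 0"
proof -
  have *: "a \<in> set_pmf pA" "b \<in> set_pmf (KB a)" "y \<in> set_pmf (Lb f b)"
    using assms by (auto simp: Jab_def joint_def)
  then have "y \<in> set_pmf (La f a)" by (auto simp: La_def)
  moreover from this have "y \<in> set_pmf (L0 f)" using * by (auto simp: L0_def)
  ultimately show "pmf (Lb f b) y > 0" "pmf (La f a) y > 0" "pmf (L0 f) y > 0"
    using * by (auto intro!: pmf_positive)
qed

lemma Jbc_pos:
  assumes "(a, b, c, y) \<in> set_pmf (Jbc f)"
  shows "pmf (Lb f b) y > 0" "pmf (Lc f c) y > 0"
proof -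
  have *: "c \<in> set_pmf (KC b)" "y \<in> set_pmf (Lc f c)"
    using assms by (auto simp: Jbc_def joint_def)
  then show "pmf (Lb f b) y > 0" "pmf (Lc f c) y > 0"
    by (auto intro!: pmf_positive simp: Lb_def)
qed

definition "iab f m = log 2 (pmf (Lb f (fst (snd m))) (snd (snd m)) / pmf (La f (fst m)) (snd (snd m)))"
definition "i0b f m = log 2 (pmf (Lb f (fst (snd m))) (snd (snd m)) / pmf (L0 f) (snd (snd m)))"
definition "ibc f m = log 2 (pmf (Lc f (fst (snd (snd m)))) (snd (snd (snd m))) / pmf (Lb f (fst (snd m))) (snd (snd (snd m))))"

lemma Iab_J: "Iab f = expect (Jab f) (iab f)"
  and I0b_J: "I0b f = expect (Jab f) (i0b f)"
  and Ibc_J: "Ibc f = expect (Jbc f) (ibc f)"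
  by (simp_all add: Iab_def I0b_def Ibc_def Jab_def Jbc_def expect_joint iab_def i0b_def ibc_def)

lemma expect_chanl_Jab:
  "expect (iid n pA) (\<lambda>a. expect (chanl KB a) (\<lambda>b. expect (chanl (Lb f) b) (F a b)))
   = expect (iid n (Jab f)) (\<lambda>ms. F (map fst ms) (map (\<lambda>m. fst (snd m)) ms) (map (\<lambda>m. snd (snd m)) ms))"
proof -
  have "expect (iid n pA) (\<lambda>a. expect (chanl KB a) (\<lambda>b. expect (chanl (Lb f) b) (F a b)))
     = expect (iid n pA) (\<lambda>a. expect (chanl (joint KB (Lb f)) a) (\<lambda>m. F a (map fst m) (map snd m)))"
    by (subst expect_chanl_joint) simp_all
  also have "\<dots> = expect (iid n (Jab f)) (\<lambda>ms. F (map fst ms) (map fst (map snd ms)) (map snd (map snd ms)))"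
    unfolding Jab_def iid_joint unfolding iid_def by (subst expect_chanl_joint) simp_all
  finally show ?thesis by (simp add: o_def)
qed

lemma expect_chanl_Jbc:
  "expect (iid n pA) (\<lambda>a. expect (chanl KB a) (\<lambda>b. expect (chanl KC b) (\<lambda>c. expect (chanl (Lc f) c) (F a b c))))
   = expect (iid n (Jbc f)) (\<lambda>ms. F (map fst ms) (map (\<lambda>m. fst (snd m)) ms) (map (\<lambda>m. fst (snd (snd m))) ms)
       (map (\<lambda>m. snd (snd (snd m))) ms))"
proof -
  have "expect (iid n pA) (\<lambda>a. expect (chanl KB a) (\<lambda>b. expect (chanl KC b) (\<lambda>c. expect (chanl (Lc f) c) (F a b c))))
     = expect (iid n pA) (\<lambda>a. expect (chanl KB a) (\<lambda>b. expect (chanl (joint KC (Lc f)) b) (\<lambda>m. F a b (map fst m) (map snd m))))"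
    by (subst expect_chanl_joint[of KC]) simp_all
  also have "\<dots> = expect (iid n pA) (\<lambda>a. expect (chanl (joint KB (joint KC (Lc f))) a)
      (\<lambda>m. F a (map fst m) (map fst (map snd m)) (map snd (map snd m))))"
    by (subst expect_chanl_joint) simp_all
  also have "\<dots> = expect (iid n (Jbc f)) (\<lambda>ms. F (map fst ms) (map fst (map snd ms))
      (map fst (map snd (map snd ms))) (map snd (map snd (map snd ms))))"
    unfolding Jbc_def iid_joint unfolding iid_def by (subst expect_chanl_joint) simp_all
  finally show ?thesis by (simp add: o_def)
qed

definition block_code where
  "block_code n Ws Ss Js \<nu> \<epsilon> ca cb cc dr dy dz dk \<longleftrightarrow>
    (\<forall>v\<in>Ws. \<forall>w\<in>Ws. \<forall>k\<in>Ss \<times> Js. ca v \<in> set_pmf (iid n pA) \<and> cb v w \<in> set_pmf (chanl KB (ca v))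
        \<and> cc v w k \<in> set_pmf (chanl KC (cb v w))) \<and>
    expect \<nu> (\<lambda>(v, w, k). expect (chanl Ch (cc v w k)) (\<lambda>r. of_bool (\<not> (dr v (map fr r) = w
        \<and> dy w (map fy r) = v \<and> dz w (map fz r) = v \<and> dk v w (map fy r) = k)))) \<le> \<epsilon> \<and>
    expect \<nu> (\<lambda>(v, w, k). expect (chanl (Lc fz) (cc v w k)) (\<lambda>z. log 2 (1 +
        (\<Sum>j\<in>Js. pmf (chanl (Lc fz) (cc v w (fst k, j))) z) / card Js / pmf (chanl (Lb fz) (cb v w)) z))) \<le> \<epsilon> * n"

text \<open>The index sets are quantified inside \<open>eventually\<close> because they grow with
  \<open>n\<close>. The factors 4 and 8 leave room for rounding up two and three set sizes, each by
  at most a factor 2.\<close>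

theorem exists_block_code:
  fixes Iw \<eta> \<epsilon> :: real
  assumes \<eta>: "\<eta> > 0" and \<epsilon>: "\<epsilon> > 0"
    and I: "Iw \<le> Iab fr" "Iw \<le> I0b fy" "Iw \<le> I0b fz"
  shows "\<forall>\<^sub>F n in sequentially. \<forall>(Ws :: 'w set) (Ss :: 's set) (Js :: 'j set) \<nu>.
    finite Ws \<longrightarrow> finite Ss \<longrightarrow> finite Js \<longrightarrow> set_pmf \<nu> \<subseteq> Ws \<times> Ws \<times> Ss \<times> Js \<longrightarrow>
    card Ws \<le> 4 * 2 powr (n * (Iw - \<eta>)) \<longrightarrow> card Ss * card Js \<le> 8 * 2 powr (n * (Ibc fy - \<eta>)) \<longrightarrow>
    2 powr (n * Ibc fz) \<le> card Js \<longrightarrow>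
    (\<exists>ca cb cc dr dy dz dk. block_code n Ws Ss Js \<nu> \<epsilon> ca cb cc dr dy dz dk)"
proof -
  \<comment> \<open>At most \<open>\<eta> / 2\<close>, so that thresholds exceed the numbers of
    candidates by a factor exponential in \<open>n * (\<eta> / 2)\<close>; at most
    \<open>\<epsilon> / 2\<close>, because \<delta> is the limit of the total bound \<beta>.\<close>
  define \<delta> where "\<delta> = min (\<eta> / 2) (\<epsilon> / 2)"
  have \<delta>: "\<delta> > 0" "\<delta> \<le> \<eta> / 2" "\<delta> \<le> \<epsilon> / 2" using \<eta> \<epsilon> by (auto simp: \<delta>_def)
  define V where "V = dev (Jab fr) (iab fr) + dev (Jab fy) (i0b fy) + dev (Jab fz) (i0b fz) + dev (Jbc fy) (ibc fy)"
  define V' where "V' = dev (Jbc fz) (ibc fz)"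
  \<comment> \<open>20 = 4 + 4 + 4 + 8: three searches for a cloud index and one for a satellite.
    The last summand is the leakage weighted with \<open>1 / n\<close>.\<close>
  define \<beta> where "\<beta> = (\<lambda>n::nat. V / (n * \<delta>\<^sup>2) + 20 * 2 powr (- (n * (\<eta> / 2))) + (2 + n * \<delta> + V' / \<delta>) / n)"
  have "\<beta> \<longlonglongrightarrow> \<delta>"
    unfolding \<beta>_def using \<delta>(1) \<eta> by real_asymp
  moreover have "\<delta> < \<epsilon>" using \<delta> \<epsilon> by simp
  ultimately have "\<forall>\<^sub>F n in sequentially. \<beta> n < \<epsilon>" by (rule order_tendstoD(2))
  then show ?thesis
    using eventually_gt_at_top[of 0]
  proof eventually_elim
    case (elim n)
    show ?case
    proof (intro allI impI)
      fix Ws :: "'w set" and Ss :: "'s set" and Js :: "'j set" and \<nu>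
      assume fin: "finite Ws" "finite Ss" "finite Js" and \<nu>: "set_pmf \<nu> \<subseteq> Ws \<times> Ws \<times> Ss \<times> Js"
        and cW: "card Ws \<le> 4 * 2 powr (n * (Iw - \<eta>))"
        and cK: "card Ss * card Js \<le> 8 * 2 powr (n * (Ibc fy - \<eta>))"
        and cJ: "2 powr (n * Ibc fz) \<le> card Js"
      interpret S: superposition "iid n pA" "chanl KB" "chanl KC" "chanl Ch" Ws Ss Js
        by unfold_locales (use fin in auto)
      have c: "S.chan_c (map f) = chanl (Lc f)" for f :: "'o \<Rightarrow> 't"
        unfolding S.chan_c_def chanl_map Lc_def ..
      have b: "S.chan_b (map f) = chanl (Lb f)" for f :: "'o \<Rightarrow> 't"
        unfolding S.chan_b_def c chanl_bind Lb_def ..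
      have a: "S.chan_a (map f) = chanl (La f)" for f :: "'o \<Rightarrow> 't"
        unfolding S.chan_a_def b chanl_bind La_def ..
      have o: "S.chan_0 (map f) = iid n (L0 f)" for f :: "'o \<Rightarrow> 't"
      proof -
        have "S.chan_0 (map f) = bind_pmf (iid n pA) (chanl (La f))" by (simp only: S.chan_0_def a)
        then show ?thesis by (simp only: iid_def chanl_bind L0_def)
      qed
      have o': "pmf (iid n (L0 f)) (map h ms) = (\<Prod>m\<leftarrow>ms. pmf (L0 f) (h m))" if "length ms = n"
        for f :: "'o \<Rightarrow> 't" and h and ms :: "'q list"
        using that pmf_chanl_map[of "\<lambda>_. L0 f" "\<lambda>_. ()" ms h]
        by (simp add: iid_def map_replicate_const)
      have n: "n > 0" using elim by simp
      define \<theta> where "\<theta> = (\<lambda>I. 2 powr (n * (I - \<delta>)))"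
      have \<theta>: "\<theta> I > 0" for I by (simp add: \<theta>_def)
      have mr: "S.miss_ab (map f) (\<theta> (Iab f)) \<le> dev (Jab f) (iab f) / (n * \<delta>\<^sup>2)" for f :: "'o \<Rightarrow> 't"
      proof -
        have "S.miss_ab (map f) (\<theta> (Iab f)) = expect (iid n (Jab f)) (\<lambda>ms. of_bool (\<not> \<theta> (Iab f) *
           (\<Prod>m\<leftarrow>ms. pmf (La f (fst m)) (snd (snd m))) < (\<Prod>m\<leftarrow>ms. pmf (Lb f (fst (snd m))) (snd (snd m)))))"
          unfolding S.miss_ab_def a b
          by (subst expect_chanl_Jab) (simp only: pmf_chanl_map)
        also have "\<dots> \<le> dev (Jab f) (iab f) / (n * \<delta>\<^sup>2)"
          unfolding \<theta>_def Iab_J iab_def[abs_def] by (rule threshold_tail) (use n \<delta> Jab_pos in auto)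
        finally show ?thesis .
      qed
      have m0: "S.miss_0b (map f) (\<theta> (I0b f)) \<le> dev (Jab f) (i0b f) / (n * \<delta>\<^sup>2)" for f :: "'o \<Rightarrow> 't"
      proof -
        have "S.miss_0b (map f) (\<theta> (I0b f)) = expect (iid n (Jab f)) (\<lambda>ms. of_bool (\<not> \<theta> (I0b f) *
           (\<Prod>m\<leftarrow>ms. pmf (L0 f) (snd (snd m))) < (\<Prod>m\<leftarrow>ms. pmf (Lb f (fst (snd m))) (snd (snd m)))))"
          unfolding S.miss_0b_def b o
          by (subst expect_chanl_Jab, rule expect_cong) (simp add: pmf_chanl_map o' set_iid)
        also have "\<dots> \<le> dev (Jab f) (i0b f) / (n * \<delta>\<^sup>2)"
          unfolding \<theta>_def I0b_J i0b_def[abs_def] by (rule threshold_tail) (use n \<delta> Jab_pos in auto)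
        finally show ?thesis .
      qed
      have mk: "S.miss_bc (map f) (\<theta> (Ibc f)) \<le> dev (Jbc f) (ibc f) / (n * \<delta>\<^sup>2)" for f :: "'o \<Rightarrow> 't"
      proof -
        have "S.miss_bc (map f) (\<theta> (Ibc f)) = expect (iid n (Jbc f)) (\<lambda>ms. of_bool (\<not> \<theta> (Ibc f) *
           (\<Prod>m\<leftarrow>ms. pmf (Lb f (fst (snd m))) (snd (snd (snd m)))) < (\<Prod>m\<leftarrow>ms. pmf (Lc f (fst (snd (snd m)))) (snd (snd (snd m))))))"
          unfolding S.miss_bc_def b c
          by (subst expect_chanl_Jbc) (simp only: pmf_chanl_map)
        also have "\<dots> \<le> dev (Jbc f) (ibc f) / (n * \<delta>\<^sup>2)"
          unfolding \<theta>_def Ibc_J ibc_def[abs_def] by (rule threshold_tail) (use n \<delta> Jbc_pos in auto)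
        finally show ?thesis .
      qed
      have lz: "S.leak_bound (map fz) \<le> 2 + n * \<delta> + V' / \<delta>"
      proof -
        have "S.leak_bound (map fz) = expect (iid n (Jbc fz)) (\<lambda>ms. log 2 (2 +
           (\<Prod>m\<leftarrow>ms. pmf (Lc fz (fst (snd (snd m)))) (snd (snd (snd m)))) / (card Js * (\<Prod>m\<leftarrow>ms. pmf (Lb fz (fst (snd m))) (snd (snd (snd m)))))))"
          unfolding S.leak_bound_def b c
          by (subst expect_chanl_Jbc) (simp only: pmf_chanl_map)
        also have "\<dots> \<le> 2 + n * \<delta> + V' / \<delta>"
          unfolding V'_def ibc_def[abs_def]
          by (rule covering_tail) (use n \<delta> Jbc_pos cJ in \<open>auto simp: Ibc_J ibc_def[abs_def]\<close>)
        finally show ?thesis .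
      qed
      have ratio: "card Ws / \<theta> I \<le> 4 * 2 powr (- (n * (\<eta> / 2)))" if "Iw \<le> I" for I
      proof -
        have "card Ws / \<theta> I \<le> 4 * 2 powr (n * (Iw - \<eta>)) / 2 powr (n * (I - \<delta>))"
          unfolding \<theta>_def by (rule divide_right_mono[OF cW]) simp
        also have "\<dots> = 4 * 2 powr (n * (Iw - \<eta>) - n * (I - \<delta>))"
          by (simp add: powr_diff)
        also have "n * (Iw - \<eta>) - n * (I - \<delta>) = n * (Iw - \<eta> - I + \<delta>)"
          by (simp add: algebra_simps)
        also have "n * (Iw - \<eta> - I + \<delta>) \<le> n * (- (\<eta> / 2))" using that \<delta> by (intro mult_left_mono) auto
        finally show ?thesis by simp
      qed
      have "card S.Ks / \<theta> (Ibc fy) \<le> 8 * 2 powr (- (n * (\<eta> / 2)))"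
      proof -
        have "card S.Ks / \<theta> (Ibc fy) \<le> 8 * 2 powr (n * (Ibc fy - \<eta>)) / 2 powr (n * (Ibc fy - \<delta>))"
          using cK by (auto simp: S.Ks_def card_cartesian_product \<theta>_def intro!: divide_right_mono)
        also have "\<dots> = 8 * 2 powr (n * (Ibc fy - \<eta>) - n * (Ibc fy - \<delta>))"
          by (simp add: powr_diff)
        also have "n * (Ibc fy - \<eta>) - n * (Ibc fy - \<delta>) = n * (\<delta> - \<eta>)"
          by (simp add: algebra_simps)
        also have "n * (\<delta> - \<eta>) \<le> n * (- (\<eta> / 2))" using \<delta> by (intro mult_left_mono) auto
        finally show ?thesis by simp
      qed
      then have "S.miss_ab (map fr) (\<theta> (Iab fr)) + card Ws / \<theta> (Iab fr) + (S.miss_0b (map fy) (\<theta> (I0b fy)) + card Ws / \<theta> (I0b fy))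
          + (S.miss_0b (map fz) (\<theta> (I0b fz)) + card Ws / \<theta> (I0b fz)) + (S.miss_bc (map fy) (\<theta> (Ibc fy)) + card S.Ks / \<theta> (Ibc fy))
          + 1 / n * S.leak_bound (map fz)
        \<le> V / (n * \<delta>\<^sup>2) + 20 * 2 powr (- (n * (\<eta> / 2))) + 1 / n * (2 + n * \<delta> + V' / \<delta>)" (is "?err \<le> _")
        using mr[of fr] m0[of fy] m0[of fz] mk[of fy] mult_left_mono[OF lz, of "1 / n"] I[THEN ratio]
        by (simp add: V_def add_divide_distrib)
      also have "\<dots> = \<beta> n" by (simp add: \<beta>_def)
      also have "\<dots> \<le> \<epsilon>" using elim by simp
      finally have "?err \<le> \<epsilon>" .
      from S.exists_code[OF _ \<theta> \<theta> \<theta> \<theta> _ this, of \<nu>] n \<nu>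
      show "\<exists>ca cb cc dr dy dz dk. block_code n Ws Ss Js \<nu> \<epsilon> ca cb cc dr dy dz dk"
        unfolding b c S.Ks_def block_code_def by simp
    qed
  qed
qed

end

section \<open>Equivocation\<close>

lemma Ent_expect:
  assumes "finite (set_pmf q)"
  shows "Ent q f = - expect q (\<lambda>\<omega>. log 2 (pmf (map_pmf f q) (f \<omega>)))"
proof -
  have "expect (map_pmf f q) (\<lambda>a. log 2 (pmf (map_pmf f q) a)) = (\<Sum>a\<in>set_pmf (map_pmf f q). pmf (map_pmf f q) a * log 2 (pmf (map_pmf f q) a))"
    using assms by (intro expect_sum_pmf) simp
  then show ?thesis by (simp add: Ent_def entropy_pmf_def)
qed

lemma pmf_map_pos: "\<omega> \<in> set_pmf q \<Longrightarrow> pmf (map_pmf f q) (f \<omega>) > 0"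
  by (intro pmf_positive) simp

lemma pmf_map_mono:
  assumes "\<And>\<omega>'. \<omega>' \<in> set_pmf q \<Longrightarrow> f \<omega>' = f \<omega> \<Longrightarrow> g \<omega>' = g \<omega>"
  shows "pmf (map_pmf f q) (f \<omega>) \<le> pmf (map_pmf g q) (g \<omega>)"
  unfolding pmf_map using assms
  by (intro measure_pmf.finite_measure_mono_AE) (auto simp: AE_measure_pmf_iff)

text \<open>Entropy sees only the partition induced by a variable; the values of \<open>f\<close>
  and \<open>g\<close> may have different types.\<close>

lemma Ent_relabel:
  assumes "finite (set_pmf q)" "\<And>\<omega> \<omega>'. f \<omega> = f \<omega>' \<longleftrightarrow> g \<omega> = g \<omega>'"
  shows "Ent q f = Ent q g"
proof -
  have "pmf (map_pmf f q) (f \<omega>) = pmf (map_pmf g q) (g \<omega>)" for \<omega>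
    using assms(2) by (intro antisym pmf_map_mono) auto
  then show ?thesis using assms by (simp add: Ent_expect)
qed

lemma expect_restricted:
  assumes "finite (set_pmf q)"
  shows "expect q (\<lambda>\<omega>. of_bool (\<omega> \<in> G) * h (Y \<omega>)) = (\<Sum>y\<in>Y ` set_pmf q. measure_pmf.prob q {\<omega>\<in>G. Y \<omega> = y} * h y)"
proof -
  have "expect q (\<lambda>\<omega>. of_bool (\<omega> \<in> G) * h (Y \<omega>)) = (\<Sum>\<omega>\<in>set_pmf q. pmf q \<omega> * (of_bool (\<omega> \<in> G) * h (Y \<omega>)))"
    using assms by (rule expect_sum_pmf)
  also have "\<dots> = (\<Sum>y\<in>Y ` set_pmf q. \<Sum>\<omega>\<in>{\<omega>\<in>set_pmf q. Y \<omega> = y}. pmf q \<omega> * (of_bool (\<omega> \<in> G) * h (Y \<omega>)))"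
    using assms by (intro sum.image_gen)
  also have "\<dots> = (\<Sum>y\<in>Y ` set_pmf q. measure_pmf.prob q {\<omega>\<in>G. Y \<omega> = y} * h y)"
  proof (rule sum.cong[OF refl])
    fix y
    have "measure_pmf.prob q {\<omega>\<in>G. Y \<omega> = y} = measure_pmf.prob q ({\<omega>\<in>G. Y \<omega> = y} \<inter> set_pmf q)"
      by (rule measure_Int_set_pmf[symmetric])
    also have "\<dots> = (\<Sum>\<omega>\<in>{\<omega>\<in>set_pmf q. Y \<omega> = y}. pmf q \<omega> * of_bool (\<omega> \<in> G))"
      using assms by (subst measure_measure_pmf_finite) (auto intro!: sum.mono_neutral_cong_left)
    finally show "(\<Sum>\<omega>\<in>{\<omega>\<in>set_pmf q. Y \<omega> = y}. pmf q \<omega> * (of_bool (\<omega> \<in> G) * h (Y \<omega>)))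
        = measure_pmf.prob q {\<omega>\<in>G. Y \<omega> = y} * h y"
      by (simp add: sum_distrib_right mult.assoc)
  qed
  finally show ?thesis .
qed

text \<open>With \<open>T\<close> revealed to the eavesdropper, it suffices to compare on a good event \<open>G\<close> with a
  majorant of the joint law and an arbitrary reference law: \<open>log x \<le> x / ln 2\<close> absorbs
  conditioning, the restriction to \<open>G\<close> and the change of measure at once, so neither Fano's
  inequality nor continuity of entropy is needed.\<close>

theorem equivocation_lower_bound:
  fixes q :: "'w pmf" and Qp :: "('z \<times> 't) pmf" and R :: "'s \<Rightarrow> 'z \<Rightarrow> 't \<Rightarrow> real"
  assumes fin: "finite (set_pmf q)"
    and S: "\<And>\<omega> \<omega>'. \<omega> \<in> set_pmf q \<Longrightarrow> \<omega>' \<in> set_pmf q \<Longrightarrow> A \<omega> = A \<omega>' \<Longrightarrow> S \<omega> = S \<omega>'"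
    and R: "\<And>s z t. measure_pmf.prob q {\<omega>\<in>G. (S \<omega>, Z \<omega>, T \<omega>) = (s, z, t)} \<le> R s z t"
    and pos: "\<And>\<omega>. \<omega> \<in> set_pmf q \<inter> G \<Longrightarrow> R (S \<omega>) (Z \<omega>) (T \<omega>) > 0 \<and> pmf Qp (Z \<omega>, T \<omega>) > 0"
  shows "cEnt q A Z \<ge> expect q (\<lambda>\<omega>. of_bool (\<omega> \<in> G) * log 2 (pmf Qp (Z \<omega>, T \<omega>) / R (S \<omega>) (Z \<omega>) (T \<omega>))) - 1 / ln 2"
proof -
  let ?PZ = "pmf (map_pmf Z q)" and ?PSZ = "pmf (map_pmf (\<lambda>\<omega>. (S \<omega>, Z \<omega>)) q)"
    and ?PAZ = "pmf (map_pmf (\<lambda>\<omega>. (A \<omega>, Z \<omega>)) q)"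
  \<comment> \<open>\<open>?PSZ / ?PZ\<close> is the conditional law of the secret given the
    observation, so \<open>pmf Qp (z, t) * (?PSZ (s, z) / ?PZ z)\<close> has total mass at most
    1.\<close>
  define h where "h = (\<lambda>(s, z, t). pmf Qp (z, t) / R s z t * (?PSZ (s, z) / ?PZ z))"
  have "expect q (\<lambda>\<omega>. of_bool (\<omega> \<in> G) * log 2 (pmf Qp (Z \<omega>, T \<omega>) / R (S \<omega>) (Z \<omega>) (T \<omega>)))
     \<le> expect q (\<lambda>\<omega>. log 2 (?PZ (Z \<omega>)) - log 2 (?PAZ (A \<omega>, Z \<omega>)) + of_bool (\<omega> \<in> G) * h (S \<omega>, Z \<omega>, T \<omega>) / ln 2)"
  proof (rule expect_mono[OF fin])
    fix \<omega> assume \<omega>: "\<omega> \<in> set_pmf q"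
    have PZ: "?PZ (Z \<omega>) > 0" and PSZ: "?PSZ (S \<omega>, Z \<omega>) > 0" and PAZ: "?PAZ (A \<omega>, Z \<omega>) > 0"
      using pmf_map_pos[OF \<omega>, of Z] pmf_map_pos[OF \<omega>, of "\<lambda>\<omega>. (S \<omega>, Z \<omega>)"]
        pmf_map_pos[OF \<omega>, of "\<lambda>\<omega>. (A \<omega>, Z \<omega>)"] by auto
    have "?PAZ (A \<omega>, Z \<omega>) \<le> ?PSZ (S \<omega>, Z \<omega>)"
      by (rule pmf_map_mono[of q "\<lambda>\<omega>. (A \<omega>, Z \<omega>)" \<omega> "\<lambda>\<omega>. (S \<omega>, Z \<omega>)"]) (auto intro: S[OF _ \<omega>])
    then have 1: "log 2 (?PAZ (A \<omega>, Z \<omega>)) \<le> log 2 (?PSZ (S \<omega>, Z \<omega>))"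
      using PAZ PSZ by simp
    have "?PSZ (S \<omega>, Z \<omega>) \<le> ?PZ (Z \<omega>)"
      using pmf_map_mono[of q "\<lambda>\<omega>. (S \<omega>, Z \<omega>)" \<omega> Z] by auto
    then have 2: "log 2 (?PSZ (S \<omega>, Z \<omega>)) \<le> log 2 (?PZ (Z \<omega>))"
      using PZ PSZ by simp
    show "of_bool (\<omega> \<in> G) * log 2 (pmf Qp (Z \<omega>, T \<omega>) / R (S \<omega>) (Z \<omega>) (T \<omega>))
      \<le> log 2 (?PZ (Z \<omega>)) - log 2 (?PAZ (A \<omega>, Z \<omega>)) + of_bool (\<omega> \<in> G) * h (S \<omega>, Z \<omega>, T \<omega>) / ln 2"
    proof (cases "\<omega> \<in> G")
      case True
      define x where "x = pmf Qp (Z \<omega>, T \<omega>) / R (S \<omega>) (Z \<omega>) (T \<omega>)"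
      define y where "y = ?PSZ (S \<omega>, Z \<omega>) / ?PZ (Z \<omega>)"
      have x: "x > 0" and y: "y > 0" using pos \<omega> True PZ PSZ by (auto simp: x_def y_def)
      have "log 2 (x * y) \<le> (x * y) / ln 2"
      proof -
        have "log 2 (x * y) \<le> (x * y - 1) / ln 2"
          using log2_tangent[of "x * y" 1] x y by simp
        also have "\<dots> \<le> (x * y) / ln 2" by (intro divide_right_mono) auto
        finally show ?thesis .
      qed
      moreover have "log 2 (x * y) = log 2 x + log 2 y" using x y by (simp add: log_mult)
      moreover have "log 2 y = log 2 (?PSZ (S \<omega>, Z \<omega>)) - log 2 (?PZ (Z \<omega>))"
        using PZ PSZ by (simp add: y_def log_divide)
      ultimately show ?thesis using 1 True by (simp add: h_def x_def y_def)
    qed (use 1 2 in simp)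
  qed
  also have "\<dots> = cEnt q A Z + expect q (\<lambda>\<omega>. of_bool (\<omega> \<in> G) * h (S \<omega>, Z \<omega>, T \<omega>)) / ln 2"
    using fin by (simp add: cEnt_def Ent_expect)
  \<comment> \<open>The restriction to \<open>G\<close> has mass at most \<open>R\<close> at each
    point, which cancels the denominator of \<open>h\<close> and leaves that
    sub-probability.\<close>
  also have "expect q (\<lambda>\<omega>. of_bool (\<omega> \<in> G) * h (S \<omega>, Z \<omega>, T \<omega>)) \<le> 1"
  proof -
    let ?Y = "\<lambda>\<omega>. (S \<omega>, Z \<omega>, T \<omega>)"
    have "expect q (\<lambda>\<omega>. of_bool (\<omega> \<in> G) * h (?Y \<omega>)) = (\<Sum>y\<in>?Y ` set_pmf q. measure_pmf.prob q {\<omega>\<in>G. ?Y \<omega> = y} * h y)"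
      by (rule expect_restricted[OF fin])
    also have "\<dots> \<le> (\<Sum>(s, z, t)\<in>?Y ` set_pmf q. pmf Qp (z, t) * (?PSZ (s, z) / ?PZ z))"
    proof (rule sum_mono)
      fix y assume "y \<in> ?Y ` set_pmf q"
      obtain s z t where y: "y = (s, z, t)" by (cases y)
      have R0: "R s z t \<ge> 0" using R[of s z t] measure_nonneg[of "measure_pmf q"] by (rule order_trans[rotated])
      have "measure_pmf.prob q {\<omega>\<in>G. ?Y \<omega> = y} * h y \<le> R s z t * h y"
        using R[of s z t] R0 unfolding y
        by (intro mult_right_mono) (auto simp: h_def intro!: mult_nonneg_nonneg divide_nonneg_nonneg)
      also have "\<dots> \<le> pmf Qp (z, t) * (?PSZ (s, z) / ?PZ z)"
        by (cases "R s z t = 0") (auto simp: h_def y)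
      finally show "measure_pmf.prob q {\<omega>\<in>G. ?Y \<omega> = y} * h y \<le> (case y of (s, z, t) \<Rightarrow> pmf Qp (z, t) * (?PSZ (s, z) / ?PZ z))"
        by (simp add: y)
    qed
    also have "\<dots> \<le> (\<Sum>(s, z, t)\<in>S ` set_pmf q \<times> Z ` set_pmf q \<times> T ` set_pmf q. pmf Qp (z, t) * (?PSZ (s, z) / ?PZ z))"
      using fin by (intro sum_mono2) (auto intro!: mult_nonneg_nonneg divide_nonneg_nonneg)
    also have "\<dots> = (\<Sum>(z, t)\<in>Z ` set_pmf q \<times> T ` set_pmf q. pmf Qp (z, t) * ((\<Sum>s\<in>S ` set_pmf q. ?PSZ (s, z)) / ?PZ z))"
      by (subst sum.cartesian_product[symmetric], subst sum.swap)
         (simp add: sum_distrib_left sum_divide_distrib case_prod_unfold)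
    also have "\<dots> \<le> (\<Sum>(z, t)\<in>Z ` set_pmf q \<times> T ` set_pmf q. pmf Qp (z, t))"
    proof (rule sum_mono, clarify)
      fix \<omega>1 \<omega>2 assume "\<omega>1 \<in> set_pmf q" "\<omega>2 \<in> set_pmf q"
      let ?z = "Z \<omega>1" and ?t = "T \<omega>2"
      have "(\<Sum>s\<in>S ` set_pmf q. ?PSZ (s, ?z)) = (\<Sum>y\<in>(\<lambda>s. (s, ?z)) ` S ` set_pmf q. ?PSZ y)"
        by (subst sum.reindex) (auto simp: inj_on_def)
      also have "\<dots> = measure_pmf.prob (map_pmf (\<lambda>\<omega>. (S \<omega>, Z \<omega>)) q) ((\<lambda>s. (s, ?z)) ` S ` set_pmf q)"
        using fin by (subst measure_measure_pmf_finite) auto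
      also have "\<dots> \<le> ?PZ ?z"
        unfolding pmf_map by (auto simp: intro!: measure_pmf.finite_measure_mono)
      finally have "(\<Sum>s\<in>S ` set_pmf q. ?PSZ (s, ?z)) / ?PZ ?z \<le> 1"
        by (auto intro!: divide_le_eq_1[THEN iffD2])
      then show "pmf Qp (?z, ?t) * ((\<Sum>s\<in>S ` set_pmf q. ?PSZ (s, ?z)) / ?PZ ?z) \<le> pmf Qp (?z, ?t)"
        by (intro mult_left_le) auto
    qed
    also have "\<dots> = measure_pmf.prob Qp (Z ` set_pmf q \<times> T ` set_pmf q)"
      using fin by (subst measure_measure_pmf_finite) (auto simp: case_prod_unfold)
    also have "\<dots> \<le> 1" by simp
    finally show ?thesis .
  qed
  finally show ?thesis by (simp add: divide_right_mono)
qed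

section \<open>Divergence and conditional laws\<close>

lemma KL_nonneg:
  assumes "finite (set_pmf P)" "\<And>y. y \<in> set_pmf P \<Longrightarrow> pmf Q y > 0"
  shows "expect P (\<lambda>y. log 2 (pmf P y / pmf Q y)) \<ge> 0"
proof -
  have "expect P (\<lambda>y. (1 - pmf Q y / pmf P y) / ln 2) \<le> expect P (\<lambda>y. log 2 (pmf P y / pmf Q y))"
  proof (rule expect_mono[OF assms(1)])
    fix y assume y: "y \<in> set_pmf P"
    have "log 2 (pmf Q y / pmf P y) \<le> log 2 1 + (pmf Q y / pmf P y - 1) / (1 * ln 2)"
      using assms(2)[OF y] y by (intro log2_tangent) (auto simp: pmf_positive)
    then show "(1 - pmf Q y / pmf P y) / ln 2 \<le> log 2 (pmf P y / pmf Q y)"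
      using assms(2)[OF y] pmf_positive[OF y] by (simp add: log_divide diff_divide_distrib)
  qed
  moreover have "expect P (\<lambda>y. pmf Q y / pmf P y) \<le> 1"
  proof -
    have "expect P (\<lambda>y. pmf Q y / pmf P y) = (\<Sum>y\<in>set_pmf P. pmf Q y)"
      unfolding expect_sum_pmf[OF assms(1)] by (intro sum.cong) (auto simp: set_pmf_iff)
    also have "\<dots> = measure_pmf.prob Q (set_pmf P)"
      using assms by (simp add: measure_measure_pmf_finite)
    finally show ?thesis by simp
  qed
  moreover have "expect P (\<lambda>y. (1 - pmf Q y / pmf P y) / ln 2) = (1 - expect P (\<lambda>y. pmf Q y / pmf P y)) / ln 2"
    using assms by simp
  ultimately show ?thesis by (smt (verit) divide_nonneg_pos ln_gt_zero)
qed

text \<open>Applied to the second receiver: the hypothesis on \<open>Req\<close> then implies that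
  the protected part alone fits into the satellites.\<close>

lemma (in letters) Ibc_nonneg: "Ibc f \<ge> 0"
proof -
  have *: "expect (Lc f c) (\<lambda>y. log 2 (pmf (Lc f c) y / pmf (Lb f b) y)) \<ge> 0" if "c \<in> set_pmf (KC b)" for b c
    using that by (intro KL_nonneg fin_L) (auto simp: Lb_def intro!: pmf_positive)
  show ?thesis
    unfolding Ibc_def
    by (rule expect_ge_const, simp, rule expect_ge_const, simp, rule expect_ge_const, simp, erule *)
qed

text \<open>The conditional law of the second coordinate given the first; unspecified outside the
  support of the first marginal.\<close>

definition kernel_of :: "('a \<times> 'b) pmf \<Rightarrow> 'a \<Rightarrow> 'b pmf" where
  "kernel_of p a = map_pmf snd (cond_pmf p {y. fst y = a})"

lemma joint_kernel_of: "joint (\<lambda>_::unit. map_pmf fst p) (kernel_of p) () = p"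
proof (rule pmf_eqI)
  fix y :: "'a \<times> 'b"
  obtain a b where y: "y = (a, b)" by (cases y)
  have *: "map_pmf (Pair a') (kernel_of p a') = cond_pmf p {y. fst y = a'}" if "a' \<in> set_pmf (map_pmf fst p)" for a'
  proof -
    have ne: "set_pmf p \<inter> {y. fst y = a'} \<noteq> {}" using that by auto
    have "map_pmf (Pair a') (kernel_of p a') = map_pmf (\<lambda>y. (a', snd y)) (cond_pmf p {y. fst y = a'})"
      by (simp add: kernel_of_def pmf.map_comp o_def)
    also have "\<dots> = map_pmf (\<lambda>y. y) (cond_pmf p {y. fst y = a'})"
      using set_cond_pmf[OF ne] by (intro map_pmf_cong) auto
    finally show ?thesis by simp
  qed
  have "joint (\<lambda>_::unit. map_pmf fst p) (kernel_of p) () = bind_pmf (map_pmf fst p) (\<lambda>a'. cond_pmf p {y. fst y = a'})"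
    unfolding joint_def using * by (intro bind_pmf_cong) auto
  also have "\<dots> = p"
    by (rule bind_cond_pmf_cancel) (auto simp: vimage_def)
  finally show "pmf (joint (\<lambda>_::unit. map_pmf fst p) (kernel_of p) ()) y = pmf p y" by simp
qed

section \<open>Block Markov coding\<close>

lemma chanl_take: "map_pmf (take k) (chanl K xs) = chanl K (take k xs)"
proof (induction xs arbitrary: k)
  case (Cons x xs)
  show ?case
    by (cases k) (simp_all add: chanl.simps map_bind_pmf pmf.map_comp o_def flip: Cons.IH)
qed simp

lemma chanl_drop: "map_pmf (drop k) (chanl K xs) = chanl K (drop k xs)"
proof (induction xs arbitrary: k)
  case (Cons x xs)
  show ?case
    by (cases k) (simp_all add: chanl.simps map_bind_pmf pmf.map_comp o_def flip: Cons.IH)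
qed simp

definition block :: "nat \<Rightarrow> nat \<Rightarrow> 'a list \<Rightarrow> 'a list" where
  "block n b xs = take n (drop (b * n) xs)"

lemma chanl_block: "map_pmf (block n b) (chanl K xs) = chanl K (block n b xs)"
proof -
  have "map_pmf (block n b) (chanl K xs) = map_pmf (take n) (map_pmf (drop (b * n)) (chanl K xs))"
    by (simp add: pmf.map_comp o_def block_def[abs_def])
  then show ?thesis by (simp add: chanl_take chanl_drop block_def)
qed

lemma block_map: "block n b (map f xs) = map f (block n b xs)"
  by (simp add: block_def take_map drop_map)

lemma block_nth: "j < n \<Longrightarrow> b * n + j < length xs \<Longrightarrow> block n b xs ! j = xs ! (b * n + j)"
  by (simp add: block_def)

lemma block_take: "(b + 1) * n \<le> k \<Longrightarrow> block n b (take k xs) = block n b xs"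
  by (simp add: block_def drop_take take_take min_def algebra_simps)

lemma length_concat_blocks:
  assumes "\<And>b. b < B \<Longrightarrow> length (f b) = n"
  shows "length (concat (map f [0..<B])) = n * B"
  using assms by (induction B) auto

lemma block_concat:
  assumes "\<And>b. b < B \<Longrightarrow> length (f b) = n" "b < B"
  shows "block n b (concat (map f [0..<B]) @ ys) = f b"
proof -
  have "[0..<B] = [0..<b] @ b # [Suc b..<B]"
    using assms(2) by (metis le_add_diff_inverse less_imp_le_nat upt_add_eq_append upt_conv_Cons zero_le)
  moreover have "length (concat (map f [0..<b])) = n * b"
    using assms by (intro length_concat_blocks) auto
  ultimately show ?thesis
    using assms by (simp add: block_def mult.commute)
qed

lemma pmf_chanl_blocks:
  assumes "\<And>b. b < B \<Longrightarrow> length (f b) = n" "length z = n * B + length ys"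
  shows "pmf (chanl K (concat (map f [0..<B]) @ ys)) z
       = (\<Prod>b<B. pmf (chanl K (f b)) (block n b z)) * pmf (chanl K ys) (drop (n * B) z)"
  using assms
proof (induction B arbitrary: ys)
  case (Suc B)
  let ?v = "drop (n * B) z"
  have "pmf (chanl K (concat (map f [0..<Suc B]) @ ys)) z
      = (\<Prod>b<B. pmf (chanl K (f b)) (block n b z)) * pmf (chanl K (f B @ ys)) ?v"
    using Suc.IH[of "f B @ ys"] Suc.prems by simp
  also have "pmf (chanl K (f B @ ys)) ?v = pmf (chanl K (f B @ ys)) (take n ?v @ drop n ?v)"
    by (simp only: append_take_drop_id)
  also have "\<dots> = pmf (chanl K (f B)) (take n ?v) * pmf (chanl K ys) (drop n ?v)"
    using Suc.prems by (intro pmf_chanl_append) simp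
  finally show ?case by (simp add: block_def mult.commute add.commute)
qed simp

text \<open>Keeps the relay outputs, which \<open>run_channel\<close> discards: the good event
  refers to what the relay decodes.\<close>

primrec run_full ::
  "('x \<Rightarrow> 'x1 \<Rightarrow> ('y \<times> 'y1 \<times> 'z) pmf) \<Rightarrow> ('y1 list \<Rightarrow> 'x1 pmf) \<Rightarrow> 'x list \<Rightarrow> 'y1 list
     \<Rightarrow> ('y \<times> 'y1 \<times> 'z) list pmf" where
  "run_full W r [] past = return_pmf []"
| "run_full W r (x # xs) past =
     bind_pmf (r past) (\<lambda>x1. bind_pmf (W x x1) (\<lambda>o'.
       map_pmf ((#) o') (run_full W r xs (past @ [fst (snd o')]))))"

lemma run_channel_full:
  "run_channel W r xs past = map_pmf (\<lambda>os. (map fst os, map (\<lambda>o'. snd (snd o')) os)) (run_full W r xs past)"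
proof (induction xs arbitrary: past)
  case (Cons x xs)
  show ?case
    by (simp add: Cons.IH map_bind_pmf pmf.map_comp o_def case_prod_unfold)
qed simp

lemma finite_run_full [simp]:
  fixes W :: "'x \<Rightarrow> 'x1::finite \<Rightarrow> ('y::finite \<times> 'y1::finite \<times> 'z::finite) pmf"
  shows "finite (set_pmf (run_full W r xs past))"
  by (induction xs arbitrary: past) auto

text \<open>The assumption on the relay concerns only the prefixes of the given outcome, so equality
  is claimed for this outcome and not for the laws. Along these prefixes the relay sends the
  prescribed letters, feedback disappears and the probability factors.\<close>

lemma pmf_run_full_eq:
  fixes W :: "'x \<Rightarrow> 'x1 \<Rightarrow> ('y \<times> 'y1 \<times> 'z) pmf"
  assumes "length os = length cs"
    "\<And>i. i < length cs \<Longrightarrow> r (past @ map (\<lambda>o'. fst (snd o')) (take i os)) = return_pmf (x1of (cs ! i))"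
  shows "pmf (bind_pmf (chanl KX cs) (\<lambda>xs. run_full W r xs past)) os
       = pmf (chanl (\<lambda>c. bind_pmf (KX c) (\<lambda>x. W x (x1of c))) cs) os"
  using assms
proof (induction cs arbitrary: os past)
  case Nil
  then show ?case by (simp add: bind_return_pmf)
next
  case (Cons c cs)
  then obtain o' os' where os: "os = o' # os'" by (cases os) auto
  have "r past = return_pmf (x1of c)" using Cons.prems(2)[of 0] by simp
  then have "bind_pmf (chanl KX (c # cs)) (\<lambda>xs. run_full W r xs past)
    = bind_pmf (KX c) (\<lambda>x. bind_pmf (chanl KX cs) (\<lambda>xs. bind_pmf (W x (x1of c)) (\<lambda>o'.
       map_pmf ((#) o') (run_full W r xs (past @ [fst (snd o')])))))"
    by (simp add: chanl.simps bind_assoc_pmf bind_map_pmf bind_return_pmf)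
  \<comment> \<open>The inputs of later uses are drawn independently of the present use of the
    channel, so the two draws commute.\<close>
  also have "\<dots> = bind_pmf (KX c) (\<lambda>x. bind_pmf (W x (x1of c)) (\<lambda>o'. bind_pmf (chanl KX cs) (\<lambda>xs.
       map_pmf ((#) o') (run_full W r xs (past @ [fst (snd o')])))))"
    by (subst (2) bind_commute_pmf) simp
  also have "\<dots> = bind_pmf (bind_pmf (KX c) (\<lambda>x. W x (x1of c))) (\<lambda>o'.
       map_pmf ((#) o') (bind_pmf (chanl KX cs) (\<lambda>xs. run_full W r xs (past @ [fst (snd o')]))))"
    by (simp add: bind_assoc_pmf map_bind_pmf)
  finally have "pmf (bind_pmf (chanl KX (c # cs)) (\<lambda>xs. run_full W r xs past)) os
    = pmf (bind_pmf (KX c) (\<lambda>x. W x (x1of c))) o'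
      * pmf (bind_pmf (chanl KX cs) (\<lambda>xs. run_full W r xs (past @ [fst (snd o')]))) os'"
    by (simp add: os pmf_bind_Cons)
  also have "pmf (bind_pmf (chanl KX cs) (\<lambda>xs. run_full W r xs (past @ [fst (snd o')]))) os'
     = pmf (chanl (\<lambda>c. bind_pmf (KX c) (\<lambda>x. W x (x1of c))) cs) os'"
  proof (rule Cons.IH)
    show "length os' = length cs" using Cons.prems os by simp
    show "r ((past @ [fst (snd o')]) @ map (\<lambda>o'. fst (snd o')) (take i os')) = return_pmf (x1of (cs ! i))"
      if "i < length cs" for i
      using Cons.prems(2)[of "Suc i"] that by (simp add: os)
  qed
  finally show ?case by (simp add: os)
qed

lemma pmf_joint: "pmf (joint (\<lambda>_::unit. p) K ()) (x, y) = pmf p x * pmf (K x) y"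
proof -
  have "pmf (map_pmf (Pair x') (K x')) (x, y) = indicator {x} x' * pmf (K x) y" for x'
  proof (cases "x' = x")
    case True
    then show ?thesis using pmf_map_inj'[of "Pair x" "K x" y] by (simp add: inj_on_def)
  next
    case False
    then show ?thesis by (auto simp: pmf_eq_0_set_pmf)
  qed
  then show ?thesis by (simp add: joint_def pmf_bind measure_pmf_single)
qed

lemma expect_agree:
  assumes "finite (set_pmf p)" "finite (set_pmf q)" "\<And>\<omega>. \<omega> \<in> G \<Longrightarrow> pmf p \<omega> = pmf q \<omega>"
  shows "expect p (\<lambda>\<omega>. of_bool (\<omega> \<in> G) * h \<omega>) = expect q (\<lambda>\<omega>. of_bool (\<omega> \<in> G) * h \<omega>)"
proof -
  have "expect p (\<lambda>\<omega>. of_bool (\<omega> \<in> G) * h \<omega>) = (\<Sum>\<omega>\<in>set_pmf p \<union> set_pmf q. of_bool (\<omega> \<in> G) * h \<omega> * pmf p \<omega>)"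
    using assms by (intro integral_measure_pmf_real) auto
  also have "\<dots> = (\<Sum>\<omega>\<in>set_pmf p \<union> set_pmf q. of_bool (\<omega> \<in> G) * h \<omega> * pmf q \<omega>)"
    using assms(3) by (intro sum.cong) auto
  also have "\<dots> = expect q (\<lambda>\<omega>. of_bool (\<omega> \<in> G) * h \<omega>)"
    using assms by (intro integral_measure_pmf_real[symmetric]) auto
  finally show ?thesis .
qed

lemma expect_of_bool_eq:
  assumes "finite (set_pmf p)"
  shows "expect p (\<lambda>x. of_bool (x = a) * h x) = pmf p a * h a"
proof -
  have "expect p (\<lambda>x. of_bool (x = a) * h x) = (\<Sum>x\<in>{a}. of_bool (x = a) * h x * pmf p x)"
    by (intro integral_measure_pmf_real) auto
  then show ?thesis by simp
qed

lemma log2_prod: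
  assumes "finite I" "\<And>i. i \<in> I \<Longrightarrow> f i > (0::real)"
  shows "log 2 (\<Prod>i\<in>I. f i) = (\<Sum>i\<in>I. log 2 (f i))"
proof -
  have "ln (\<Prod>i\<in>I. f i) = (\<Sum>i\<in>I. ln (f i))"
    using assms by (intro ln_prod) force+
  then show ?thesis by (simp add: log_def sum_divide_distrib)
qed

text \<open>The default value outside \<open>{1..<B}\<close> fixes the first and the last cloud index to \<open>(0, 0)\<close>:
  the former initialises the relay, the latter the backward decoders.\<close>

definition common :: "nat \<Rightarrow> nat \<Rightarrow> (nat \<Rightarrow> nat) pmf" where
  "common B M = Pi_pmf {1..<B} 0 (\<lambda>_. pmf_of_set {..<M})"
definition confidential :: "nat \<Rightarrow> nat \<Rightarrow> nat \<Rightarrow> (nat \<Rightarrow> nat \<times> nat) pmf" where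
  "confidential B S J = Pi_pmf {..<B} (0, 0) (\<lambda>_. pmf_of_set ({..<S} \<times> {..<J}))"
definition dummy :: "nat \<Rightarrow> nat \<Rightarrow> (nat \<Rightarrow> nat) pmf" where
  "dummy B D = Pi_pmf {..<B} 0 (\<lambda>_. pmf_of_set {..<D})"

type_synonym clouds = "(nat \<Rightarrow> nat) \<times> (nat \<Rightarrow> nat)"
type_synonym msg = "clouds \<times> (nat \<Rightarrow> nat \<times> nat) \<times> (nat \<Rightarrow> nat)"

definition msgs :: "nat \<Rightarrow> nat \<Rightarrow> nat \<Rightarrow> nat \<Rightarrow> nat \<Rightarrow> nat \<Rightarrow> msg pmf" where
  "msgs B M0 M1 S J D = bind_pmf (pair_pmf (common B M0) (common B M1)) (\<lambda>t.
     bind_pmf (confidential B S J) (\<lambda>\<kappa>. map_pmf (\<lambda>d. (t, \<kappa>, d)) (dummy B D)))"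

definition cloud :: "clouds \<Rightarrow> nat \<Rightarrow> nat \<times> nat" where
  "cloud t b = (fst t b, snd t b)"

text \<open>Block \<open>b\<close> introduces the cloud index \<open>Suc b\<close> while the relay
  repeats index \<open>b\<close>; thus \<open>B\<close> blocks involve the indices 0 to
  \<open>B\<close>, of which the two ends are fixed.\<close>

definition idx :: "msg \<Rightarrow> nat \<Rightarrow> (nat \<times> nat) \<times> (nat \<times> nat) \<times> nat \<times> nat \<times> nat" where
  "idx m b = (cloud (fst m) b, cloud (fst m) (Suc b), fst (fst (snd m) b), snd (fst (snd m) b), snd (snd m) b)"

text \<open>The index law under which the codebook is selected: a uniformly chosen block. Because
  the same codebook is reused, \<open>B\<close> times this average is the sum over all
  blocks.\<close>

definition block_index :: "nat \<Rightarrow> nat \<Rightarrow> nat \<Rightarrow> nat \<Rightarrow> nat \<Rightarrow> nat \<Rightarrow> ((nat \<times> nat) \<times> (nat \<times> nat) \<times> nat \<times> nat \<times> nat) pmf" where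
  "block_index B M0 M1 S J D = bind_pmf (pmf_of_set {..<B}) (\<lambda>b. map_pmf (\<lambda>m. idx m b) (msgs B M0 M1 S J D))"

lemma set_common: "M > 0 \<Longrightarrow> set_pmf (common B M) = PiE_dflt {1..<B} 0 (\<lambda>_. {..<M})"
  and set_confidential: "S > 0 \<Longrightarrow> J > 0 \<Longrightarrow> set_pmf (confidential B S J) = PiE_dflt {..<B} (0, 0) (\<lambda>_. {..<S} \<times> {..<J})"
  and set_dummy: "D > 0 \<Longrightarrow> set_pmf (dummy B D) = PiE_dflt {..<B} 0 (\<lambda>_. {..<D})"
  by (simp_all add: common_def confidential_def dummy_def set_Pi_pmf o_def lessThan_empty_iff)

lemma uniform_common: "M > 0 \<Longrightarrow> common B M = pmf_of_set (PiE_dflt {1..<B} 0 (\<lambda>_. {..<M}))"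
  and uniform_confidential: "S > 0 \<Longrightarrow> J > 0 \<Longrightarrow> confidential B S J = pmf_of_set (PiE_dflt {..<B} (0, 0) (\<lambda>_. {..<S} \<times> {..<J}))"
  unfolding common_def confidential_def by (intro Pi_pmf_of_set; auto simp: lessThan_empty_iff)+

lemma pair_pmf_of_set:
  assumes "finite A" "finite B" "A \<noteq> {}" "B \<noteq> {}"
  shows "pair_pmf (pmf_of_set A) (pmf_of_set B) = pmf_of_set (A \<times> B)"
proof (rule pmf_eqI)
  fix y
  have "pmf (pmf_of_set (A \<times> B)) y = indicator (A \<times> B) y / card (A \<times> B)"
    using assms by (intro pmf_of_set) auto
  then show "pmf (pair_pmf (pmf_of_set A) (pmf_of_set B)) y = pmf (pmf_of_set (A \<times> B)) y"
    using assms by (cases y) (simp add: pmf_pair card_cartesian_product indicator_times)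
qed

text \<open>Codes number their messages, whereas the scheme works with functions on blocks; a
  uniform law passes through any numbering.\<close>

lemma map_pmf_of_set_enum:
  fixes A :: "'m set"
  assumes "finite A" "A \<noteq> {}"
  obtains e :: "'m \<Rightarrow> nat" where "bij_betw e A {..<card A}" "pmf_of_set {..<card A} = map_pmf e (pmf_of_set A)"
proof -
  obtain e where "bij_betw e A {0..<card A}"
    using ex_bij_betw_finite_nat[OF assms(1)] by blast
  then have e: "bij_betw e A {..<card A}" by (simp add: atLeast0LessThan)
  then have "map_pmf e (pmf_of_set A) = pmf_of_set {..<card A}"
    using assms by (intro map_pmf_of_set_bij_betw) auto
  then show ?thesis using that[OF e] by simp
qed

section \<open>Message law and block scheme\<close>

locale messages =
  fixes B M0 M1 S J D :: nat
  assumes sizes: "B > 0" "M0 > 0" "M1 > 0" "S > 0" "J > 0" "D > 0"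
begin

abbreviation "UT \<equiv> pair_pmf (common B M0) (common B M1)"
abbreviation "UK \<equiv> confidential B S J"
abbreviation "UD \<equiv> dummy B D"
abbreviation "\<mu> \<equiv> msgs B M0 M1 S J D"
abbreviation "Ws \<equiv> {..<M0} \<times> {..<M1}"
abbreviation "Ks \<equiv> {..<S} \<times> {..<J} \<times> {..<D}"

lemma fin_Us [simp]:
  "finite (set_pmf (common B M0))" "finite (set_pmf (common B M1))" "finite (set_pmf UT)" "finite (set_pmf UK)"
  "finite (set_pmf UD)" "finite (set_pmf \<mu>)"
proof -
  show *: "finite (set_pmf (common B M0))" "finite (set_pmf (common B M1))" "finite (set_pmf UK)" "finite (set_pmf UD)"
    using sizes by (auto simp: set_common set_confidential set_dummy)
  then show "finite (set_pmf UT)" by simp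
  with * show "finite (set_pmf \<mu>)" by (auto simp: msgs_def)
qed

lemma expect_msgs: "expect \<mu> F = expect UT (\<lambda>t. expect UK (\<lambda>\<kappa>. expect UD (\<lambda>d. F (t, \<kappa>, d))))"
  by (simp add: msgs_def expect_bind)

lemma cloud_in: "t \<in> set_pmf UT \<Longrightarrow> cloud t b \<in> Ws"
  using sizes by (auto simp: set_common PiE_dflt_def cloud_def split: if_splits)
     (metis less_numeral_extra(3) neq0_conv)+

lemma cloud_end: "t \<in> set_pmf UT \<Longrightarrow> b = 0 \<or> b \<ge> B \<Longrightarrow> cloud t b = (0, 0)"
  using sizes by (auto simp: set_common PiE_dflt_def cloud_def)

lemma idx_in:
  assumes "m \<in> set_pmf \<mu>" "b < B"
  shows "idx m b \<in> Ws \<times> Ws \<times> Ks"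
proof -
  obtain t \<kappa> d where m: "m = (t, \<kappa>, d)" by (cases m)
  have t: "t \<in> set_pmf UT" and \<kappa>: "\<kappa> \<in> set_pmf UK" and d: "d \<in> set_pmf UD"
    using assms m by (auto simp: msgs_def)
  have "\<kappa> b \<in> {..<S} \<times> {..<J}" using \<kappa> assms sizes by (auto simp: set_confidential PiE_dflt_def)
  moreover have "d b \<in> {..<D}" using d assms sizes by (auto simp: set_dummy PiE_dflt_def)
  ultimately show ?thesis using cloud_in[OF t] by (cases "\<kappa> b") (simp add: idx_def m)
qed

lemma set_block_index: "set_pmf (block_index B M0 M1 S J D) \<subseteq> Ws \<times> Ws \<times> Ks"
proof
  fix i assume "i \<in> set_pmf (block_index B M0 M1 S J D)"
  then obtain b m where "b < B" "m \<in> set_pmf \<mu>" "i = idx m b"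
    using sizes by (auto simp: block_index_def lessThan_empty_iff)
  then show "i \<in> Ws \<times> Ws \<times> Ks" using idx_in by blast
qed

lemma expect_block_index: "real B * expect (block_index B M0 M1 S J D) F = (\<Sum>b<B. expect \<mu> (\<lambda>m. F (idx m b)))"
  using sizes by (simp add: block_index_def expect_bind lessThan_empty_iff integral_pmf_of_set)

end

text \<open>The \<open>r\<close> padding letters \<open>c0\<close> make every total length
  available, not only multiples of \<open>B\<close>. The assumption \<open>supp\<close> keeps the
  reference law positive on all possible outputs, so that its log-likelihood ratios are
  meaningful.\<close>

locale block_scheme = messages B M0 M1 S J D
  for B M0 M1 S J D :: nat +
  fixes W :: "'x::finite \<Rightarrow> 'x1::finite \<Rightarrow> ('y::finite \<times> 'y1::finite \<times> 'z::finite) pmf"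
    and KX :: "'c::finite \<Rightarrow> 'x pmf" and x1of :: "'c \<Rightarrow> 'x1" and Lb :: "'b \<Rightarrow> 'z pmf"
    and n r :: nat
    and ca :: "nat \<times> nat \<Rightarrow> 'x1 list" and cb :: "nat \<times> nat \<Rightarrow> nat \<times> nat \<Rightarrow> 'b list"
    and cc :: "nat \<times> nat \<Rightarrow> nat \<times> nat \<Rightarrow> nat \<times> nat \<times> nat \<Rightarrow> 'c list"
    and dr :: "nat \<times> nat \<Rightarrow> 'y1 list \<Rightarrow> nat \<times> nat" and dy :: "nat \<times> nat \<Rightarrow> 'y list \<Rightarrow> nat \<times> nat"
    and dz :: "nat \<times> nat \<Rightarrow> 'z list \<Rightarrow> nat \<times> nat"
    and dk :: "nat \<times> nat \<Rightarrow> nat \<times> nat \<Rightarrow> 'y list \<Rightarrow> nat \<times> nat \<times> nat"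
    and c0 :: 'c
  assumes n_pos: "n > 0"
    and len: "\<And>v w k. v \<in> {..<M0} \<times> {..<M1} \<Longrightarrow> w \<in> {..<M0} \<times> {..<M1} \<Longrightarrow> k \<in> {..<S} \<times> {..<J} \<times> {..<D}
       \<Longrightarrow> length (cc v w k) = n \<and> map x1of (cc v w k) = ca v \<and> length (cb v w) = n"
    and supp: "\<And>v w k z. v \<in> {..<M0} \<times> {..<M1} \<Longrightarrow> w \<in> {..<M0} \<times> {..<M1} \<Longrightarrow> k \<in> {..<S} \<times> {..<J} \<times> {..<D}
       \<Longrightarrow> z \<in> set_pmf (chanl (\<lambda>c. map_pmf (\<lambda>o'. snd (snd o')) (bind_pmf (KX c) (\<lambda>x. W x (x1of c)))) (cc v w k))
       \<Longrightarrow> pmf (chanl Lb (cb v w)) z > 0"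
begin

lemmas pos = n_pos sizes

definition Ch :: "'c \<Rightarrow> ('y \<times> 'y1 \<times> 'z) pmf" where "Ch c = bind_pmf (KX c) (\<lambda>x. W x (x1of c))"
definition Lz :: "'c \<Rightarrow> 'z pmf" where "Lz c = map_pmf (\<lambda>o'. snd (snd o')) (Ch c)"

definition cw :: "msg \<Rightarrow> nat \<Rightarrow> 'c list" where
  "cw m b = (case idx m b of (v, w, k) \<Rightarrow> cc v w k)"
definition full :: "msg \<Rightarrow> 'c list" where
  "full m = concat (map (cw m) [0..<B]) @ replicate r c0"

definition ok :: "(nat \<times> nat) \<times> (nat \<times> nat) \<times> nat \<times> nat \<times> nat \<Rightarrow> ('y \<times> 'y1 \<times> 'z) list \<Rightarrow> bool" where
  "ok i os = (case i of (v, w, k) \<Rightarrow> dr v (map (\<lambda>o'. fst (snd o')) os) = w \<and> dy w (map fst os) = v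
     \<and> dz w (map (\<lambda>o'. snd (snd o')) os) = v \<and> dk v w (map fst os) = k)"

text \<open>The relay only looks at completed blocks, the receivers decode backwards from the known
  last index.\<close>

primrec relay_est :: "'y1 list \<Rightarrow> nat \<Rightarrow> nat \<times> nat" where
  "relay_est past 0 = (0, 0)"
| "relay_est past (Suc b) = dr (relay_est past b) (block n b past)"

definition relay_fun :: "'y1 list \<Rightarrow> 'x1 pmf" where
  "relay_fun past = (let b = length past div n in
     return_pmf (if b < B then ca (relay_est past b) ! (length past mod n) else x1of c0))"

primrec backward :: "(nat \<times> nat \<Rightarrow> 'l list \<Rightarrow> nat \<times> nat) \<Rightarrow> 'l list \<Rightarrow> nat \<Rightarrow> nat \<times> nat" where
  "backward dd ys 0 = (0, 0)"
| "backward dd ys (Suc k) = dd (backward dd ys k) (block n (B - Suc k) ys)"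

text \<open>Beyond \<open>B\<close> it takes the default value of the cloud indices, so that correct
  decoding is an equality of functions.\<close>

definition est :: "(nat \<times> nat \<Rightarrow> 'l list \<Rightarrow> nat \<times> nat) \<Rightarrow> 'l list \<Rightarrow> nat \<Rightarrow> nat \<times> nat" where
  "est dd ys b = (if b \<le> B then backward dd ys (B - b) else (0, 0))"

text \<open>In the ideal system the relay sends the word of the true previous index, which makes the
  outputs a memoryless function of the satellite letters. The two systems assign the same
  probability to every outcome in \<open>Good\<close>.\<close>

definition real_out :: "msg \<Rightarrow> ('y \<times> 'y1 \<times> 'z) list pmf" where
  "real_out m = bind_pmf (chanl KX (full m)) (\<lambda>xs. run_full W relay_fun xs [])"

definition "real_sys = joint (\<lambda>_::unit. \<mu>) real_out ()"
definition "ideal_sys = joint (\<lambda>_::unit. \<mu>) (\<lambda>m. chanl Ch (full m)) ()"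

definition Good :: "(msg \<times> ('y \<times> 'y1 \<times> 'z) list) set" where
  "Good = {(m, os). m \<in> set_pmf \<mu> \<and> length os = n * B + r \<and> (\<forall>b<B. ok (idx m b) (block n b os))}"

lemma fin_sys [simp]: "finite (set_pmf real_sys)" "finite (set_pmf ideal_sys)" "finite (set_pmf (real_out m))"
proof -
  show *: "finite (set_pmf (real_out m))" for m by (simp add: real_out_def)
  show "finite (set_pmf real_sys)" "finite (set_pmf ideal_sys)"
    by (auto simp: real_sys_def ideal_sys_def joint_def *)
qed

lemma cw_len:
  assumes "m \<in> set_pmf \<mu>" "b < B"
  shows "length (cw m b) = n" "map x1of (cw m b) = ca (cloud (fst m) b)"
  using idx_in[OF assms] len by (auto simp: cw_def idx_def)

lemma length_full: "m \<in> set_pmf \<mu> \<Longrightarrow> length (full m) = n * B + r"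
  using length_concat_blocks[of B "cw m" n] by (simp add: full_def cw_len)

lemma block_full: "m \<in> set_pmf \<mu> \<Longrightarrow> b < B \<Longrightarrow> block n b (full m) = cw m b"
  unfolding full_def by (intro block_concat cw_len) auto

lemma backward_correct:
  assumes "t \<in> set_pmf UT" "\<And>b. b < B \<Longrightarrow> dd (cloud t (Suc b)) (block n b ys) = cloud t b" "k \<le> B"
  shows "backward dd ys k = cloud t (B - k)"
  using assms(3)
proof (induction k)
  case 0
  then show ?case using cloud_end[OF assms(1), of B] by simp
next
  case (Suc k)
  then have "backward dd ys (Suc k) = dd (cloud t (Suc (B - Suc k))) (block n (B - Suc k) ys)"
    by (simp add: Suc_diff_Suc)
  then show ?case using assms(2)[of "B - Suc k"] Suc.prems by simp
qed

lemma est_correct: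
  assumes "t \<in> set_pmf UT" "\<And>b. b < B \<Longrightarrow> dd (cloud t (Suc b)) (block n b ys) = cloud t b"
  shows "est dd ys = cloud t"
proof
  show "est dd ys b = cloud t b" for b
    using backward_correct[of t dd ys "B - b"] assms cloud_end[OF assms(1), of b] by (auto simp: est_def)
qed

lemma Good_ok:
  assumes "(m, os) \<in> Good" "b < B"
  shows "dr (cloud (fst m) b) (block n b (map (\<lambda>o'. fst (snd o')) os)) = cloud (fst m) (Suc b)"
    "dy (cloud (fst m) (Suc b)) (block n b (map fst os)) = cloud (fst m) b"
    "dz (cloud (fst m) (Suc b)) (block n b (map (\<lambda>o'. snd (snd o')) os)) = cloud (fst m) b"
    "dk (cloud (fst m) b) (cloud (fst m) (Suc b)) (block n b (map fst os))
       = (fst (fst (snd m) b), snd (fst (snd m) b), snd (snd m) b)"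
  using assms by (auto simp: Good_def ok_def idx_def block_map)

lemma Good_in:
  assumes "(m, os) \<in> Good"
  shows "m \<in> set_pmf \<mu>" "fst m \<in> set_pmf UT" "length os = n * B + r"
  using assms by (auto simp: Good_def msgs_def)

text \<open>The relay starts from the known index \<open>(0, 0)\<close>, and on a good outcome each
  completed block yields the next correct index. Since a satellite word carries its relay word, the
  relay then sends the letter that the codeword prescribes.\<close>

lemma relay_correct:
  assumes G: "(m, os) \<in> Good" and i: "i < length (full m)"
  shows "relay_fun (map (\<lambda>o'. fst (snd o')) (take i os)) = return_pmf (x1of (full m ! i))"
proof -
  note m = Good_in[OF G]
  let ?y = "map (\<lambda>o'. fst (snd o')) os"
  have past: "map (\<lambda>o'. fst (snd o')) (take i os) = take i ?y" by (simp add: take_map)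
  have li: "length (take i ?y) = i" using i m length_full by simp
  show ?thesis
  proof (cases "i div n < B")
    case True
    have "relay_est (take i ?y) b = cloud (fst m) b" if "b \<le> i div n" for b
      using that
    proof (induction b)
      case 0
      then show ?case using cloud_end[OF m(2), of 0] by simp
    next
      case (Suc b)
      \<comment> \<open>Block \<open>b\<close> is complete before time \<open>i\<close>, so cutting
        the outcome at \<open>i\<close> leaves it intact.\<close>
      have "(b + 1) * n \<le> i div n * n" using Suc.prems by (intro mult_right_mono) auto
      also have "\<dots> \<le> i" by simp
      finally have "block n b (take i ?y) = block n b ?y" by (rule block_take)
      then show ?case using Suc Good_ok(1)[OF G, of b] True by simp
    qed
    then have "relay_fun (take i ?y) = return_pmf (ca (cloud (fst m) (i div n)) ! (i mod n))"
      using True li by (simp add: relay_fun_def Let_def)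
    also have "ca (cloud (fst m) (i div n)) ! (i mod n) = x1of (cw m (i div n) ! (i mod n))"
      using cw_len[OF m(1) True] pos by (metis mod_less_divisor nth_map)
    also have "cw m (i div n) ! (i mod n) = full m ! i"
      unfolding block_full[OF m(1) True, symmetric] using i pos by (subst block_nth) auto
    finally show ?thesis by (simp only: past)
  next
    case False
    \<comment> \<open>Padding region: here the relay sends the relay letter of \<open>c0\<close>, as
      the padded codeword prescribes.\<close>
    have "n * B \<le> i" using False pos by (simp add: div_less_iff_less_mult not_less mult.commute)
    then have "full m ! i = c0"
      using i length_concat_blocks[of B "cw m" n] cw_len[OF m(1)] length_full[OF m(1)]
      by (simp add: full_def nth_append)
    then show ?thesis using False li by (simp add: past relay_fun_def Let_def)
  qed
qed

lemma agree: "\<omega> \<in> Good \<Longrightarrow> pmf real_sys \<omega> = pmf ideal_sys \<omega>"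
proof (cases \<omega>)
  case (Pair m os)
  assume "\<omega> \<in> Good"
  then have G: "(m, os) \<in> Good" using Pair by simp
  have "pmf (real_out m) os = pmf (chanl Ch (full m)) os"
    unfolding real_out_def Ch_def
    by (rule pmf_run_full_eq) (use relay_correct[OF G] Good_in[OF G] length_full in auto)
  then show ?thesis by (simp add: Pair real_sys_def ideal_sys_def pmf_joint)
qed

definition err :: real where
  "err = expect (block_index B M0 M1 S J D) (\<lambda>(v, w, k). expect (chanl Ch (cc v w k)) (\<lambda>os. of_bool (\<not> ok (v, w, k) os)))"

text \<open>Union bound over blocks. In the ideal system a block is a single use of the block code
  with the true indices, so errors do not propagate.\<close>

lemma ideal_Good: "expect ideal_sys (\<lambda>\<omega>. of_bool (\<omega> \<notin> Good)) \<le> B * err"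
proof -
  have "expect ideal_sys (\<lambda>\<omega>. of_bool (\<omega> \<notin> Good)) \<le> expect ideal_sys (\<lambda>\<omega>. \<Sum>b<B. of_bool (\<not> ok (idx (fst \<omega>) b) (block n b (snd \<omega>))))"
  proof (rule expect_mono[OF fin_sys(2)])
    fix \<omega> assume \<omega>: "\<omega> \<in> set_pmf ideal_sys"
    show "of_bool (\<omega> \<notin> Good) \<le> (\<Sum>b<B. of_bool (\<not> ok (idx (fst \<omega>) b) (block n b (snd \<omega>))) :: real)"
    proof (cases "\<omega> \<in> Good")
      case False
      have "fst \<omega> \<in> set_pmf \<mu>" "length (snd \<omega>) = n * B + r"
        using \<omega> by (auto simp: ideal_sys_def joint_def length_full dest: length_chanl)
      then obtain b where b: "b < B" "\<not> ok (idx (fst \<omega>) b) (block n b (snd \<omega>))"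
        using False by (cases \<omega>) (auto simp: Good_def)
      have "of_bool (\<not> ok (idx (fst \<omega>) b) (block n b (snd \<omega>))) \<le> (\<Sum>b<B. of_bool (\<not> ok (idx (fst \<omega>) b) (block n b (snd \<omega>))) :: real)"
        using b by (intro member_le_sum) auto
      then show ?thesis using b False by simp
    qed (auto simp: sum_nonneg)
  qed
  also have "\<dots> = (\<Sum>b<B. expect \<mu> (\<lambda>m. expect (chanl Ch (full m)) (\<lambda>os. of_bool (\<not> ok (idx m b) (block n b os)))))"
    by (subst expect_sum) (simp_all add: ideal_sys_def expect_joint[where K="\<lambda>_. \<mu>"])
  also have "\<dots> = (\<Sum>b<B. expect \<mu> (\<lambda>m. expect (chanl Ch (cw m b)) (\<lambda>os. of_bool (\<not> ok (idx m b) os))))"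
  proof (intro sum.cong refl expect_cong)
    fix b m assume "b \<in> {..<B}" "m \<in> set_pmf \<mu>"
    then have "map_pmf (block n b) (chanl Ch (full m)) = chanl Ch (cw m b)"
      by (simp add: chanl_block block_full)
    then show "expect (chanl Ch (full m)) (\<lambda>os. of_bool (\<not> ok (idx m b) (block n b os))) =
        expect (chanl Ch (cw m b)) (\<lambda>os. of_bool (\<not> ok (idx m b) os))"
      by (metis (no_types, lifting) integral_map_pmf Bochner_Integration.integral_cong)
  qed
  also have "\<dots> = B * err"
    unfolding err_def expect_block_index by (simp add: cw_def case_prod_unfold)
  finally show ?thesis .
qed

text \<open>Both systems give the good event the same probability; this settles error propagation in
  the real system.\<close>

lemma real_Good: "expect real_sys (\<lambda>\<omega>. of_bool (\<omega> \<in> Good)) \<ge> 1 - B * err" "expect ideal_sys (\<lambda>\<omega>. of_bool (\<omega> \<in> Good)) \<ge> 1 - B * err"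
proof -
  have "expect ideal_sys (\<lambda>\<omega>. of_bool (\<omega> \<in> Good)) = expect ideal_sys (\<lambda>\<omega>. 1 - of_bool (\<omega> \<notin> Good))"
    by (intro expect_cong) auto
  then show 1: "expect ideal_sys (\<lambda>\<omega>. of_bool (\<omega> \<in> Good)) \<ge> 1 - B * err"
    using ideal_Good by simp
  then show "expect real_sys (\<lambda>\<omega>. of_bool (\<omega> \<in> Good)) \<ge> 1 - B * err"
    using expect_agree[OF fin_sys(1,2), of Good "\<lambda>_. 1"] agree by simp
qed

section \<open>Likelihoods at the second receiver\<close>

definition zout :: "('y \<times> 'y1 \<times> 'z) list \<Rightarrow> 'z list" where
  "zout os = map (\<lambda>o'. snd (snd o')) os"

definition qblock :: "clouds \<Rightarrow> nat \<Rightarrow> 'z list \<Rightarrow> real" where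
  "qblock t b z = pmf (chanl Lb (cb (cloud t b) (cloud t (Suc b)))) (block n b z)"
definition mblock :: "clouds \<Rightarrow> nat \<Rightarrow> nat \<Rightarrow> 'z list \<Rightarrow> real" where
  "mblock t b s z = (\<Sum>j\<in>{..<J} \<times> {..<D}. pmf (chanl Lz (cc (cloud t b) (cloud t (Suc b)) (s, j))) (block n b z)) / (J * D)"
definition pad :: "'z list \<Rightarrow> real" where
  "pad z = pmf (chanl Lz (replicate r c0)) (drop (n * B) z)"

definition leakage :: real where
  "leakage = expect (block_index B M0 M1 S J D) (\<lambda>(v, w, k). expect (chanl Lz (cc v w k)) (\<lambda>z. log 2 (1 +
     (\<Sum>j\<in>{..<J} \<times> {..<D}. pmf (chanl Lz (cc v w (fst k, j))) z) / card ({..<J} \<times> {..<D}) / pmf (chanl Lb (cb v w)) z)))"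

lemma block_nonneg: "qblock t b z \<ge> 0" "mblock t b s z \<ge> 0" "pad z \<ge> 0"
  by (simp_all add: qblock_def mblock_def pad_def sum_nonneg)

lemma chanl_Lz: "map_pmf zout (chanl Ch cs) = chanl Lz cs"
  unfolding zout_def by (simp add: chanl_map Lz_def[abs_def])

lemma block_len:
  assumes "t \<in> set_pmf UT"
  shows "length (cb (cloud t b) (cloud t (Suc b))) = n"
    "k \<in> Ks \<Longrightarrow> length (cc (cloud t b) (cloud t (Suc b)) k) = n"
proof -
  have "(0, 0, 0) \<in> Ks" using pos by auto
  then show "length (cb (cloud t b) (cloud t (Suc b))) = n"
    "k \<in> Ks \<Longrightarrow> length (cc (cloud t b) (cloud t (Suc b)) k) = n"
    using len[OF cloud_in[OF assms] cloud_in[OF assms]] by blast+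
qed

text \<open>The reference law has letters with different input alphabets (clouds, then padding), so it is
  written as a product of a list of distributions.\<close>

definition reference :: "('z list \<times> clouds) pmf" where
  "reference = map_pmf (\<lambda>(t, z). (z, t)) (joint (\<lambda>_::unit. UT) (\<lambda>t. chanl (\<lambda>p. p)
     (concat (map (\<lambda>b. map Lb (cb (cloud t b) (cloud t (Suc b)))) [0..<B]) @ map Lz (replicate r c0))) ())"

lemma pmf_reference:
  assumes "t \<in> set_pmf UT" "length z = n * B + r"
  shows "pmf reference (z, t) = pmf UT t * ((\<Prod>b<B. qblock t b z) * pad z)"
proof -
  let ?L = "\<lambda>t. chanl (\<lambda>p. p) (concat (map (\<lambda>b. map Lb (cb (cloud t b) (cloud t (Suc b)))) [0..<B]) @ map Lz (replicate r c0))"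
  have inj: "inj (\<lambda>(t, z). (z, t) :: 'z list \<times> clouds)" by (auto simp: inj_def)
  have "pmf reference (z, t) = pmf (joint (\<lambda>_::unit. UT) ?L ()) (t, z)"
    using pmf_map_inj'[OF inj, of _ "(t, z)"] by (simp add: reference_def)
  also have "\<dots> = pmf UT t * pmf (?L t) z"
    by (rule pmf_joint)
  also have "pmf (?L t) z = (\<Prod>b<B. qblock t b z) * pad z"
    using assms block_len(1)[OF assms(1)]
    by (subst pmf_chanl_blocks[where n=n]) (simp_all add: qblock_def pad_def chanl_map_input del: map_replicate)
  finally show ?thesis .
qed

text \<open>The summand \<open>qblock\<close> is not needed for a majorant; it turns each factor of the ratio to the
  reference law into the \<open>1 + ratio\<close> of the leakage.\<close>

definition majorant :: "(nat \<Rightarrow> nat) \<Rightarrow> 'z list \<Rightarrow> clouds \<Rightarrow> real" where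
  "majorant s z t = (if t \<in> set_pmf UT \<and> length z = n * B + r
     then pmf UT t * ((1 / S) ^ B * (\<Prod>b<B. mblock t b (s b) z + qblock t b z) * pad z) else 0)"

text \<open>An inequality because \<open>s\<close> is any number: for \<open>s \<ge> S\<close> the
  left side vanishes, otherwise the secret value has probability \<open>1 / S\<close> and averaging
  over the mask gives the mixture.\<close>

lemma expect_uniform_mblock:
  "expect (pmf_of_set ({..<S} \<times> {..<J})) (\<lambda>k. expect (pmf_of_set {..<D}) (\<lambda>d. of_bool (fst k = s) *
     pmf (chanl Lz (cc (cloud t b) (cloud t (Suc b)) (fst k, snd k, d))) (block n b z))) \<le> 1 / S * mblock t b s z"
proof -
  define g where "g = (\<lambda>j d. pmf (chanl Lz (cc (cloud t b) (cloud t (Suc b)) (s, j, d))) (block n b z))"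
  define u :: "nat \<Rightarrow> real" where "u = (\<lambda>\<sigma>. of_bool (\<sigma> = s))"
  have "expect (pmf_of_set ({..<S} \<times> {..<J})) (\<lambda>k. expect (pmf_of_set {..<D}) (\<lambda>d. of_bool (fst k = s) *
     pmf (chanl Lz (cc (cloud t b) (cloud t (Suc b)) (fst k, snd k, d))) (block n b z)))
    = expect (pmf_of_set ({..<S} \<times> {..<J})) (\<lambda>k. expect (pmf_of_set {..<D}) (\<lambda>d. u (fst k) * g (snd k) d))"
    by (intro Bochner_Integration.integral_cong refl) (auto simp: g_def u_def)
  also have "\<dots> = (\<Sum>k\<in>{..<S} \<times> {..<J}. u (fst k) * ((\<Sum>d<D. g (snd k) d) / D)) / (S * J)"
    using pos by (simp add: integral_pmf_of_set lessThan_empty_iff card_cartesian_product ac_simps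
        flip: sum_divide_distrib)
  also have "\<dots> = (\<Sum>\<sigma><S. \<Sum>j<J. u \<sigma> * ((\<Sum>d<D. g j d) / D)) / (S * J)"
    by (simp add: sum.cartesian_product case_prod_unfold)
  also have "\<dots> = (\<Sum>\<sigma><S. u \<sigma>) * ((\<Sum>j<J. (\<Sum>d<D. g j d) / D) / (S * J))"
    by (simp only: sum_product times_divide_eq_right)
  also have "\<dots> \<le> 1 * ((\<Sum>j<J. (\<Sum>d<D. g j d) / D) / (S * J))"
  proof (rule mult_right_mono)
    show "(\<Sum>\<sigma><S. u \<sigma>) \<le> 1" unfolding u_def of_bool_def by simp
  qed (auto simp: g_def intro!: divide_nonneg_nonneg sum_nonneg)
  also have "\<dots> = 1 / S * mblock t b s z"
    by (simp add: mblock_def g_def sum.cartesian_product case_prod_unfold sum_divide_distrib ac_simps)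
  finally show ?thesis .
qed

text \<open>Given the cloud indices, the likelihood is a product over blocks and the satellite
  indices of different blocks are independent, so the mean of the product is the product of the
  means.\<close>

lemma secret_likelihood:
  assumes t: "t \<in> set_pmf UT" and z: "length z = n * B + r"
  shows "expect UK (\<lambda>\<kappa>. expect UD (\<lambda>d. of_bool ((\<lambda>b. fst (\<kappa> b)) = s) * pmf (chanl Lz (full (t, \<kappa>, d))) z))
     \<le> (1 / S) ^ B * (\<Prod>b<B. mblock t b (s b) z + qblock t b z) * pad z"
proof -
  define g where "g = (\<lambda>b k d. of_bool (fst k = s b) * pmf (chanl Lz (cc (cloud t b) (cloud t (Suc b)) (fst k, snd k, d))) (block n b z))"
  have g: "g b k d \<ge> 0" for b k d by (simp add: g_def)
  have "expect UK (\<lambda>\<kappa>. expect UD (\<lambda>d. of_bool ((\<lambda>b. fst (\<kappa> b)) = s) * pmf (chanl Lz (full (t, \<kappa>, d))) z))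
    \<le> expect UK (\<lambda>\<kappa>. expect UD (\<lambda>d. (\<Prod>b<B. g b (\<kappa> b) (d b)) * pad z))"
  proof (intro expect_mono fin_Us)
    fix \<kappa> d assume \<kappa>: "\<kappa> \<in> set_pmf UK" and d: "d \<in> set_pmf UD"
    have m: "(t, \<kappa>, d) \<in> set_pmf \<mu>" using t \<kappa> d by (auto simp: msgs_def)
    show "of_bool ((\<lambda>b. fst (\<kappa> b)) = s) * pmf (chanl Lz (full (t, \<kappa>, d))) z \<le> (\<Prod>b<B. g b (\<kappa> b) (d b)) * pad z"
    proof (cases "(\<lambda>b. fst (\<kappa> b)) = s")
      case True
      have "pmf (chanl Lz (full (t, \<kappa>, d))) z = (\<Prod>b<B. pmf (chanl Lz (cw (t, \<kappa>, d) b)) (block n b z)) * pad z"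
        unfolding full_def pad_def using z cw_len[OF m] by (intro pmf_chanl_blocks) auto
      also have "(\<Prod>b<B. pmf (chanl Lz (cw (t, \<kappa>, d) b)) (block n b z)) = (\<Prod>b<B. g b (\<kappa> b) (d b))"
        using True by (intro prod.cong) (auto simp: g_def cw_def idx_def)
      finally show ?thesis using True by simp
    qed (auto intro!: mult_nonneg_nonneg prod_nonneg g block_nonneg)
  qed
  also have "\<dots> = expect UK (\<lambda>\<kappa>. expect UD (\<lambda>d. \<Prod>b<B. g b (\<kappa> b) (d b))) * pad z"
    by simp
  also have "expect UK (\<lambda>\<kappa>. expect UD (\<lambda>d. \<Prod>b<B. g b (\<kappa> b) (d b)))
     = expect UK (\<lambda>\<kappa>. \<Prod>b<B. expect (pmf_of_set {..<D}) (g b (\<kappa> b)))"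
    unfolding dummy_def using pos g
    by (subst expectation_prod_Pi_pmf) (auto simp: lessThan_empty_iff)
  also have "\<dots> = (\<Prod>b<B. expect (pmf_of_set ({..<S} \<times> {..<J})) (\<lambda>k. expect (pmf_of_set {..<D}) (g b k)))"
    unfolding confidential_def using pos g
    by (subst expectation_prod_Pi_pmf) (auto simp: lessThan_empty_iff intro!: expect_ge_const)
  also have "\<dots> \<le> (\<Prod>b<B. 1 / S * (mblock t b (s b) z + qblock t b z))"
  proof (intro prod_mono conjI)
    fix b
    show "0 \<le> expect (pmf_of_set ({..<S} \<times> {..<J})) (\<lambda>k. expect (pmf_of_set {..<D}) (g b k))"
      using g pos by (auto simp: lessThan_empty_iff intro!: expect_ge_const)
    have "expect (pmf_of_set ({..<S} \<times> {..<J})) (\<lambda>k. expect (pmf_of_set {..<D}) (g b k)) \<le> 1 / S * mblock t b (s b) z"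
      unfolding g_def by (rule expect_uniform_mblock)
    also have "\<dots> \<le> 1 / S * (mblock t b (s b) z + qblock t b z)"
      by (intro mult_left_mono) (auto simp: block_nonneg)
    finally show "expect (pmf_of_set ({..<S} \<times> {..<J})) (\<lambda>k. expect (pmf_of_set {..<D}) (g b k))
       \<le> 1 / S * (mblock t b (s b) z + qblock t b z)" .
  qed
  also have "\<dots> = (1 / S) ^ B * (\<Prod>b<B. mblock t b (s b) z + qblock t b z)"
    by (simp add: prod.distrib prod_dividef power_one_over)
  finally show ?thesis by (simp add: mult_right_mono block_nonneg)
qed

definition secret :: "msg \<times> ('y \<times> 'y1 \<times> 'z) list \<Rightarrow> nat \<Rightarrow> nat" where
  "secret \<omega> = (\<lambda>b. fst (fst (snd (fst \<omega>)) b))"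

lemma majorant:
  "measure_pmf.prob real_sys {\<omega>\<in>Good. (secret \<omega>, zout (snd \<omega>), fst (fst \<omega>)) = (s, z, t)} \<le> majorant s z t"
proof (cases "t \<in> set_pmf UT \<and> length z = n * B + r")
  case True
  let ?A = "{\<omega>\<in>Good. (secret \<omega>, zout (snd \<omega>), fst (fst \<omega>)) = (s, z, t)}"
  have "measure_pmf.prob real_sys ?A = expect real_sys (\<lambda>\<omega>. of_bool (\<omega> \<in> ?A) * 1)"
    by (subst prob_expect) simp
  also have "\<dots> = expect ideal_sys (\<lambda>\<omega>. of_bool (\<omega> \<in> ?A) * 1)"
    by (rule expect_agree) (auto simp: agree)
  \<comment> \<open>The good event is dropped only now: in the ideal system the likelihood factors
    over all outcomes.\<close>
  also have "\<dots> \<le> expect ideal_sys (\<lambda>\<omega>. of_bool (fst (fst \<omega>) = t) * (of_bool (secret \<omega> = s) * of_bool (zout (snd \<omega>) = z)))"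
    by (intro expect_mono) auto
  also have "\<dots> = expect UT (\<lambda>t'. expect UK (\<lambda>\<kappa>. expect UD (\<lambda>d. expect (chanl Ch (full (t', \<kappa>, d)))
      (\<lambda>os. of_bool (t' = t) * (of_bool ((\<lambda>b. fst (\<kappa> b)) = s) * of_bool (zout os = z))))))"
    by (simp add: ideal_sys_def expect_joint[where K="\<lambda>_. \<mu>"] expect_msgs secret_def)
  also have "\<dots> = expect UT (\<lambda>t'. of_bool (t' = t) * expect UK (\<lambda>\<kappa>. expect UD (\<lambda>d. of_bool ((\<lambda>b. fst (\<kappa> b)) = s) *
      pmf (chanl Lz (full (t', \<kappa>, d))) z)))"
  proof -
    have "expect (chanl Ch cs) (\<lambda>os. of_bool (zout os = z)) = pmf (chanl Lz cs) z" for cs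
      using prob_expect[of "chanl Ch cs" "zout -` {z}"] by (simp add: pmf_map flip: chanl_Lz)
    then show ?thesis by simp
  qed
  also have "\<dots> = pmf UT t * expect UK (\<lambda>\<kappa>. expect UD (\<lambda>d. of_bool ((\<lambda>b. fst (\<kappa> b)) = s) * pmf (chanl Lz (full (t, \<kappa>, d))) z))"
    by (rule expect_of_bool_eq) simp
  also have "\<dots> \<le> majorant s z t"
    unfolding majorant_def if_P[OF True] by (intro mult_left_mono secret_likelihood) (use True in auto)
  finally show ?thesis .
next
  case False
  then have empty: "{\<omega>\<in>Good. (secret \<omega>, zout (snd \<omega>), fst (fst \<omega>)) = (s, z, t)} = {}"
    using Good_in by (fastforce simp: zout_def)
  show ?thesis unfolding empty majorant_def if_not_P[OF False] by simp
qed

lemma ideal_blocks_pos: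
  assumes "\<omega> \<in> set_pmf ideal_sys"
  shows "fst (fst \<omega>) \<in> set_pmf UT" "length (zout (snd \<omega>)) = n * B + r" "pad (zout (snd \<omega>)) > 0"
    "b < B \<Longrightarrow> qblock (fst (fst \<omega>)) b (zout (snd \<omega>)) > 0"
proof -
  obtain m os where \<omega>: "\<omega> = (m, os)" by (cases \<omega>)
  have m: "m \<in> set_pmf \<mu>" and os: "os \<in> set_pmf (chanl Ch (full m))"
    using assms \<omega> by (auto simp: ideal_sys_def joint_def)
  have z: "zout os \<in> set_pmf (chanl Lz (full m))" using os by (auto simp flip: chanl_Lz)
  show "fst (fst \<omega>) \<in> set_pmf UT" using m \<omega> by (auto simp: msgs_def)
  show l: "length (zout (snd \<omega>)) = n * B + r" using length_chanl[OF z] length_full[OF m] \<omega> by simp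
  have "drop (n * B) (zout os) \<in> set_pmf (map_pmf (drop (n * B)) (chanl Lz (full m)))" using z by simp
  also have "map_pmf (drop (n * B)) (chanl Lz (full m)) = chanl Lz (replicate r c0)"
    using length_concat_blocks[of B "cw m" n] cw_len[OF m] by (simp add: chanl_drop full_def)
  finally show "pad (zout (snd \<omega>)) > 0" by (simp add: pad_def \<omega> pmf_positive)
  show "qblock (fst (fst \<omega>)) b (zout (snd \<omega>)) > 0" if b: "b < B"
  proof -
    have "block n b (zout os) \<in> set_pmf (map_pmf (block n b) (chanl Lz (full m)))" using z by simp
    also have "map_pmf (block n b) (chanl Lz (full m)) = chanl Lz (cw m b)"
      using block_full[OF m b] by (simp add: chanl_block)
    finally have "block n b (zout os) \<in> set_pmf (chanl Lz (cw m b))" .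
    then show ?thesis
      using supp idx_in[OF m b] by (auto simp: qblock_def \<omega> cw_def idx_def Lz_def[abs_def] Ch_def)
  qed
qed

text \<open>The law of the clouds and the padding cancel in the ratio. The factor
  \<open>(1 / S) ^ B\<close> yields the entropy of a uniform secret, the remaining factors yield the
  leakage.\<close>

lemma log_reference_majorant:
  assumes "\<omega> \<in> set_pmf ideal_sys"
  defines "t \<equiv> fst (fst \<omega>)" and "z \<equiv> zout (snd \<omega>)"
  shows "majorant (secret \<omega>) z t > 0" "pmf reference (z, t) > 0"
    "log 2 (pmf reference (z, t) / majorant (secret \<omega>) z t)
      = B * log 2 S - (\<Sum>b<B. log 2 (1 + mblock t b (secret \<omega> b) z / qblock t b z))"
proof -
  note p = ideal_blocks_pos[OF assms(1), folded t_def z_def]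
  let ?q = "\<lambda>b. qblock t b z" and ?mq = "\<lambda>b. mblock t b (secret \<omega> b) z + qblock t b z"
  have T: "pmf UT t > 0" using p(1) by (rule pmf_positive)
  have q: "(\<Prod>b<B. ?q b) > 0" using p(4) by (intro prod_pos) auto
  have mq: "(\<Prod>b<B. ?mq b) > 0" using p(4) by (intro prod_pos) (auto intro: add_nonneg_pos block_nonneg)
  have maj: "majorant (secret \<omega>) z t = pmf UT t * ((1 / S) ^ B * (\<Prod>b<B. ?mq b) * pad z)"
    using p by (simp add: majorant_def)
  have ref: "pmf reference (z, t) = pmf UT t * ((\<Prod>b<B. ?q b) * pad z)"
    using p by (simp add: pmf_reference)
  show "majorant (secret \<omega>) z t > 0" using T mq p pos by (simp add: maj)
  show "pmf reference (z, t) > 0" using T q p by (simp add: ref)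
  have ratio: "(\<Prod>b<B. ?mq b) / (\<Prod>b<B. ?q b) = (\<Prod>b<B. 1 + mblock t b (secret \<omega> b) z / ?q b)"
    unfolding prod_dividef[symmetric] using p(4)
    by (intro prod.cong) (auto simp: add_divide_distrib less_imp_neq[THEN not_sym])
  have "pmf reference (z, t) / majorant (secret \<omega>) z t = real S ^ B / ((\<Prod>b<B. ?mq b) / (\<Prod>b<B. ?q b))"
    using T q mq p pos by (simp add: maj ref power_one_over)
  also have "\<dots> = real S ^ B / (\<Prod>b<B. 1 + mblock t b (secret \<omega> b) z / ?q b)"
    by (simp only: ratio)
  also have "log 2 \<dots> = log 2 (real S ^ B) - log 2 (\<Prod>b<B. 1 + mblock t b (secret \<omega> b) z / ?q b)"
    using pos by (intro log_divide_pos) (auto intro!: prod_pos add_pos_nonneg divide_nonneg_nonneg block_nonneg)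
  also have "log 2 (\<Prod>b<B. 1 + mblock t b (secret \<omega> b) z / ?q b) = (\<Sum>b<B. log 2 (1 + mblock t b (secret \<omega> b) z / ?q b))"
    by (intro log2_prod) (auto intro!: add_pos_nonneg divide_nonneg_nonneg block_nonneg)
  finally show "log 2 (pmf reference (z, t) / majorant (secret \<omega>) z t)
      = B * log 2 S - (\<Sum>b<B. log 2 (1 + mblock t b (secret \<omega> b) z / qblock t b z))"
    using pos by (simp add: log_nat_power)
qed

definition cost :: "msg \<times> ('y \<times> 'y1 \<times> 'z) list \<Rightarrow> real" where
  "cost \<omega> = (\<Sum>b<B. log 2 (1 + mblock (fst (fst \<omega>)) b (secret \<omega> b) (zout (snd \<omega>)) / qblock (fst (fst \<omega>)) b (zout (snd \<omega>))))"

lemma expect_leakage: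
  "expect ideal_sys cost
   = B * leakage"
proof -
  define F where "F = (\<lambda>i :: (nat \<times> nat) \<times> (nat \<times> nat) \<times> nat \<times> nat \<times> nat. case i of (v, w, k) \<Rightarrow> \<lambda>z. log 2 (1 +
     (\<Sum>j\<in>{..<J} \<times> {..<D}. pmf (chanl Lz (cc v w (fst k, j))) z) / card ({..<J} \<times> {..<D}) / pmf (chanl Lb (cb v w)) z))"
  have "expect ideal_sys cost
    = expect ideal_sys (\<lambda>\<omega>. \<Sum>b<B. F (idx (fst \<omega>) b) (block n b (zout (snd \<omega>))))"
    by (simp add: cost_def[abs_def] F_def idx_def mblock_def qblock_def secret_def card_cartesian_product)
  also have "\<dots> = (\<Sum>b<B. expect \<mu> (\<lambda>m. expect (chanl Ch (full m)) (\<lambda>os. F (idx m b) (block n b (zout os)))))"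
    by (subst expect_sum) (simp_all add: ideal_sys_def expect_joint[where K="\<lambda>_. \<mu>"])
  also have "\<dots> = (\<Sum>b<B. expect \<mu> (\<lambda>m. expect (chanl Lz (cw m b)) (F (idx m b))))"
  proof (intro sum.cong refl expect_cong)
    fix b m assume "b \<in> {..<B}" "m \<in> set_pmf \<mu>"
    then have "chanl Lz (cw m b) = map_pmf (block n b) (map_pmf zout (chanl Ch (full m)))"
      by (simp add: chanl_block block_full chanl_Lz)
    then show "expect (chanl Ch (full m)) (\<lambda>os. F (idx m b) (block n b (zout os))) = expect (chanl Lz (cw m b)) (F (idx m b))"
      by simp
  qed
  also have "\<dots> = B * leakage"
    unfolding leakage_def expect_block_index by (simp add: F_def cw_def case_prod_unfold)
  finally show ?thesis .
qed

text \<open>Only the first satellite component counts as secret. The cloud indices, including the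
  confidential message they carry, take the role of the revealed variable \<open>T\<close>.\<close>

lemma equivocation_real_sys:
  assumes "\<And>\<omega> \<omega>'. \<omega> \<in> set_pmf real_sys \<Longrightarrow> \<omega>' \<in> set_pmf real_sys \<Longrightarrow> A \<omega> = A \<omega>' \<Longrightarrow> secret \<omega> = secret \<omega>'"
  shows "cEnt real_sys A (\<lambda>\<omega>. zout (snd \<omega>)) \<ge> (1 - B * err) * (B * log 2 S) - B * leakage - 1 / ln 2"
proof -
  let ?l = "\<lambda>\<omega>. log 2 (pmf reference (zout (snd \<omega>), fst (fst \<omega>)) / majorant (secret \<omega>) (zout (snd \<omega>)) (fst (fst \<omega>)))"
  have cost: "cost \<omega> \<ge> 0" for \<omega>
    unfolding cost_def by (intro sum_nonneg log2_one_plus_nonneg divide_nonneg_nonneg block_nonneg)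
  have "(1 - B * err) * (B * log 2 S) - B * leakage \<le> expect ideal_sys (\<lambda>\<omega>. of_bool (\<omega> \<in> Good)) * (B * log 2 S) - B * leakage"
    using pos real_Good(2) by (auto intro!: mult_right_mono mult_nonneg_nonneg)
  also have "\<dots> = expect ideal_sys (\<lambda>\<omega>. of_bool (\<omega> \<in> Good) * (B * log 2 S) - cost \<omega>)"
    using expect_leakage by simp
  \<comment> \<open>On the good event both sides agree. Off it the left side is
    \<open>- cost \<omega>\<close>, at most 0; here nonnegativity of each logarithm of
    \<open>1 + ratio\<close> pays off.\<close>
  also have "\<dots> \<le> expect ideal_sys (\<lambda>\<omega>. of_bool (\<omega> \<in> Good) * ?l \<omega>)"
    using cost log_reference_majorant(3) by (intro expect_mono) (auto simp: cost_def of_bool_def)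
  also have "\<dots> = expect real_sys (\<lambda>\<omega>. of_bool (\<omega> \<in> Good) * ?l \<omega>)"
    by (rule expect_agree[symmetric]) (auto simp: agree)
  also have "\<dots> \<le> cEnt real_sys A (\<lambda>\<omega>. zout (snd \<omega>)) + 1 / ln 2"
  proof -
    have "\<omega> \<in> set_pmf ideal_sys" if "\<omega> \<in> set_pmf real_sys \<inter> Good" for \<omega>
      using that agree[of \<omega>] by (simp add: set_pmf_iff)
    note ideal = this
    have "expect real_sys (\<lambda>\<omega>. of_bool (\<omega> \<in> Good) * ?l \<omega>) - 1 / ln 2 \<le> cEnt real_sys A (\<lambda>\<omega>. zout (snd \<omega>))"
    proof (rule equivocation_lower_bound[where q=real_sys and A=A and S=secret and G=Good
          and Z="\<lambda>\<omega>. zout (snd \<omega>)" and T="\<lambda>\<omega>. fst (fst \<omega>)" and R=majorant and Qp=reference])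
      show "secret \<omega> = secret \<omega>'" if "\<omega> \<in> set_pmf real_sys" "\<omega>' \<in> set_pmf real_sys" "A \<omega> = A \<omega>'" for \<omega> \<omega>'
        using that by (rule assms)
      show "measure_pmf.prob real_sys {\<omega> \<in> Good. (secret \<omega>, zout (snd \<omega>), fst (fst \<omega>)) = (s, z, t)} \<le> majorant s z t" for s z t
        by (rule majorant)
      show "0 < majorant (secret \<omega>) (zout (snd \<omega>)) (fst (fst \<omega>)) \<and> 0 < pmf reference (zout (snd \<omega>), fst (fst \<omega>))"
        if "\<omega> \<in> set_pmf real_sys \<inter> Good" for \<omega>
        using log_reference_majorant(1,2)[OF ideal[OF that]] by blast
    qed simp
    then show ?thesis by linarith
  qed
  finally show ?thesis by simp
qed

section \<open>From functions on blocks to numbered messages\<close>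

abbreviation "F0 \<equiv> PiE_dflt {1..<B} (0::nat) (\<lambda>_. {..<M0})"
abbreviation "F1 \<equiv> PiE_dflt {1..<B} (0::nat) (\<lambda>_. {..<M1}) \<times> PiE_dflt {..<B} (0::nat, 0::nat) (\<lambda>_. {..<S} \<times> {..<J})"

text \<open>The masking index \<open>j\<close> belongs to the confidential message and is delivered
  to the first receiver; the dummy \<open>d\<close> is the private randomness of the encoder. Clouds
  contribute only \<open>B - 1\<close> free indices, satellites \<open>B\<close>.\<close>

theorem block_markov_code:
  shows "\<exists>c. valid_code (n * B + r) c \<and> nW0 c = M0 ^ (B - 1) \<and> nW1 c = M1 ^ (B - 1) * (S * J) ^ B
    \<and> Pe1 W c \<le> B * err \<and> Pe2 W c \<le> B * err
    \<and> cEnt (code_joint W c) (\<lambda>(w0, w1, ys, zs). w1) (\<lambda>(w0, w1, ys, zs). zs)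
        \<ge> (1 - B * err) * (B * log 2 S) - B * leakage - 1 / ln 2"
proof -
  have ne: "finite F0" "F0 \<noteq> {}" "finite F1" "F1 \<noteq> {}"
    using pos by (auto simp: lessThan_empty_iff)
  obtain e0 where e0: "bij_betw e0 F0 {..<card F0}" "pmf_of_set {..<card F0} = map_pmf e0 (pmf_of_set F0)"
    using map_pmf_of_set_enum[OF ne(1,2)] by blast
  obtain e1 where e1: "bij_betw e1 F1 {..<card F1}" "pmf_of_set {..<card F1} = map_pmf e1 (pmf_of_set F1)"
    using map_pmf_of_set_enum[OF ne(3,4)] by blast
  define i0 where "i0 = inv_into F0 e0"
  define i1 where "i1 = inv_into F1 e1"
  have i0: "i0 (e0 f) = f" if "f \<in> F0" for f
    using that e0 by (auto simp: i0_def bij_betw_def)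
  have i1: "i1 (e1 f) = f" if "f \<in> F1" for f
    using that e1(1) unfolding i1_def by (meson bij_betw_inv_into_left)
  have U0: "common B M0 = pmf_of_set F0" using pos by (simp add: uniform_common)
  have U1: "pair_pmf (common B M1) UK = pmf_of_set F1"
    using pos by (simp add: uniform_common uniform_confidential pair_pmf_of_set lessThan_empty_iff finite_PiE_dflt)
  have S0: "set_pmf (common B M0) = F0" using ne by (simp add: U0)
  have S1: "set_pmf (pair_pmf (common B M1) UK) = F1" unfolding U1 by (rule set_pmf_of_set[OF ne(4,3)])
  \<comment> \<open>From \<open>B\<close> on the decoder returns the default of the message
    functions, so that its output equals the message as a function.\<close>
  define d1 where "d1 = (\<lambda>ys. (e0 (\<lambda>b. fst (est dy ys b)), e1 (\<lambda>b. snd (est dy ys b), \<lambda>b. if b < B then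
      let k = dk (est dy ys b) (est dy ys (Suc b)) (block n b ys) in (fst k, fst (snd k)) else (0, 0))))"
  define c :: "('x, 'x1, 'y, 'y1, 'z) rbc_code" where
    "c = \<lparr>nW0 = card F0, nW1 = card F1,
      enc = (\<lambda>w0 w1. bind_pmf UD (\<lambda>d. chanl KX (full ((i0 w0, fst (i1 w1)), snd (i1 w1), d)))),
      relay = relay_fun, dec1 = d1, dec2 = (\<lambda>zs. e0 (\<lambda>b. fst (est dz zs b)))\<rparr>"
  define \<phi> :: "msg \<times> ('y \<times> 'y1 \<times> 'z) list \<Rightarrow> nat \<times> nat \<times> 'y list \<times> 'z list" where
    "\<phi> = (\<lambda>\<omega>. (e0 (fst (fst (fst \<omega>))), e1 (snd (fst (fst \<omega>)), fst (snd (fst \<omega>))), map fst (snd \<omega>), zout (snd \<omega>)))"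
  have c: "nW0 c = card F0" "nW1 c = card F1" "relay c = relay_fun" "dec1 c = d1"
    "dec2 c = (\<lambda>zs. e0 (\<lambda>b. fst (est dz zs b)))"
    "enc c = (\<lambda>w0 w1. bind_pmf UD (\<lambda>d. chanl KX (full ((i0 w0, fst (i1 w1)), snd (i1 w1), d))))"
    by (simp_all add: c_def)
  have joint: "code_joint W c = map_pmf \<phi> real_sys"
  proof -
    have "code_joint W c = bind_pmf (common B M0) (\<lambda>f0. bind_pmf (pair_pmf (common B M1) UK) (\<lambda>f1.
        bind_pmf (enc c (e0 f0) (e1 f1)) (\<lambda>xs. map_pmf (\<lambda>(ys, zs). (e0 f0, e1 f1, ys, zs)) (run_channel W relay_fun xs []))))"
      unfolding code_joint_def c(1-3) e0(2) e1(2) U0 U1 bind_map_pmf ..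
    also have "\<dots> = bind_pmf (common B M0) (\<lambda>f0. bind_pmf (pair_pmf (common B M1) UK) (\<lambda>f1.
        bind_pmf UD (\<lambda>d. bind_pmf (chanl KX (full ((f0, fst f1), snd f1, d)))
        (\<lambda>xs. map_pmf (\<lambda>os. (e0 f0, e1 f1, map fst os, zout os)) (run_full W relay_fun xs [])))))"
    proof (intro bind_pmf_cong refl)
      fix f0 f1 assume f: "f0 \<in> set_pmf (common B M0)" "f1 \<in> set_pmf (pair_pmf (common B M1) UK)"
      have "i0 (e0 f0) = f0" using f(1) S0 i0 by simp
      moreover have "i1 (e1 f1) = f1" using f(2) unfolding S1 by (rule i1)
      ultimately show "bind_pmf (enc c (e0 f0) (e1 f1)) (\<lambda>xs. map_pmf (\<lambda>(ys, zs). (e0 f0, e1 f1, ys, zs)) (run_channel W relay_fun xs []))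
        = bind_pmf UD (\<lambda>d. bind_pmf (chanl KX (full ((f0, fst f1), snd f1, d)))
        (\<lambda>xs. map_pmf (\<lambda>os. (e0 f0, e1 f1, map fst os, zout os)) (run_full W relay_fun xs [])))"
        by (simp add: c(6) bind_assoc_pmf run_channel_full pmf.map_comp o_def zout_def)
    qed
    also have "\<dots> = map_pmf \<phi> real_sys"
      by (simp add: real_sys_def joint_def msgs_def real_out_def pair_pmf_def bind_assoc_pmf bind_return_pmf
          bind_map_pmf map_bind_pmf pmf.map_comp o_def \<phi>_def)
    finally show ?thesis .
  qed
  have dec: "d1 (map fst (snd \<omega>)) = (e0 (fst (fst (fst \<omega>))), e1 (snd (fst (fst \<omega>)), fst (snd (fst \<omega>))))"
    "e0 (\<lambda>b. fst (est dz (zout (snd \<omega>)) b)) = e0 (fst (fst (fst \<omega>)))" if G: "\<omega> \<in> Good" for \<omega>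
  proof -
    obtain f0 f1 \<kappa> d os where \<omega>: "\<omega> = (((f0, f1), \<kappa>, d), os)" by (metis prod.exhaust)
    note g = Good_ok[OF G[unfolded \<omega>], simplified] and m = Good_in[OF G[unfolded \<omega>], simplified]
    have t: "(f0, f1) \<in> set_pmf UT" using m by simp
    have y: "est dy (map fst os) = cloud (f0, f1)" by (rule est_correct[OF t]) (use g in simp)
    have z: "est dz (zout os) = cloud (f0, f1)" by (rule est_correct[OF t]) (use g in \<open>simp add: zout_def\<close>)
    have \<kappa>: "\<kappa> b = (0, 0)" if "\<not> b < B" for b
      using m(1) that pos by (auto simp: msgs_def set_confidential PiE_dflt_def)
    have kk: "(\<lambda>b. if b < B then let k = dk (cloud (f0, f1) b) (cloud (f0, f1) (Suc b)) (block n b (map fst os)) in (fst k, fst (snd k)) else (0, 0)) = \<kappa>"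
      using g(4) \<kappa> by (auto simp: fun_eq_iff Let_def)
    then show "d1 (map fst (snd \<omega>)) = (e0 (fst (fst (fst \<omega>))), e1 (snd (fst (fst \<omega>)), fst (snd (fst \<omega>))))"
      unfolding d1_def \<omega> fst_conv snd_conv y kk by (simp add: cloud_def)
    show "e0 (\<lambda>b. fst (est dz (zout (snd \<omega>)) b)) = e0 (fst (fst (fst \<omega>)))"
      by (simp add: \<omega> z cloud_def)
  qed
  have err_le: "measure_pmf.prob (code_joint W c) X \<le> B * err" if "\<And>\<omega>. \<omega> \<in> Good \<Longrightarrow> \<phi> \<omega> \<notin> X" for X
  proof -
    have "measure_pmf.prob (code_joint W c) X = expect real_sys (\<lambda>\<omega>. of_bool (\<phi> \<omega> \<in> X))"
      by (simp add: joint prob_expect del: measure_map_pmf)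
    also have "\<dots> \<le> expect real_sys (\<lambda>\<omega>. 1 - of_bool (\<omega> \<in> Good))"
      using that by (intro expect_mono) auto
    also have "\<dots> \<le> B * err"
      using real_Good(1) by simp
    finally show ?thesis .
  qed
  have "Pe1 W c \<le> B * err"
    unfolding Pe1_def by (rule err_le) (auto simp: \<phi>_def c dec)
  moreover have "Pe2 W c \<le> B * err"
    unfolding Pe2_def by (rule err_le) (auto simp: \<phi>_def c dec)
  moreover have "card F0 = M0 ^ (B - 1)" by (simp add: card_PiE_dflt)
  moreover have "card F1 = M1 ^ (B - 1) * (S * J) ^ B" by (simp add: card_PiE_dflt card_cartesian_product)
  moreover have "valid_code (n * B + r) c"
    unfolding valid_code_def
  proof (intro conjI allI impI ballI)
    show "1 \<le> nW0 c" "1 \<le> nW1 c" using ne by (auto simp: c Suc_le_eq card_gt_0_iff simp del: card_cartesian_product)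
    fix w0 w1 xs assume w: "w0 < nW0 c" "w1 < nW1 c" and xs: "xs \<in> set_pmf (enc c w0 w1)"
    have "i0 w0 \<in> F0" using w(1) e0(1) unfolding i0_def c
      by (metis bij_betw_imp_surj_on inv_into_into lessThan_iff)
    moreover have "i1 w1 \<in> F1" using w(2) e1(1) unfolding i1_def c
      by (metis bij_betw_imp_surj_on inv_into_into lessThan_iff)
    ultimately have t: "i0 w0 \<in> set_pmf (common B M0)" "i1 w1 \<in> set_pmf (pair_pmf (common B M1) UK)"
      unfolding S0 S1 by auto
    obtain d where d: "d \<in> set_pmf UD" "xs \<in> set_pmf (chanl KX (full ((i0 w0, fst (i1 w1)), snd (i1 w1), d)))"
      using xs by (auto simp: c)
    have "(t, \<kappa>, d) \<in> set_pmf \<mu>" if "t \<in> set_pmf UT" "\<kappa> \<in> set_pmf UK" for t \<kappa>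
      using that d by (auto simp: msgs_def)
    then have "((i0 w0, fst (i1 w1)), snd (i1 w1), d) \<in> set_pmf \<mu>"
      using t by (cases "i1 w1") auto
    then show "length xs = n * B + r" using length_chanl[OF d(2)] length_full by simp
  qed
  moreover have "cEnt (code_joint W c) (\<lambda>(w0, w1, ys, zs). w1) (\<lambda>(w0, w1, ys, zs). zs)
     = cEnt real_sys (\<lambda>\<omega>. e1 (snd (fst (fst \<omega>)), fst (snd (fst \<omega>)))) (\<lambda>\<omega>. zout (snd \<omega>))"
    unfolding joint by (simp add: cEnt_def Ent_def pmf.map_comp o_def \<phi>_def)
  moreover have "\<dots> \<ge> (1 - B * err) * (B * log 2 S) - B * leakage - 1 / ln 2"
  proof (rule equivocation_real_sys)
    fix \<omega> \<omega>' assume \<omega>: "\<omega> \<in> set_pmf real_sys" "\<omega>' \<in> set_pmf real_sys"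
      and eq: "e1 (snd (fst (fst \<omega>)), fst (snd (fst \<omega>))) = e1 (snd (fst (fst \<omega>')), fst (snd (fst \<omega>')))"
    have "(snd (fst (fst \<omega>)), fst (snd (fst \<omega>))) \<in> F1" if "\<omega> \<in> set_pmf real_sys" for \<omega>
    proof -
      have "(snd (fst (fst \<omega>)), fst (snd (fst \<omega>))) \<in> set_pmf (pair_pmf (common B M1) UK)"
        using that by (auto simp: real_sys_def joint_def msgs_def)
      then show ?thesis unfolding S1 .
    qed
    then have "(snd (fst (fst \<omega>)), fst (snd (fst \<omega>))) = (snd (fst (fst \<omega>')), fst (snd (fst \<omega>')))"
      using \<omega> eq i1 by metis
    then show "secret \<omega> = secret \<omega>'" by (simp add: secret_def)
  qed
  ultimately show ?thesis using c by auto
qed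

end

section \<open>Single-letter quantities\<close>

lemma joint_kernel_of_function:
  "joint (\<lambda>_::unit. map_pmf g p) (kernel_of (map_pmf (\<lambda>c. (g c, c)) p)) () = map_pmf (\<lambda>c. (g c, c)) p"
  using joint_kernel_of[of "map_pmf (\<lambda>c. (g c, c)) p"] by (simp add: pmf.map_comp o_def)

lemma bind_joint:
  "bind_pmf (joint (\<lambda>_::unit. p) K ()) F = bind_pmf p (\<lambda>x. bind_pmf (K x) (\<lambda>y. F (x, y)))"
  by (simp add: joint_def bind_assoc_pmf bind_map_pmf)

lemma joint_kernel_bind:
  "joint (\<lambda>_::unit. map_pmf g p) (\<lambda>b. bind_pmf (kernel_of (map_pmf (\<lambda>c. (g c, c)) p) b) L) ()
   = map_pmf (\<lambda>(c, t). (g c, t)) (joint (\<lambda>_::unit. p) L ())"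
proof -
  have "joint (\<lambda>_::unit. map_pmf g p) (\<lambda>b. bind_pmf (kernel_of (map_pmf (\<lambda>c. (g c, c)) p) b) L) ()
    = bind_pmf (joint (\<lambda>_::unit. map_pmf g p) (kernel_of (map_pmf (\<lambda>c. (g c, c)) p)) ()) (\<lambda>(b, c). map_pmf (Pair b) (L c))"
    by (simp add: bind_joint) (simp add: joint_def map_bind_pmf)
  also have "\<dots> = bind_pmf p (\<lambda>c. map_pmf (Pair (g c)) (L c))"
    by (simp add: joint_kernel_of_function bind_map_pmf)
  also have "\<dots> = map_pmf (\<lambda>(c, t). (g c, t)) (joint (\<lambda>_::unit. p) L ())"
    by (simp add: joint_def map_bind_pmf pmf.map_comp o_def)
  finally show ?thesis .
qed

text \<open>The upper layers are functions of the bottom letter, and the downward kernels are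
  conditional laws; a codebook letter drawn from the top down therefore has the prescribed joint
  law.\<close>

locale chain =
  fixes pC :: "'c::finite pmf" and Ch :: "'c \<Rightarrow> 'o::finite pmf"
    and \<pi> :: "'c \<Rightarrow> 'b::finite" and \<rho> :: "'b \<Rightarrow> 'a::finite"
begin

definition pB :: "'b pmf" where "pB = map_pmf \<pi> pC"
definition pA :: "'a pmf" where "pA = map_pmf \<rho> pB"
definition KC :: "'b \<Rightarrow> 'c pmf" where "KC = kernel_of (map_pmf (\<lambda>c. (\<pi> c, c)) pC)"
definition KB :: "'a \<Rightarrow> 'b pmf" where "KB = kernel_of (map_pmf (\<lambda>b. (\<rho> b, b)) pB)"
definition P :: "('c \<times> 'o) pmf" where "P = joint (\<lambda>_::unit. pC) Ch ()"

sublocale letters pA KB KC Ch fr fy fz for fr fy fz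
  by unfold_locales auto

lemma joint_c: "joint (\<lambda>_::unit. pC) (Lc f) () = map_pmf (\<lambda>\<omega>. (fst \<omega>, f (snd \<omega>))) P"
  by (simp add: P_def joint_def Lc_def map_bind_pmf pmf.map_comp o_def)

lemma joint_b: "joint (\<lambda>_::unit. pB) (Lb f) () = map_pmf (\<lambda>\<omega>. (\<pi> (fst \<omega>), f (snd \<omega>))) P"
proof -
  have eq: "Lb f = (\<lambda>b. bind_pmf (KC b) (Lc f))" by (rule ext) (rule Lb_def)
  have "joint (\<lambda>_::unit. pB) (Lb f) () = map_pmf (\<lambda>(c, t). (\<pi> c, t)) (joint (\<lambda>_::unit. pC) (Lc f) ())"
    unfolding eq unfolding pB_def KC_def by (rule joint_kernel_bind)
  then show ?thesis by (simp add: joint_c pmf.map_comp o_def)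
qed

lemma joint_a: "joint (\<lambda>_::unit. pA) (La f) () = map_pmf (\<lambda>\<omega>. (\<rho> (\<pi> (fst \<omega>)), f (snd \<omega>))) P"
proof -
  have eq: "La f = (\<lambda>a. bind_pmf (KB a) (Lb f))" by (rule ext) (rule La_def)
  have "joint (\<lambda>_::unit. pA) (La f) () = map_pmf (\<lambda>(b, t). (\<rho> b, t)) (joint (\<lambda>_::unit. pB) (Lb f) ())"
    unfolding eq unfolding pA_def KB_def by (rule joint_kernel_bind)
  then show ?thesis by (simp add: joint_b pmf.map_comp o_def)
qed

lemma L0_eq: "L0 f = map_pmf (\<lambda>\<omega>. f (snd \<omega>)) P"
proof -
  have "L0 f = map_pmf snd (joint (\<lambda>_::unit. pA) (La f) ())"
    by (simp add: L0_def joint_def map_bind_pmf pmf.map_comp o_def)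
  then show ?thesis by (simp add: joint_a pmf.map_comp o_def)
qed

lemma marginals:
  "pC = map_pmf fst P" "pB = map_pmf (\<lambda>\<omega>. \<pi> (fst \<omega>)) P" "pA = map_pmf (\<lambda>\<omega>. \<rho> (\<pi> (fst \<omega>))) P"
proof -
  have 1: "map_pmf fst P = pC" by (simp add: P_def joint_def map_bind_pmf pmf.map_comp o_def bind_return_pmf')
  then show "pC = map_pmf fst P" by (rule sym)
  have 2: "map_pmf (\<lambda>\<omega>. \<pi> (fst \<omega>)) P = map_pmf \<pi> (map_pmf fst P)" by (simp add: pmf.map_comp o_def)
  show "pB = map_pmf (\<lambda>\<omega>. \<pi> (fst \<omega>)) P" unfolding 2 1 by (rule pB_def)
  have 3: "map_pmf (\<lambda>\<omega>. \<rho> (\<pi> (fst \<omega>))) P = map_pmf \<rho> (map_pmf \<pi> (map_pmf fst P))" by (simp add: pmf.map_comp o_def)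
  show "pA = map_pmf (\<lambda>\<omega>. \<rho> (\<pi> (fst \<omega>))) P" unfolding 3 1 by (simp only: pA_def pB_def)
qed

abbreviation "loglaw g \<omega> \<equiv> log 2 (pmf (map_pmf g P) (g \<omega>))"

text \<open>The pointwise chain rule log p(y|x) = log p(x,y) - log p(x), with positivity on the
  support; taking means turns it into differences of entropies.\<close>

lemma log_kernels:
  assumes "\<omega> \<in> set_pmf P"
  shows "log 2 (pmf (Lc f (fst \<omega>)) (f (snd \<omega>))) =
      loglaw (\<lambda>\<omega>. (fst \<omega>, f (snd \<omega>))) \<omega> - loglaw fst \<omega>"
    "log 2 (pmf (Lb f (\<pi> (fst \<omega>))) (f (snd \<omega>))) =
      loglaw (\<lambda>\<omega>. (\<pi> (fst \<omega>), f (snd \<omega>))) \<omega> - loglaw (\<lambda>\<omega>. \<pi> (fst \<omega>)) \<omega>"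
    "log 2 (pmf (La f (\<rho> (\<pi> (fst \<omega>)))) (f (snd \<omega>))) =
      loglaw (\<lambda>\<omega>. (\<rho> (\<pi> (fst \<omega>)), f (snd \<omega>))) \<omega> - loglaw (\<lambda>\<omega>. \<rho> (\<pi> (fst \<omega>))) \<omega>"
    "pmf (Lc f (fst \<omega>)) (f (snd \<omega>)) > 0" "pmf (Lb f (\<pi> (fst \<omega>))) (f (snd \<omega>)) > 0"
    "pmf (La f (\<rho> (\<pi> (fst \<omega>)))) (f (snd \<omega>)) > 0" "pmf (L0 f) (f (snd \<omega>)) > 0"
proof -
  have log: "pmf (K a) y > 0 \<and> log 2 (pmf (K a) y) = log 2 (pmf (joint (\<lambda>_::unit. p) K ()) (a, y)) - log 2 (pmf p a)"
    if "pmf (joint (\<lambda>_::unit. p) K ()) (a, y) > 0" for p :: "'q pmf" and K :: "'q \<Rightarrow> 't pmf" and a y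
    using that by (auto simp: pmf_joint zero_less_mult_iff log_mult)
  note p = pmf_map_pos[OF assms]
  show "log 2 (pmf (Lc f (fst \<omega>)) (f (snd \<omega>))) =
      loglaw (\<lambda>\<omega>. (fst \<omega>, f (snd \<omega>))) \<omega> - loglaw fst \<omega>"
    "pmf (Lc f (fst \<omega>)) (f (snd \<omega>)) > 0"
    using log[of pC "Lc f" "fst \<omega>" "f (snd \<omega>)"] p[of "\<lambda>\<omega>. (fst \<omega>, f (snd \<omega>))"]
    unfolding joint_c marginals(1)[symmetric] by auto
  show "log 2 (pmf (Lb f (\<pi> (fst \<omega>))) (f (snd \<omega>))) =
      loglaw (\<lambda>\<omega>. (\<pi> (fst \<omega>), f (snd \<omega>))) \<omega> - loglaw (\<lambda>\<omega>. \<pi> (fst \<omega>)) \<omega>"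
    "pmf (Lb f (\<pi> (fst \<omega>))) (f (snd \<omega>)) > 0"
    using log[of pB "Lb f" "\<pi> (fst \<omega>)" "f (snd \<omega>)"] p[of "\<lambda>\<omega>. (\<pi> (fst \<omega>), f (snd \<omega>))"]
    unfolding joint_b marginals(2)[symmetric] by auto
  show "log 2 (pmf (La f (\<rho> (\<pi> (fst \<omega>)))) (f (snd \<omega>))) =
      loglaw (\<lambda>\<omega>. (\<rho> (\<pi> (fst \<omega>)), f (snd \<omega>))) \<omega> - loglaw (\<lambda>\<omega>. \<rho> (\<pi> (fst \<omega>))) \<omega>"
    "pmf (La f (\<rho> (\<pi> (fst \<omega>)))) (f (snd \<omega>)) > 0"
    using log[of pA "La f" "\<rho> (\<pi> (fst \<omega>))" "f (snd \<omega>)"] p[of "\<lambda>\<omega>. (\<rho> (\<pi> (fst \<omega>)), f (snd \<omega>))"]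
    unfolding joint_a marginals(3)[symmetric] by auto
  show "pmf (L0 f) (f (snd \<omega>)) > 0"
    using p[of "\<lambda>\<omega>. f (snd \<omega>)"] by (simp add: L0_eq)
qed

lemma expect_layers:
  "expect pA (\<lambda>a. expect (KB a) (H a)) = expect pB (\<lambda>b. H (\<rho> b) b)"
  "expect pB (\<lambda>b. expect (KC b) (G b)) = expect pC (\<lambda>c. G (\<pi> c) c)"
  using arg_cong[OF joint_kernel_of_function[of \<rho> pB], of "\<lambda>p. expect p (\<lambda>(a, b). H a b)"]
    arg_cong[OF joint_kernel_of_function[of \<pi> pC], of "\<lambda>p. expect p (\<lambda>(b, c). G b c)"]
  by (simp_all add: expect_joint KB_def[symmetric] KC_def[symmetric] pA_def[symmetric] pB_def[symmetric])

lemma expect_out: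
  "expect pC (\<lambda>c. expect (Lc f c) (F c)) = expect P (\<lambda>\<omega>. F (fst \<omega>) (f (snd \<omega>)))"
  "expect pB (\<lambda>b. expect (Lb f b) (G b)) = expect P (\<lambda>\<omega>. G (\<pi> (fst \<omega>)) (f (snd \<omega>)))"
  using arg_cong[OF joint_c[of f], of "\<lambda>p. expect p (\<lambda>(c, y). F c y)"]
    arg_cong[OF joint_b[of f], of "\<lambda>p. expect p (\<lambda>(c, y). G c y)"]
  by (simp_all add: expect_joint)

text \<open>The upper letter is a function of the cloud letter, so the cloud letter alone stands for
  the pair in the entropies.\<close>

lemma Iab_Ent: "Iab f = Ent P (\<lambda>\<omega>. \<pi> (fst \<omega>)) + Ent P (\<lambda>\<omega>. (\<rho> (\<pi> (fst \<omega>)), f (snd \<omega>)))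
    - Ent P (\<lambda>\<omega>. (\<pi> (fst \<omega>), f (snd \<omega>))) - Ent P (\<lambda>\<omega>. \<rho> (\<pi> (fst \<omega>)))"
proof -
  have "Iab f = expect P (\<lambda>\<omega>. log 2 (pmf (Lb f (\<pi> (fst \<omega>))) (f (snd \<omega>)) / pmf (La f (\<rho> (\<pi> (fst \<omega>)))) (f (snd \<omega>))))"
    unfolding Iab_def by (simp add: expect_layers expect_out)
  also have "\<dots> = expect P (\<lambda>\<omega>. log 2 (pmf (Lb f (\<pi> (fst \<omega>))) (f (snd \<omega>))) - log 2 (pmf (La f (\<rho> (\<pi> (fst \<omega>)))) (f (snd \<omega>))))"
    by (intro expect_cong) (rule log_divide_pos; rule log_kernels(5,6))
  also have "\<dots> = expect P (\<lambda>\<omega>. (loglaw (\<lambda>\<omega>. (\<pi> (fst \<omega>), f (snd \<omega>))) \<omega> - loglaw (\<lambda>\<omega>. \<pi> (fst \<omega>)) \<omega>)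
     - (loglaw (\<lambda>\<omega>. (\<rho> (\<pi> (fst \<omega>)), f (snd \<omega>))) \<omega> - loglaw (\<lambda>\<omega>. \<rho> (\<pi> (fst \<omega>))) \<omega>))"
    by (intro expect_cong) (simp only: log_kernels)
  finally show ?thesis by (simp add: Ent_expect)
qed

lemma I0b_Ent: "I0b f = Ent P (\<lambda>\<omega>. \<pi> (fst \<omega>)) + Ent P (\<lambda>\<omega>. f (snd \<omega>)) - Ent P (\<lambda>\<omega>. (\<pi> (fst \<omega>), f (snd \<omega>)))"
proof -
  have "I0b f = expect P (\<lambda>\<omega>. log 2 (pmf (Lb f (\<pi> (fst \<omega>))) (f (snd \<omega>)) / pmf (L0 f) (f (snd \<omega>))))"
    unfolding I0b_def by (simp add: expect_layers expect_out)
  also have "\<dots> = expect P (\<lambda>\<omega>. log 2 (pmf (Lb f (\<pi> (fst \<omega>))) (f (snd \<omega>))) - log 2 (pmf (L0 f) (f (snd \<omega>))))"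
    by (intro expect_cong) (rule log_divide_pos; rule log_kernels(5,7))
  also have "\<dots> = expect P (\<lambda>\<omega>. (loglaw (\<lambda>\<omega>. (\<pi> (fst \<omega>), f (snd \<omega>))) \<omega> - loglaw (\<lambda>\<omega>. \<pi> (fst \<omega>)) \<omega>)
     - loglaw (\<lambda>\<omega>. f (snd \<omega>)) \<omega>)"
    by (intro expect_cong) (simp only: log_kernels L0_eq)
  finally show ?thesis by (simp add: Ent_expect)
qed

lemma Ibc_Ent: "Ibc f = Ent P fst + Ent P (\<lambda>\<omega>. (\<pi> (fst \<omega>), f (snd \<omega>)))
    - Ent P (\<lambda>\<omega>. (fst \<omega>, f (snd \<omega>))) - Ent P (\<lambda>\<omega>. \<pi> (fst \<omega>))"
proof -
  have "Ibc f = expect P (\<lambda>\<omega>. log 2 (pmf (Lc f (fst \<omega>)) (f (snd \<omega>)) / pmf (Lb f (\<pi> (fst \<omega>))) (f (snd \<omega>))))"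
    unfolding Ibc_def by (simp add: expect_layers expect_out)
  also have "\<dots> = expect P (\<lambda>\<omega>. log 2 (pmf (Lc f (fst \<omega>)) (f (snd \<omega>))) - log 2 (pmf (Lb f (\<pi> (fst \<omega>))) (f (snd \<omega>))))"
    by (intro expect_cong) (rule log_divide_pos; rule log_kernels(4,5))
  also have "\<dots> = expect P (\<lambda>\<omega>. (loglaw (\<lambda>\<omega>. (fst \<omega>, f (snd \<omega>))) \<omega> - loglaw fst \<omega>)
     - (loglaw (\<lambda>\<omega>. (\<pi> (fst \<omega>), f (snd \<omega>))) \<omega> - loglaw (\<lambda>\<omega>. \<pi> (fst \<omega>)) \<omega>))"
    by (intro expect_cong) (simp only: log_kernels)
  finally show ?thesis by (simp add: Ent_expect)
qed

lemma KB_support: "a \<in> set_pmf pA \<Longrightarrow> b \<in> set_pmf (KB a) \<Longrightarrow> \<rho> b = a \<and> b \<in> set_pmf pB"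
  and KC_support: "b \<in> set_pmf pB \<Longrightarrow> c \<in> set_pmf (KC b) \<Longrightarrow> \<pi> c = b"
proof -
  assume "a \<in> set_pmf pA" "b \<in> set_pmf (KB a)"
  then have "(a, b) \<in> set_pmf (joint (\<lambda>_::unit. pA) KB ())" by (auto simp: joint_def)
  then show "\<rho> b = a \<and> b \<in> set_pmf pB"
    unfolding KB_def pA_def joint_kernel_of_function by auto
next
  assume "b \<in> set_pmf pB" "c \<in> set_pmf (KC b)"
  then have "(b, c) \<in> set_pmf (joint (\<lambda>_::unit. pB) KC ())" by (auto simp: joint_def)
  then show "\<pi> c = b"
    unfolding KC_def pB_def joint_kernel_of_function by auto
qed

text \<open>On their supports the kernels respect \<open>\<rho>\<close> and \<open>\<pi>\<close>;
  hence the relay word can be read off the satellite word, letter by letter.\<close>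

lemma chanl_support:
  assumes "as \<in> set_pmf (iid n pA)" "bs \<in> set_pmf (chanl KB as)" "cs \<in> set_pmf (chanl KC bs)"
  shows "length cs = n" "length bs = n" "map (\<lambda>c. \<rho> (\<pi> c)) cs = as"
proof -
  have a: "length as = n" "set as \<subseteq> set_pmf pA" using set_iid[OF assms(1)] by auto
  show b: "length bs = n" using length_chanl[OF assms(2)] a by simp
  show c: "length cs = n" using length_chanl[OF assms(3)] b by simp
  show "map (\<lambda>c. \<rho> (\<pi> c)) cs = as"
  proof (rule nth_equalityI)
    fix i assume "i < length (map (\<lambda>c. \<rho> (\<pi> c)) cs)"
    then have i: "i < n" using c by simp
    have 1: "as ! i \<in> set_pmf pA" using a i by auto
    have 2: "bs ! i \<in> set_pmf (KB (as ! i))" using assms(2) i a by (auto simp: set_chanl list_all2_conv_all_nth)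
    have 3: "cs ! i \<in> set_pmf (KC (bs ! i))" using assms(3) i b by (auto simp: set_chanl list_all2_conv_all_nth)
    show "map (\<lambda>c. \<rho> (\<pi> c)) cs ! i = as ! i"
      using KB_support[OF 1 2] KC_support[OF _ 3] i c by simp
  qed (use a c in simp)
qed

end

lemma (in letters) Lb_pos:
  assumes "cs \<in> set_pmf (chanl KC bs)" "z \<in> set_pmf (chanl (Lc f) cs)"
  shows "pmf (chanl (Lb f) bs) z > 0"
proof -
  have "z \<in> set_pmf (bind_pmf (chanl KC bs) (chanl (Lc f)))" using assms by auto
  then show ?thesis unfolding chanl_bind Lb_def[abs_def] by (rule pmf_positive)
qed

section \<open>Rates and the diagonal argument\<close>

definition size_of_rate :: "nat \<Rightarrow> real \<Rightarrow> nat" where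
  "size_of_rate n x = nat \<lceil>2 powr (n * x)\<rceil>"

lemma size_of_rate:
  assumes "x \<ge> 0"
  shows "size_of_rate n x > 0" "2 powr (n * x) \<le> size_of_rate n x" "size_of_rate n x \<le> 2 * 2 powr (n * x)"
    "n * x \<le> log 2 (size_of_rate n x)" "log 2 (size_of_rate n x) \<le> n * x + 1"
proof -
  have 1: "2 powr (n * x) \<ge> 1" using assms by (intro ge_one_powr_ge_zero) auto
  show 2: "2 powr (n * x) \<le> size_of_rate n x"
    unfolding size_of_rate_def by (rule real_nat_ceiling_ge)
  show 3: "size_of_rate n x \<le> 2 * 2 powr (n * x)"
    unfolding size_of_rate_def using 1 by linarith
  have "real (size_of_rate n x) > 0" using 1 2 by linarith
  then show pos: "size_of_rate n x > 0" by simp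
  show "n * x \<le> log 2 (size_of_rate n x)"
    using 2 pos by (subst le_log_iff) auto
  have "log 2 (size_of_rate n x) \<le> log 2 (2 * 2 powr (n * x))"
    using 3 pos by (subst log_le_cancel_iff) auto
  also have "\<dots> = n * x + 1" by (simp add: log_mult)
  finally show "log 2 (size_of_rate n x) \<le> n * x + 1" .
qed

text \<open>Slack in all requirements is harmless: a diagonal sequence of codes removes it and reaches
  the boundary of the region.\<close>

definition near_code ::
  "('x \<Rightarrow> 'x1 \<Rightarrow> ('y \<times> 'y1 \<times> 'z) pmf) \<Rightarrow> real \<Rightarrow> real \<Rightarrow> real \<Rightarrow> real \<Rightarrow> nat
     \<Rightarrow> ('x, 'x1, 'y, 'y1, 'z) rbc_code \<Rightarrow> bool" where
  "near_code W R0 R1 Req \<delta> N c \<longleftrightarrow> valid_code N c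
     \<and> \<bar>log 2 (nW0 c) / N - R0\<bar> \<le> \<delta> \<and> \<bar>log 2 (nW1 c) / N - R1\<bar> \<le> \<delta>
     \<and> Req - \<delta> \<le> equivocation W N c \<and> Pe1 W c \<le> \<delta> \<and> Pe2 W c \<le> \<delta>"

text \<open>Two relative losses: \<open>B / N\<close> from an incomplete last block,
  \<open>1 / B\<close> because the clouds fill only \<open>B - 1\<close> of \<open>B\<close>
  blocks.\<close>

lemma block_count:
  fixes N B :: nat and a :: real
  assumes "B > 0" "N > 0" and a: "a \<ge> 0"
  shows "real (B - 1) * (real (N div B) * a) \<ge> N * a - N * ((B / N + 1 / B) * a)"
    "real B * (real (N div B) * a) \<le> N * a"
    "real (B - 1) * (real (N div B) * a) \<le> real B * (real (N div B) * a)"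
proof -
  let ?n = "real (N div B)"
  have N: "N = B * (N div B) + N mod B" by simp
  have "N mod B \<le> B" using assms by (simp add: less_imp_le)
  then have 1: "real N \<le> B * ?n + B" by (metis N add_left_mono of_nat_add of_nat_le_iff of_nat_mult)
  have 2: "B * ?n \<le> N" by (metis N le_add1 of_nat_le_iff of_nat_mult)
  have 3: "?n \<le> N / B" using 2 assms by (simp add: field_simps)
  have B: "real (B - 1) = real B - 1" using assms by simp
  have "real (B - 1) * ?n \<ge> real N - B - N / B" unfolding B using 1 3 by (simp add: algebra_simps)
  then have "real (B - 1) * ?n * a \<ge> (real N - B - N / B) * a" using a by (rule mult_right_mono)
  also have "(real N - B - N / B) * a = N * a - N * ((B / N + 1 / B) * a)"
    using assms by (simp add: field_simps)
  finally show "real (B - 1) * (?n * a) \<ge> N * a - N * ((B / N + 1 / B) * a)" by (simp add: mult.assoc)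
  show "real B * (?n * a) \<le> N * a" using mult_right_mono[OF 2 a] by (simp add: mult.assoc)
  show "real (B - 1) * (?n * a) \<le> real B * (?n * a)" using a by (intro mult_right_mono) auto
qed

locale relay_chain =
  fixes W :: "'x::finite \<Rightarrow> 'x1::finite \<Rightarrow> ('y::finite \<times> 'y1::finite \<times> 'z::finite) pmf"
    and pC :: "'c::finite pmf" and KX :: "'c \<Rightarrow> 'x pmf"
    and \<pi> :: "'c \<Rightarrow> 'b::finite" and \<rho> :: "'b \<Rightarrow> 'x1"
begin

sublocale chain pC "\<lambda>c. bind_pmf (KX c) (\<lambda>x. W x (\<rho> (\<pi> c)))" \<pi> \<rho> .

abbreviation (input) "out_y1 \<equiv> \<lambda>o' :: 'y \<times> 'y1 \<times> 'z. fst (snd o')"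
abbreviation (input) "out_y \<equiv> \<lambda>o' :: 'y \<times> 'y1 \<times> 'z. fst o'"
abbreviation (input) "out_z \<equiv> \<lambda>o' :: 'y \<times> 'y1 \<times> 'z. snd (snd o')"

text \<open>The rate conditions are, in order, decodability of the clouds, decodability of the
  satellites at the first receiver, and enough masking for soft covering. The block code is
  independent of the padding, so one bound on \<open>n\<close> serves all \<open>r\<close>.\<close>

lemma eventually_block_markov_code:
  fixes B :: nat and Iw \<eta> \<epsilon> a0 a1 as aj ad :: real
  assumes \<eta>: "\<eta> > 0" and \<epsilon>: "\<epsilon> > 0" and B: "B > 0"
    and I: "Iw \<le> Iab out_y1" "Iw \<le> I0b out_y" "Iw \<le> I0b out_z"
    and a: "a0 \<ge> 0" "a1 \<ge> 0" "as \<ge> 0" "aj \<ge> 0" "ad \<ge> 0"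
    and rates: "a0 + a1 \<le> Iw - \<eta>" "as + aj + ad \<le> Ibc out_y - \<eta>" "Ibc out_z \<le> aj + ad"
  shows "\<forall>\<^sub>F n in sequentially. \<forall>r. \<exists>c. valid_code (n * B + r) c
    \<and> nW0 c = size_of_rate n a0 ^ (B - 1)
    \<and> nW1 c = size_of_rate n a1 ^ (B - 1) * (size_of_rate n as * size_of_rate n aj) ^ B
    \<and> Pe1 W c \<le> B * \<epsilon> \<and> Pe2 W c \<le> B * \<epsilon>
    \<and> cEnt (code_joint W c) (\<lambda>(w0, w1, ys, zs). w1) (\<lambda>(w0, w1, ys, zs). zs)
        \<ge> (1 - B * \<epsilon>) * (B * log 2 (size_of_rate n as)) - B * (\<epsilon> * n) - 1 / ln 2" (is "\<forall>\<^sub>F n in _. \<forall>r. ?ex n r")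
  using exists_block_code[where fr=out_y1 and fy=out_y and fz=out_z and 'w="nat \<times> nat" and 's=nat and 'j="nat \<times> nat", OF \<eta> \<epsilon> I]
    eventually_gt_at_top[of 0]
proof eventually_elim
  case (elim n)
  show ?case
  proof
    fix r :: nat
    let ?M0 = "size_of_rate n a0" and ?M1 = "size_of_rate n a1" and ?S = "size_of_rate n as"
      and ?J = "size_of_rate n aj" and ?D = "size_of_rate n ad"
    let ?Ws = "{..<?M0} \<times> {..<?M1}" and ?Js = "{..<?J} \<times> {..<?D}"
    note s0 = size_of_rate[OF a(1), of n] and s1 = size_of_rate[OF a(2), of n] and ss = size_of_rate[OF a(3), of n]
      and sj = size_of_rate[OF a(4), of n] and sd = size_of_rate[OF a(5), of n]
    interpret messages B ?M0 ?M1 ?S ?J ?D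
      by unfold_locales (use B s0 s1 ss sj sd in auto)
    let ?\<nu> = "block_index B ?M0 ?M1 ?S ?J ?D"
    have cW: "card ?Ws \<le> 4 * 2 powr (n * (Iw - \<eta>))"
    proof -
      have "card ?Ws \<le> (2 * 2 powr (n * a0)) * (2 * 2 powr (n * a1))"
        using mult_mono[OF s0(3) s1(3)] by (simp add: card_cartesian_product)
      also have "\<dots> = 4 * 2 powr (n * (a0 + a1))" by (simp add: powr_add distrib_left)
      also have "\<dots> \<le> 4 * 2 powr (n * (Iw - \<eta>))" using rates by (simp add: mult_left_mono)
      finally show ?thesis .
    qed
    have cJ: "card ?Js \<le> 4 * 2 powr (n * (aj + ad))" "2 powr (n * Ibc out_z) \<le> card ?Js"
    proof -
      have "card ?Js \<le> (2 * 2 powr (n * aj)) * (2 * 2 powr (n * ad))"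
        using mult_mono[OF sj(3) sd(3)] by (simp add: card_cartesian_product)
      also have "\<dots> = 4 * 2 powr (n * (aj + ad))" by (simp add: powr_add distrib_left)
      finally show "card ?Js \<le> 4 * 2 powr (n * (aj + ad))" .
      have "2 powr (n * Ibc out_z) \<le> 2 powr (n * (aj + ad))" using rates by (simp add: mult_left_mono)
      also have "\<dots> = 2 powr (n * aj) * 2 powr (n * ad)" by (simp add: powr_add distrib_left)
      also have "\<dots> \<le> card ?Js"
        using mult_mono[OF sj(2) sd(2)] by (simp add: card_cartesian_product)
      finally show "2 powr (n * Ibc out_z) \<le> card ?Js" .
    qed
    have cK: "card {..<?S} * card ?Js \<le> 8 * 2 powr (n * (Ibc out_y - \<eta>))"
    proof -
      have "real (card {..<?S} * card ?Js) \<le> (2 * 2 powr (n * as)) * (4 * 2 powr (n * (aj + ad)))"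
        using mult_mono[OF ss(3) cJ(1)] by simp
      also have "\<dots> = 8 * 2 powr (n * (as + aj + ad))" by (simp add: powr_add distrib_left)
      also have "\<dots> \<le> 8 * 2 powr (n * (Ibc out_y - \<eta>))" using rates by (simp add: mult_left_mono)
      finally show ?thesis .
    qed
    obtain ca cb cc dr dy dz dk where
      "letters.block_code pA KB KC (\<lambda>c. bind_pmf (KX c) (\<lambda>x. W x (\<rho> (\<pi> c)))) out_y1 out_y out_z
        n ?Ws {..<?S} ?Js ?\<nu> \<epsilon> ca cb cc dr dy dz dk"
      using elim(1)[rule_format, of ?Ws "{..<?S}" ?Js ?\<nu>, OF _ _ _ set_block_index cW cK cJ(2)] by auto
    note code = this[unfolded block_code_def, THEN conjunct1]
      this[unfolded block_code_def, THEN conjunct2, THEN conjunct1]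
      this[unfolded block_code_def, THEN conjunct2, THEN conjunct2]
    \<comment> \<open>Any letter can serve as padding, since its likelihood cancels between
      reference and majorant.\<close>
    interpret BS: block_scheme B ?M0 ?M1 ?S ?J ?D W KX "\<lambda>c. \<rho> (\<pi> c)" "Lb out_z" n r ca cb cc dr dy dz dk undefined
    proof
      show "0 < n" using elim by simp
      show "length (cc v w k) = n \<and> map (\<lambda>c. \<rho> (\<pi> c)) (cc v w k) = ca v \<and> length (cb v w) = n"
        if vwk: "v \<in> ?Ws" "w \<in> ?Ws" "k \<in> {..<?S} \<times> {..<?J} \<times> {..<?D}" for v w k
        using chanl_support[of "ca v" n "cb v w" "cc v w k"] code(1)[rule_format, OF vwk] by blast
      show "pmf (chanl (Lb out_z) (cb v w)) z > 0"
        if vwk: "v \<in> ?Ws" "w \<in> ?Ws" "k \<in> {..<?S} \<times> {..<?J} \<times> {..<?D}"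
          and z: "z \<in> set_pmf (chanl (\<lambda>c. map_pmf out_z (bind_pmf (KX c) (\<lambda>x. W x (\<rho> (\<pi> c))))) (cc v w k))" for v w k z
        using code(1)[rule_format, OF vwk] z by (intro Lb_pos) (auto simp: Lc_def[abs_def])
    qed
    have Ch: "BS.Ch = (\<lambda>c. bind_pmf (KX c) (\<lambda>x. W x (\<rho> (\<pi> c))))" by (rule ext) (rule BS.Ch_def)
    have Lz: "BS.Lz = Lc out_z" by (rule ext) (simp only: BS.Lz_def Ch Lc_def)
    have err: "BS.err \<le> \<epsilon>"
      unfolding BS.err_def Ch BS.ok_def prod.case by (rule code(2))
    have leak: "BS.leakage \<le> \<epsilon> * n"
      unfolding BS.leakage_def Lz by (rule code(3))
    have Berr: "B * BS.err \<le> B * \<epsilon>" using err by (intro mult_left_mono) auto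
    have Bleak: "B * BS.leakage \<le> B * (\<epsilon> * n)" using leak by (intro mult_left_mono) auto
    have "(1 - B * \<epsilon>) * (B * log 2 ?S) \<le> (1 - B * BS.err) * (B * log 2 ?S)"
      using Berr ss(1) by (intro mult_right_mono mult_nonneg_nonneg) auto
    with BS.block_markov_code Berr Bleak
    show "?ex n r"
      by (smt (verit, best))
  qed
qed

end

text \<open>The budget of \<delta>: 1/8 for \<eta>, 1/4 for the block losses, and 1/8 each for
  errors, leakage and the additive constant, three quarters in all.\<close>

lemma slack_bounds:
  fixes M x K \<delta> \<eta> :: real
  assumes "0 \<le> M * \<delta>" "K \<le> M * (\<delta> / 4)" "M * \<eta> \<le> M * (\<delta> / 8)"
  shows "M * (x - \<delta>) \<le> M * (x - \<eta>) - K"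
    "M * (x - \<eta>) - K \<le> X \<Longrightarrow> Y \<le> M * (\<delta> / 8) \<Longrightarrow> Y' \<le> M * (\<delta> / 8) \<Longrightarrow> Y'' \<le> M * (\<delta> / 8)
      \<Longrightarrow> M * (x - \<delta>) \<le> X - Y - Y' - Y''"
proof -
  define c e where "c = M * \<delta>" and "e = M * \<eta>"
  have *: "M * (x - \<delta>) = M * x - c" "M * (x - \<eta>) = M * x - e" "M * (\<delta> / 4) = c / 4" "M * (\<delta> / 8) = c / 8"
    by (simp_all add: c_def e_def right_diff_distrib)
  have a: "0 \<le> c" "K \<le> c / 4" "e \<le> c / 8" using assms unfolding * c_def e_def by simp_all
  show "M * (x - \<delta>) \<le> M * (x - \<eta>) - K" unfolding * using a by linarith
  show "M * (x - \<delta>) \<le> X - Y - Y' - Y''"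
    if "M * (x - \<eta>) - K \<le> X" "Y \<le> M * (\<delta> / 8)" "Y' \<le> M * (\<delta> / 8)" "Y'' \<le> M * (\<delta> / 8)"
    using that a unfolding * by linarith
qed

context relay_chain
begin

text \<open>The satellite rates \<open>Req - \<eta>\<close>, \<open>Rp - Req\<close> and
  \<open>Ibc out_y - Rp\<close> telescope to the decodable rate \<open>Ibc out_y - \<eta>\<close>,
  and the last two add up to \<open>Ibc out_y - Req\<close>, which is at least the covering rate.
  For the clouds, either \<open>T = 0\<close> and \<open>R0 \<le> Iw\<close> is enough, or
  \<open>T = R1 - Ibc out_y\<close> and the bound on \<open>R0 + R1\<close> applies.\<close>

theorem eventually_near_code:
  fixes Iw R0 R1 Req \<delta> :: real
  assumes I: "Iw \<le> Iab out_y1" "Iw \<le> I0b out_y" "Iw \<le> I0b out_z"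
    and R: "R0 > 0" "R1 > 0" "Req > 0" "Req \<le> R1" "R0 \<le> Iw" "R0 + R1 \<le> Iw + Ibc out_y"
      "Req \<le> Ibc out_y - Ibc out_z"
    and \<delta>: "\<delta> > 0"
  shows "\<forall>\<^sub>F N in sequentially. \<exists>c. near_code W R0 R1 Req \<delta> N c"
proof -
  \<comment> \<open>\<open>Q\<close> dominates all rates. \<open>B\<close> makes the loss
    \<open>Q / B\<close> at most \<open>\<delta> / 8\<close>; then \<epsilon> is so small that
    failures of any of the \<open>B\<close> blocks, multiplied by a rate, cost at most
    \<open>\<delta> / 8\<close>. \<eta> keeps the rates \<open>R0 - \<eta>\<close> and
    \<open>Req - \<eta>\<close> positive.\<close>
  define Q where "Q = R0 + R1 + 1"
  define B where "B = nat \<lceil>8 * Q / \<delta>\<rceil>"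
  define \<epsilon> where "\<epsilon> = min \<delta> 1 / (8 * B * Q)"
  define \<eta> where "\<eta> = min (\<delta> / 8) (min (R0 / 2) (Req / 2))"
  \<comment> \<open>\<open>Rp\<close> is the part of the confidential rate sent in the satellites, \<open>T\<close> the part sent in the
    clouds; dummy randomness of rate \<open>Ibc out_y - Rp\<close> fills the satellites up.\<close>
  define Rp where "Rp = min R1 (Ibc out_y)"
  define T where "T = R1 - Rp"
  have Q: "Q > 1" "R0 \<le> Q" "R1 \<le> Q" "Req \<le> Q" using R by (auto simp: Q_def)
  have "8 * Q / \<delta> > 0" using Q \<delta> by simp
  then have Bpos: "B > 0" by (simp add: B_def)
  have Bge: "8 * Q / \<delta> \<le> B" unfolding B_def by (rule real_nat_ceiling_ge)
  have \<epsilon>: "\<epsilon> > 0" using \<delta> Bpos Q by (simp add: \<epsilon>_def)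
  have "B * \<epsilon> * Q = min \<delta> 1 / 8" using Bpos Q by (simp add: \<epsilon>_def)
  then have B\<epsilon>Q: "B * \<epsilon> * Q \<le> \<delta> / 8" "B * \<epsilon> * Q \<le> 1" by auto
  moreover have "B * \<epsilon> * 1 \<le> B * \<epsilon> * Q"
    using Q \<epsilon> by (intro mult_left_mono) auto
  ultimately have B\<epsilon>: "B * \<epsilon> \<le> \<delta> / 8" "B * \<epsilon> \<le> 1" by auto
  have \<epsilon>\<delta>: "\<epsilon> \<le> \<delta> / 8"
  proof -
    have "1 * \<epsilon> \<le> B * \<epsilon>" using Bpos \<epsilon> by (intro mult_right_mono) auto
    then show ?thesis using B\<epsilon> by linarith
  qed
  have \<eta>: "\<eta> > 0" "\<eta> \<le> \<delta> / 8" "\<eta> < R0" "\<eta> < Req" using \<delta> R by (auto simp: \<eta>_def)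
  have Rp: "Req \<le> Rp" "Rp \<le> R1" "Rp \<le> Ibc out_y" "T \<ge> 0" "R0 + T \<le> Iw"
    using R Ibc_nonneg[of out_z] by (auto simp: Rp_def T_def)
  have ev: "\<forall>\<^sub>F n in sequentially. \<forall>r. \<exists>c. valid_code (n * B + r) c
    \<and> nW0 c = size_of_rate n (R0 - \<eta>) ^ (B - 1)
    \<and> nW1 c = size_of_rate n T ^ (B - 1) * (size_of_rate n (Req - \<eta>) * size_of_rate n (Rp - Req)) ^ B
    \<and> Pe1 W c \<le> B * \<epsilon> \<and> Pe2 W c \<le> B * \<epsilon>
    \<and> cEnt (code_joint W c) (\<lambda>(w0, w1, ys, zs). w1) (\<lambda>(w0, w1, ys, zs). zs)
        \<ge> (1 - B * \<epsilon>) * (B * log 2 (size_of_rate n (Req - \<eta>))) - B * (\<epsilon> * n) - 1 / ln 2"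
    by (rule eventually_block_markov_code[OF \<eta>(1) \<epsilon> Bpos I, where ad = "Ibc out_y - Rp"])
       (use \<eta> Rp R in auto)
  \<comment> \<open>The three summands make negligible, against \<open>N * \<delta>\<close>, the
    incomplete block, the bits lost by rounding sizes, and the constant \<open>1 / ln 2\<close> of
    the equivocation bound.\<close>
  define N1 where "N1 = nat \<lceil>(8 * B * Q + 8 * B + 8 / ln 2) / \<delta>\<rceil>"
  have "filterlim (\<lambda>N. N div B) at_top sequentially"
    using Bpos by (intro filterlim_at_top_div_const_nat)
  from filterlim_iff[THEN iffD1, OF this, rule_format, OF ev]
  show ?thesis
    using eventually_ge_at_top[of N1] eventually_gt_at_top[of 0]
  proof eventually_elim
    case (elim N)
    define n where "n = N div B"
    have N: "n * B + N mod B = N" by (simp add: n_def)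
    obtain c where c: "valid_code N c" "nW0 c = size_of_rate n (R0 - \<eta>) ^ (B - 1)"
      "nW1 c = size_of_rate n T ^ (B - 1) * (size_of_rate n (Req - \<eta>) * size_of_rate n (Rp - Req)) ^ B"
      "Pe1 W c \<le> B * \<epsilon>" "Pe2 W c \<le> B * \<epsilon>"
      "cEnt (code_joint W c) (\<lambda>(w0, w1, ys, zs). w1) (\<lambda>(w0, w1, ys, zs). zs)
        \<ge> (1 - B * \<epsilon>) * (B * log 2 (size_of_rate n (Req - \<eta>))) - B * (\<epsilon> * n) - 1 / ln 2"
      using elim(1)[rule_format, of "N mod B"] unfolding n_def[symmetric] N by blast
    have Npos: "real N > 0" using elim by simp
    have "(8 * B * Q + 8 * B + 8 / ln 2) / \<delta> \<le> N1" unfolding N1_def by (rule real_nat_ceiling_ge)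
    also have "\<dots> \<le> N" using elim by simp
    finally have N\<delta>: "8 * B * Q + 8 * B + 8 / ln 2 \<le> N * \<delta>" using \<delta> by (simp add: pos_divide_le_eq)
    define \<kappa> where "\<kappa> = B / N + 1 / B"
    have \<kappa>Q: "N * (\<kappa> * Q) \<le> N * (\<delta> / 4)"
    proof -
      have "B / N * Q \<le> \<delta> / 8"
      proof -
        have "8 * B * Q \<le> N * \<delta>"
          using N\<delta> by (smt (verit) divide_nonneg_pos ln_gt_zero of_nat_0_le_iff)
        then show ?thesis using Npos by (simp add: field_simps)
      qed
      moreover have "1 / B * Q \<le> \<delta> / 8"
        using Bge \<delta> Bpos by (simp add: field_simps)
      moreover have "\<kappa> * Q = B / N * Q + 1 / B * Q" by (simp only: \<kappa>_def distrib_right)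
      ultimately have "\<kappa> * Q \<le> \<delta> / 4" by linarith
      then show ?thesis using Npos by (intro mult_left_mono) auto
    qed
    have \<kappa>: "\<kappa> \<ge> 0" by (simp add: \<kappa>_def)
    have \<kappa>x: "N * (\<kappa> * x) \<le> N * (\<delta> / 4)" if "x \<le> Q" for x
      using order_trans[OF mult_left_mono[OF mult_left_mono[OF that \<kappa>]] \<kappa>Q] by simp
    have N8: "8 * real B \<le> N * \<delta>" "1 / ln 2 \<le> N * (\<delta> / 8)"
    proof -
      have "0 \<le> 8 * real B * Q" using Q by simp
      moreover have "0 \<le> 8 / ln (2 :: real)" by simp
      moreover have "1 / ln 2 = 8 / ln 2 / (8 :: real)" "N * (\<delta> / 8) = N * \<delta> / 8" by simp_all
      ultimately show "8 * real B \<le> N * \<delta>" "1 / ln 2 \<le> N * (\<delta> / 8)" using N\<delta> by linarith+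
    qed
    note bc = block_count[OF Bpos, of N, folded n_def \<kappa>_def]
    have N0: "N > 0" using elim by simp
    have h: "0 \<le> R0 - \<eta>" "0 \<le> T" "0 \<le> Rp - \<eta>" "0 \<le> R1 - \<eta>" "0 \<le> Req - \<eta>"
      using \<eta> Rp R by auto
    have hQ: "R0 - \<eta> \<le> Q" "R1 - \<eta> \<le> Q" "Req - \<eta> \<le> Q" using Q \<eta> by auto
    have BB: "real (B - 1) \<le> real B" "0 \<le> real B" by simp_all
    have N\<eta>: "0 \<le> N * \<eta>" "N * \<eta> \<le> N * (\<delta> / 8)"
      using \<eta> mult_left_mono[OF \<eta>(2), of "real N"] by simp_all
    have l0: "log 2 (nW0 c) = (B - 1) * log 2 (size_of_rate n (R0 - \<eta>))"
      using size_of_rate(1)[of "R0 - \<eta>" n] \<eta> by (simp add: c(2) log_nat_power)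
    have b0: "n * (R0 - \<eta>) \<le> log 2 (size_of_rate n (R0 - \<eta>))" "log 2 (size_of_rate n (R0 - \<eta>)) \<le> n * (R0 - \<eta>) + 1"
      using size_of_rate(4,5)[of "R0 - \<eta>" n] \<eta> by auto
    have b1: "n * T \<le> log 2 (size_of_rate n T)" "log 2 (size_of_rate n T) \<le> n * T + 1"
      using size_of_rate(4,5)[of T n] Rp by auto
    have bs: "n * (Req - \<eta>) \<le> log 2 (size_of_rate n (Req - \<eta>))" "log 2 (size_of_rate n (Req - \<eta>)) \<le> n * (Req - \<eta>) + 1"
      using size_of_rate(4,5)[of "Req - \<eta>" n] \<eta> by auto
    have bj: "n * (Rp - Req) \<le> log 2 (size_of_rate n (Rp - Req))" "log 2 (size_of_rate n (Rp - Req)) \<le> n * (Rp - Req) + 1"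
      using size_of_rate(4,5)[of "Rp - Req" n] Rp by auto
    have l1: "log 2 (nW1 c) = (B - 1) * log 2 (size_of_rate n T)
        + B * (log 2 (size_of_rate n (Req - \<eta>)) + log 2 (size_of_rate n (Rp - Req)))"
      using size_of_rate(1)[of T n] size_of_rate(1)[of "Req - \<eta>" n] size_of_rate(1)[of "Rp - Req" n] \<eta> Rp
      by (simp add: c(3) log_mult_pos log_nat_power)
    have rate0: "\<bar>log 2 (nW0 c) / N - R0\<bar> \<le> \<delta>"
    proof -
      have "log 2 (nW0 c) \<le> (B - 1) * (n * (R0 - \<eta>) + 1)"
        unfolding l0 using b0 by (intro mult_left_mono) auto
      also have "\<dots> = (B - 1) * (n * (R0 - \<eta>)) + real (B - 1)" by (simp add: distrib_left)
      also have "\<dots> \<le> N * (R0 - \<eta>) + B"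
        using bc(2,3)[OF N0 h(1)] BB(1) by linarith
      also have "\<dots> \<le> N * R0 + N * \<delta>"
        using N8(1) N\<eta>(1) BB(2) right_diff_distrib[of "real N" R0 \<eta>] by linarith
      finally have 1: "log 2 (nW0 c) \<le> N * (R0 + \<delta>)" by (simp add: distrib_left)
      have "N * (R0 - \<delta>) \<le> N * (R0 - \<eta>) - N * (\<kappa> * (R0 - \<eta>))"
        using \<delta> by (intro slack_bounds(1) \<kappa>x hQ N\<eta>(2)) simp
      also have "\<dots> \<le> (B - 1) * (n * (R0 - \<eta>))"
        using bc(1)[OF N0 h(1)] by simp
      also have "\<dots> \<le> log 2 (nW0 c)"
        unfolding l0 using b0 by (intro mult_left_mono) auto
      finally have "N * (R0 - \<delta>) \<le> log 2 (nW0 c)" .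
      with 1 Npos show ?thesis by (simp add: abs_le_iff field_simps)
    qed
    have rate1: "\<bar>log 2 (nW1 c) / N - R1\<bar> \<le> \<delta>"
    proof -
      have "log 2 (nW1 c) \<le> (B - 1) * (n * T + 1) + B * ((n * (Req - \<eta>) + 1) + (n * (Rp - Req) + 1))"
        unfolding l1 using b1 bs bj by (intro add_mono mult_left_mono) auto
      also have "\<dots> = (B - 1) * (n * T) + B * (n * (Rp - \<eta>)) + (real (B - 1) + 2 * B)"
        by (simp add: algebra_simps)
      \<comment> \<open>Rounding costs at most one bit per size and block: \<open>B - 1\<close> for
        the clouds and \<open>2 * B\<close> for the two satellite sizes.\<close>
      also have "\<dots> \<le> N * T + N * (Rp - \<eta>) + 3 * B"
        using bc(2,3)[OF N0 h(2)] bc(2)[OF N0 h(3)] BB(1) by linarith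
      also have "\<dots> = N * R1 - N * \<eta> + 3 * B" by (simp add: T_def algebra_simps)
      also have "\<dots> \<le> N * (R1 + \<delta>)"
        using N8(1) N\<eta>(1) BB(2) distrib_left[of "real N" R1 \<delta>] by linarith
      finally have 1: "log 2 (nW1 c) \<le> N * (R1 + \<delta>)" .
      have "N * (R1 - \<delta>) \<le> N * (R1 - \<eta>) - N * (\<kappa> * (R1 - \<eta>))"
        using \<delta> by (intro slack_bounds(1) \<kappa>x hQ N\<eta>(2)) simp
      also have "\<dots> \<le> (B - 1) * (n * (R1 - \<eta>))"
        using bc(1)[OF N0 h(4)] by simp
      also have "\<dots> = (B - 1) * (n * T) + (B - 1) * (n * (Rp - \<eta>))" by (simp add: T_def algebra_simps)
      also have "\<dots> \<le> (B - 1) * (n * T) + B * (n * (Rp - \<eta>))"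
        using bc(3)[OF N0 h(3)] by linarith
      also have "\<dots> = (B - 1) * (n * T) + B * (n * (Req - \<eta>) + n * (Rp - Req))" by (simp add: algebra_simps)
      also have "\<dots> \<le> log 2 (nW1 c)"
        unfolding l1 using b1 bs bj by (intro add_mono mult_left_mono) auto
      finally have "N * (R1 - \<delta>) \<le> log 2 (nW1 c)" .
      with 1 Npos show ?thesis by (simp add: abs_le_iff field_simps)
    qed
    have equiv: "Req - \<delta> \<le> equivocation W N c"
    proof -
      define X where "X = real B * (n * (Req - \<eta>))"
      have X: "N * (Req - \<eta>) - N * (\<kappa> * (Req - \<eta>)) \<le> X" "X \<le> N * (Req - \<eta>)" "X \<ge> 0"
        unfolding X_def using bc(1-3)[OF N0 h(5)] h(5) by (linarith, linarith, simp)
      have "N * (Req - \<eta>) \<le> N * Q" using hQ(3) by (rule mult_left_mono) simp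
      then have "B * \<epsilon> * X \<le> B * \<epsilon> * (N * Q)"
        using X(2) \<epsilon> by (intro mult_left_mono) auto
      also have "\<dots> \<le> N * (\<delta> / 8)"
        using mult_left_mono[OF B\<epsilon>Q(1), of "real N"] by (simp add: ac_simps)
      finally have 1: "B * \<epsilon> * X \<le> N * (\<delta> / 8)" .
      have "B * (\<epsilon> * n) \<le> N * \<epsilon>" using bc(2)[OF N0, of \<epsilon>] \<epsilon> by (simp add: ac_simps)
      also have "\<dots> \<le> N * (\<delta> / 8)" using \<epsilon>\<delta> by (intro mult_left_mono) auto
      finally have 2: "B * (\<epsilon> * n) \<le> N * (\<delta> / 8)" .
      have "N * (Req - \<delta>) \<le> X - B * \<epsilon> * X - B * (\<epsilon> * n) - 1 / ln 2"
        using \<delta> by (intro slack_bounds(2)[OF _ \<kappa>x[OF hQ(3)] N\<eta>(2)] X(1) 1 2 N8(2)) simp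
      also have "X - B * \<epsilon> * X = (1 - B * \<epsilon>) * X" by (simp add: left_diff_distrib)
      also have "(1 - B * \<epsilon>) * X \<le> (1 - B * \<epsilon>) * (B * log 2 (size_of_rate n (Req - \<eta>)))"
        unfolding X_def using B\<epsilon> bs by (intro mult_left_mono) auto
      finally have "N * (Req - \<delta>) \<le> cEnt (code_joint W c) (\<lambda>(w0, w1, ys, zs). w1) (\<lambda>(w0, w1, ys, zs). zs)"
        using c(6) by linarith
      then show ?thesis using Npos by (simp add: equivocation_def pos_le_divide_eq mult.commute)
    qed
    show ?case
      unfolding near_code_def using c(1,4,5) rate0 rate1 equiv B\<epsilon> \<delta> by (intro exI[of _ c]) auto
  qed
qed

end

text \<open>Fills the finitely many lengths at which no tolerance is available yet; achievability
  demands a valid code for every length.\<close>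

lemma trivial_code: "\<exists>c :: ('x, 'x1, 'y, 'y1, 'z) rbc_code. valid_code N c"
  by (rule exI[of _ "\<lparr>nW0 = 1, nW1 = 1, enc = (\<lambda>_ _. return_pmf (replicate N undefined)), relay = (\<lambda>_. return_pmf undefined),
      dec1 = (\<lambda>_. undefined), dec2 = (\<lambda>_. undefined)\<rparr>"]) (simp add: valid_code_def)

lemma achievable_if_near_codes:
  fixes W :: "'x \<Rightarrow> 'x1 \<Rightarrow> ('y \<times> 'y1 \<times> 'z) pmf"
  assumes R: "R0 > 0" "R1 > 0" "Req > 0"
    and near: "\<And>\<delta>. \<delta> > 0 \<Longrightarrow> \<forall>\<^sub>F N in sequentially. \<exists>c. near_code W R0 R1 Req \<delta> N c"
  shows "achievable W (R0, R1, Req)"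
proof -
  define d where "d = (\<lambda>k::nat. 1 / (real k + 1))"
  have "\<forall>k. \<exists>N0. \<forall>N\<ge>N0. \<exists>c. near_code W R0 R1 Req (d k) N c"
    using near unfolding d_def eventually_sequentially by simp
  then obtain N0 where N0: "\<And>k N. N \<ge> N0 k \<Longrightarrow> \<exists>c. near_code W R0 R1 Req (d k) N c" by metis
  \<comment> \<open>The tolerances available at length \<open>N\<close>. The cap
    \<open>k \<le> N\<close> makes the set finite, so the best one exists; every fixed
    \<open>k\<close> belongs to it eventually.\<close>
  define A where "A = (\<lambda>N. {k. k \<le> N \<and> N0 k \<le> N})"
  define code where "code = (\<lambda>N. if A N = {} then SOME c. valid_code N c
     else SOME c. near_code W R0 R1 Req (d (Max (A N))) N c)"
  have finA: "finite (A N)" for N by (simp add: A_def)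
  have near_mono: "near_code W R0 R1 Req \<delta> N c \<Longrightarrow> \<delta> \<le> \<delta>' \<Longrightarrow> near_code W R0 R1 Req \<delta>' N c" for \<delta> \<delta>' N c
    by (auto simp: near_code_def)
  have code: "near_code W R0 R1 Req (d (Max (A N))) N (code N)" if "A N \<noteq> {}" for N
  proof -
    have "Max (A N) \<in> A N" using finA that by (rule Max_in)
    then have "\<exists>c. near_code W R0 R1 Req (d (Max (A N))) N c" by (intro N0) (simp add: A_def)
    then show ?thesis using that by (auto simp: code_def intro: someI_ex)
  qed
  have valid: "valid_code N (code N)" for N
  proof (cases "A N = {}")
    case True
    then show ?thesis using trivial_code[of N] by (auto simp: code_def intro: someI_ex)
  next
    case False
    then show ?thesis using code by (simp add: near_code_def)
  qed
  have ev: "\<forall>\<^sub>F N in sequentially. near_code W R0 R1 Req \<delta> N (code N)" if "\<delta> > 0" for \<delta>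
  proof -
    obtain k where "1 / real (Suc k) < \<delta>" using nat_approx_posE[of \<delta>] \<open>\<delta> > 0\<close> by blast
    then have k: "d k < \<delta>" by (simp add: d_def add.commute)
    have "near_code W R0 R1 Req \<delta> N (code N)" if "N \<ge> max k (N0 k)" for N
    proof -
      have kA: "k \<in> A N" using that by (simp add: A_def)
      then have "d (Max (A N)) \<le> d k"
        unfolding d_def using finA by (intro divide_left_mono) (auto intro: Max_ge)
      then show ?thesis using code[of N] kA k near_mono by (metis empty_iff less_imp_le order_trans)
    qed
    then show ?thesis unfolding eventually_sequentially by blast
  qed
  have "(\<lambda>N. log 2 (real (nW0 (code N))) / real N) \<longlonglongrightarrow> R0"
  proof (rule tendstoI)
    fix e :: real assume "e > 0"
    then show "\<forall>\<^sub>F N in sequentially. dist (log 2 (real (nW0 (code N))) / real N) R0 < e"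
      by (intro eventually_mono[OF ev[of "e / 2"]]) (auto simp: near_code_def dist_real_def)
  qed
  moreover have "(\<lambda>N. log 2 (real (nW1 (code N))) / real N) \<longlonglongrightarrow> R1"
  proof (rule tendstoI)
    fix e :: real assume "e > 0"
    then show "\<forall>\<^sub>F N in sequentially. dist (log 2 (real (nW1 (code N))) / real N) R1 < e"
      by (intro eventually_mono[OF ev[of "e / 2"]]) (auto simp: near_code_def dist_real_def)
  qed
  moreover have "ereal Req \<le> liminf (\<lambda>N. ereal (equivocation W N (code N)))"
    unfolding le_Liminf_iff
  proof (intro allI impI)
    fix y assume "y < ereal Req"
    then obtain r where r: "y < ereal r" "r < Req" using ereal_dense2[of y "ereal Req"] by auto
    show "\<forall>\<^sub>F N in sequentially. y < ereal (equivocation W N (code N))"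
      using ev[of "Req - r"] r
      by (auto simp: near_code_def elim!: eventually_mono intro: less_le_trans[OF r(1)])
  qed
  moreover have "\<forall>\<^sub>F N in sequentially. Pe1 W (code N) \<le> \<epsilon> \<and> Pe2 W (code N) \<le> \<epsilon>" if "\<epsilon> > 0" for \<epsilon>
    using ev[OF that] by (auto simp: near_code_def elim!: eventually_mono)
  ultimately show ?thesis
    unfolding achievable_def using R valid by blast
qed

lemma Ent_map: "Ent (map_pmf h q) f = Ent q (\<lambda>\<omega>. f (h \<omega>))"
  by (simp add: Ent_def pmf.map_comp o_def)

theorem theorem10:
  fixes W :: "'x::finite \<Rightarrow> 'x1::finite \<Rightarrow> ('y::finite \<times> 'y1::finite \<times> 'z::finite) pmf"
    and PUV :: "('u::finite \<times> 'v::finite) pmf"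
    and PX :: "'u \<Rightarrow> 'v \<Rightarrow> ('x \<times> 'x1) pmf"
    and R0 R1 Req :: real
  defines "q \<equiv> single_letter W PUV PX"
  defines "M \<equiv> min (cMI q (\<lambda>(u,v,x,x1,y,y1,z). u) (\<lambda>(u,v,x,x1,y,y1,z). y1) (\<lambda>(u,v,x,x1,y,y1,z). x1))
                (min (MI q (\<lambda>(u,v,x,x1,y,y1,z). (u, x1)) (\<lambda>(u,v,x,x1,y,y1,z). y))
                     (MI q (\<lambda>(u,v,x,x1,y,y1,z). (u, x1)) (\<lambda>(u,v,x,x1,y,y1,z). z)))"
  assumes "R0 > 0" and "R1 > 0" and "Req > 0"
    and "Req \<le> R1"
    and "R0 \<le> M"
    and "R0 + R1 \<le> M + cMI q (\<lambda>(u,v,x,x1,y,y1,z). v) (\<lambda>(u,v,x,x1,y,y1,z). y) (\<lambda>(u,v,x,x1,y,y1,z). (u, x1))"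
    and "Req \<le> cMI q (\<lambda>(u,v,x,x1,y,y1,z). v) (\<lambda>(u,v,x,x1,y,y1,z). y) (\<lambda>(u,v,x,x1,y,y1,z). (u, x1))
             - cMI q (\<lambda>(u,v,x,x1,y,y1,z). v) (\<lambda>(u,v,x,x1,y,y1,z). z) (\<lambda>(u,v,x,x1,y,y1,z). (u, x1))"
  shows "(R0, R1, Req) \<in> capacity_region W"
proof -
  \<comment> \<open>The input \<open>x\<close> is the only letter outside the codebook: the encoder
    draws it letter by letter from its conditional law given \<open>(x1, u, v)\<close>. This keeps
    the dependence between \<open>x\<close> and \<open>x1\<close>.\<close>
  define m where "m = bind_pmf PUV (\<lambda>(u, v). map_pmf (\<lambda>(x, x1). ((x1, u, v), x)) (PX u v))"
  define pC where "pC = map_pmf fst m"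
  define KX where "KX = kernel_of m"
  define \<pi> :: "'x1 \<times> 'u \<times> 'v \<Rightarrow> 'x1 \<times> 'u" where "\<pi> = (\<lambda>c. (fst c, fst (snd c)))"
  \<comment> \<open>Letters of the layers are \<open>x1\<close>, \<open>(x1, u)\<close>, \<open>(x1, u, v)\<close>, so conditioning on an upper
    layer is conditioning on a function of the lower one.\<close>
  interpret relay_chain W pC KX \<pi> fst .
  have \<phi>: "P = map_pmf (\<lambda>(u, v, x, x1, o'). ((x1, u, v), o')) q"
  proof -
    have "P = bind_pmf (joint (\<lambda>_::unit. pC) KX ()) (\<lambda>(c, x). map_pmf (Pair c) (W x (fst c)))"
      unfolding P_def by (simp add: bind_joint) (simp add: joint_def map_bind_pmf \<pi>_def)
    also have "joint (\<lambda>_::unit. pC) KX () = m"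
      unfolding pC_def KX_def by (rule joint_kernel_of)
    also have "bind_pmf m (\<lambda>(c, x). map_pmf (Pair c) (W x (fst c))) = map_pmf (\<lambda>(u, v, x, x1, o'). ((x1, u, v), o')) q"
      by (simp add: m_def q_def single_letter_def bind_assoc_pmf bind_map_pmf map_bind_pmf pmf.map_comp
          o_def case_prod_unfold)
    finally show ?thesis .
  qed
  have fin: "finite (set_pmf q)" by simp
  have r: "Iab out_y1 = cMI q (\<lambda>(u,v,x,x1,y,y1,z). u) (\<lambda>(u,v,x,x1,y,y1,z). y1) (\<lambda>(u,v,x,x1,y,y1,z). x1)"
    and y: "I0b out_y = MI q (\<lambda>(u,v,x,x1,y,y1,z). (u, x1)) (\<lambda>(u,v,x,x1,y,y1,z). y)"
    and z: "I0b out_z = MI q (\<lambda>(u,v,x,x1,y,y1,z). (u, x1)) (\<lambda>(u,v,x,x1,y,y1,z). z)"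
    and vy: "Ibc out_y = cMI q (\<lambda>(u,v,x,x1,y,y1,z). v) (\<lambda>(u,v,x,x1,y,y1,z). y) (\<lambda>(u,v,x,x1,y,y1,z). (u, x1))"
    and vz: "Ibc out_z = cMI q (\<lambda>(u,v,x,x1,y,y1,z). v) (\<lambda>(u,v,x,x1,y,y1,z). z) (\<lambda>(u,v,x,x1,y,y1,z). (u, x1))"
    \<comment> \<open>Both sides are the same signed sum of entropies, term by term up to a
      regrouping of the variables.\<close>
    unfolding Iab_Ent I0b_Ent Ibc_Ent cMI_def MI_def \<phi> Ent_map
    by (intro arg_cong2[where f="(+)"] arg_cong2[where f="(-)"] Ent_relabel[OF fin]; auto simp: \<pi>_def)+
  have "achievable W (R0, R1, Req)"
  proof (rule achievable_if_near_codes)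
    show "\<forall>\<^sub>F N in sequentially. \<exists>c. near_code W R0 R1 Req \<delta> N c" if "\<delta> > 0" for \<delta>
      by (rule eventually_near_code[of M]) (use assms that in \<open>simp_all add: r y z vy vz\<close>)
  qed (use assms in auto)
  then show ?thesis by (simp add: capacity_region_def)
qed

end
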